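(* Let $X_n$, $n\ge 1$, be a standard stationary Gaussian sequence with correlation function $\rho(n)=\mathbb{E}\{X_1X_{n+1}\}$ satisfying $\lim_{n\to\infty}\rho(n)\ln n=0$. Let $S, S_n$, $n\ge1$, be independent non-negative random variables with common distribution function $F$, independent of the $X_n$'s and of a standard normal random variable $X$ (with $S$ independent of $X$), and suppose that there are constants $L,p>0$ and an ultimately monotone function $g$, regularly varying at infinity with some index $\alpha\in\mathbb{R}$, such that $$\mathbb{P}\{S>u\}=(1+o(1))\,g(u)\exp(-Lu^p),\qquad u\to\infty.$$ Set $Y=SX$ and $Y_n=S_nX_n$. Suppose further that there exist sequences $u_n(x)$, $n\ge1$, $x\in\mathbb{R}$, such that for every $x\in\mathbb{R}$ $$\lim_{n\to\infty} n\,\mathbb{P}\{Y>u_n(x)\}=\exp(-x).$$ Fix $\mathbf{x}=(x_1,x_2)\in\mathbb{R}^2$ and let $\mathbf{N}_n=\mathbf{N}_n(\cdot,\mathbf{x})$ be the bivariate exceedances point process on $\bigcup_{d=1}^2((0,1]\times\{d\})$ built from $Y_1,\dots,Y_n$ and the levels $u_n(x_1)$, $u_n(x_2)$ (defined in the context). Then, as $n\to\infty$, $\mathbf{N}_n$ converges in distribution to a Poisson process $\mathcal{N}$ on $\bigcup_{d=1}^2((0,1]\times\{d\})$ with intensity measure $$\mu(\mathbf{B})=\sum_{d=1}^2\exp(-x_d)\,m(B_d),\qquad \mathbf{B}=\bigcup_{d=1}^2(B_d\times\{d\}),$$ where $m$ denotes Lebesgue measure on $(0,1]$.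
   Context: A standard stationary Gaussian sequence is a (jointly) Gaussian sequence $X_n$, $n\ge1$, in which each $X_n$ is $N(0,1)$ distributed and $\rho(n)=\mathbb{E}\{X_1X_{n+1}\}=\mathbb{E}\{X_jX_{n+j}\}$ for all $j\ge1$. A function $g$ is regularly varying at infinity with index $\alpha$ if $\lim_{t\to\infty}g(tx)/g(t)=x^\alpha$ for all $x>0$. Bivariate exceedances point process: with $\xi_1(i)=Y_i$ and $\xi_2(i)=-Y_i$, for Borel sets $B_1,B_2\subset(0,1]$ and $\mathbf{B}=\bigcup_{d=1}^2(B_d\times\{d\})$, $$\mathbf{N}_n(\mathbf{B},\mathbf{x})=\sum_{d=1}^2\sum_{i=1}^n \mathbb{I}\left(\xi_d(i)>u_n(x_d),\ \tfrac{i}{n}\in B_d\right),$$ where $\mathbb{I}(\cdot)$ is the indicator function. *)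

theory Defs
  imports "HOL-Probability.Probability" "HOL-Library.Landau_Symbols"
begin

section \<open>Gaussian sequences and regular variation\<close>

text \<open>A constant (the case \<open>s = 0\<close>) counts as normal, as usual in the definition of joint normality.\<close>

definition normal_rv :: "'a measure \<Rightarrow> ('a \<Rightarrow> real) \<Rightarrow> bool" where
  "normal_rv M Z \<longleftrightarrow> Z \<in> borel_measurable M \<and>
     (\<exists>m s. 0 \<le> s \<and>
        distr M borel Z = (if s = 0 then return borel m else density lborel (normal_density m s)))"

definition jointly_gaussian :: "'a measure \<Rightarrow> 'i set \<Rightarrow> ('i \<Rightarrow> 'a \<Rightarrow> real) \<Rightarrow> bool" where
  "jointly_gaussian M I X \<longleftrightarrow>
     (\<forall>J a. finite J \<and> J \<subseteq> I \<longrightarrow> normal_rv M (\<lambda>\<omega>. \<Sum>j\<in>J. a j * X j \<omega>))"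

text \<open>Sequences are indexed by \<open>n \<ge> 1\<close>; the values \<open>X 0\<close> and \<open>\<rho> 0\<close> are irrelevant.\<close>

definition standard_stationary_gaussian ::
    "'a measure \<Rightarrow> (nat \<Rightarrow> 'a \<Rightarrow> real) \<Rightarrow> (nat \<Rightarrow> real) \<Rightarrow> bool" where
  "standard_stationary_gaussian M X \<rho> \<longleftrightarrow>
     jointly_gaussian M {1..} X \<and>
     (\<forall>n\<ge>1. distributed M lborel (X n) std_normal_density) \<and>
     (\<forall>j\<ge>1. \<forall>n\<ge>1. (LINT \<omega>|M. X j \<omega> * X (n + j) \<omega>) = \<rho> n)"

definition regularly_varying :: "(real \<Rightarrow> real) \<Rightarrow> real \<Rightarrow> bool" where
  "regularly_varying g \<alpha> \<longleftrightarrow> (\<forall>x>0. ((\<lambda>t. g (t * x) / g t) \<longlongrightarrow> x powr \<alpha>) at_top)"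

definition ultimately_monotone :: "(real \<Rightarrow> real) \<Rightarrow> bool" where
  "ultimately_monotone g \<longleftrightarrow>
     (\<exists>t0. mono_on {t0..} g \<or> monotone_on {t0..} (\<le>) (\<ge>) g)"

section \<open>Point processes and convergence in distribution\<close>

definition point_measures :: "'e::topological_space set \<Rightarrow> 'e measure set" where
  "point_measures E = {\<nu>. sets \<nu> = sets (restrict_space borel E) \<and>
     (\<forall>K. compact K \<and> K \<subseteq> E \<longrightarrow> emeasure \<nu> K < \<infinity>) \<and>
     (\<forall>B\<in>sets \<nu>. \<exists>k::enat. emeasure \<nu> B = ennreal_of_enat k)}"

definition compactly_supported_on :: "'e::topological_space set \<Rightarrow> ('e \<Rightarrow> real) set" where
  "compactly_supported_on E = {f. continuous_on E f \<and>
     (\<exists>K. compact K \<and> K \<subseteq> E \<and> (\<forall>x\<in>E - K. f x = 0))}"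

definition vague_topology :: "'e::topological_space set \<Rightarrow> 'e measure topology" where
  "vague_topology E = topology_generated_by
     {{\<nu> \<in> point_measures E. (LINT x|\<nu>. f x) \<in> U} | f U. f \<in> compactly_supported_on E \<and> open U}"

definition borel_algebra_of :: "'b topology \<Rightarrow> 'b measure" where
  "borel_algebra_of T = sigma (topspace T) {U. openin T U}"

text \<open>Weak convergence of the laws of random elements of a topological space; the limit may live on
  another probability space.\<close>

definition converges_in_distribution ::
    "'b topology \<Rightarrow> 'a measure \<Rightarrow> (nat \<Rightarrow> 'a \<Rightarrow> 'b) \<Rightarrow> 'c measure \<Rightarrow> ('c \<Rightarrow> 'b) \<Rightarrow> bool" where
  "converges_in_distribution T M X Q Z \<longleftrightarrow>
     (\<forall>n. X n \<in> M \<rightarrow>\<^sub>M borel_algebra_of T) \<and> Z \<in> Q \<rightarrow>\<^sub>M borel_algebra_of T \<and>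
     (\<forall>h. continuous_map T euclideanreal h \<and> (\<exists>c. \<forall>\<nu>\<in>topspace T. \<bar>h \<nu>\<bar> \<le> c) \<longrightarrow>
        (\<lambda>n. LINT \<omega>|M. h (X n \<omega>)) \<longlonglongrightarrow> (LINT \<omega>|Q. h (Z \<omega>)))"

definition poisson_process ::
    "'c measure \<Rightarrow> 'e::topological_space set \<Rightarrow> 'e measure \<Rightarrow> ('c \<Rightarrow> 'e measure) \<Rightarrow> bool" where
  "poisson_process Q E \<mu> N \<longleftrightarrow>
     N \<in> Q \<rightarrow>\<^sub>M borel_algebra_of (vague_topology E) \<and>
     (\<forall>B\<in>sets (restrict_space borel E). emeasure \<mu> B < \<infinity> \<longrightarrow>
        (\<forall>k::nat. measure Q {\<omega>\<in>space Q. emeasure (N \<omega>) B = of_nat k}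
           = exp (- measure \<mu> B) * measure \<mu> B ^ k / fact k)) \<and>
     (\<forall>(n::nat) B. (\<forall>i<n. B i \<in> sets (restrict_space borel E)) \<and> disjoint_family_on B {..<n} \<longrightarrow>
        prob_space.indep_vars Q (\<lambda>_. borel) (\<lambda>i \<omega>. emeasure (N \<omega>) (B i)) {..<n})"

section \<open>The bivariate exceedances point process\<close>

text \<open>A vector \<open>(x\<^sub>1, x\<^sub>2)\<close> is a function \<open>x :: nat \<Rightarrow> real\<close> of which only \<open>x 1\<close> and \<open>x 2\<close> are used.
  For \<open>B = B\<^sub>1 \<times> {1} \<union> B\<^sub>2 \<times> {2}\<close> the section \<open>{t. (t, d) \<in> B}\<close> is \<open>B\<^sub>d\<close>.\<close>

definition bivariate_space :: "(real \<times> nat) set" where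
  "bivariate_space = (\<Union>d\<in>{1, 2}. {0<..1} \<times> {d})"

definition xi :: "nat \<Rightarrow> real \<Rightarrow> real" where
  "xi d y = (if d = 1 then y else - y)"

definition exceedances ::
    "(nat \<Rightarrow> real \<Rightarrow> real) \<Rightarrow> (nat \<Rightarrow> real) \<Rightarrow> (nat \<Rightarrow> real) \<Rightarrow> nat \<Rightarrow> (real \<times> nat) measure" where
  "exceedances u x y n =
     measure_of bivariate_space (sets (restrict_space borel bivariate_space))
       (\<lambda>B. \<Sum>d\<in>{1, 2}. \<Sum>i\<in>{1..n}.
          if xi d (y i) > u n (x d) \<and> (real i / real n, d) \<in> B then 1 else 0)"

definition intensity :: "(nat \<Rightarrow> real) \<Rightarrow> (real \<times> nat) measure" where
  "intensity x =
     measure_of bivariate_space (sets (restrict_space borel bivariate_space))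
       (\<lambda>B. \<Sum>d\<in>{1, 2}. ennreal (exp (- x d)) * emeasure lborel {t. (t, d) \<in> B})"

text \<open>The set functions above are countably additive, so \<open>measure_of\<close> does not collapse to the null
  measure.\<close>

lemma space_bivariate: "space (restrict_space borel bivariate_space) = bivariate_space"
  by (simp add: space_restrict_space)

lemma section_borel:
  assumes "B \<in> sets (restrict_space borel bivariate_space)"
  shows "{t. (t, d) \<in> B} \<in> sets borel"
proof -
  have "bivariate_space = {0<..1} \<times> {1, 2}"
    by (auto simp: bivariate_space_def)
  moreover have "{0<..1::real} \<times> {1, 2::nat} \<in> sets borel"
    by (intro borel_Times) auto
  ultimately have "B \<in> sets borel"
    using assms by (auto simp: sets_restrict_space)
  then have "(\<lambda>t. (t, d)) -` B \<inter> space borel \<in> sets (borel :: real measure)"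
    by (intro measurable_sets[OF borel_measurable_continuous_onI]) (auto intro!: continuous_intros)
  then show ?thesis by (simp add: vimage_def)
qed

lemma emeasure_exceedances:
  assumes "B \<in> sets (restrict_space borel bivariate_space)"
  shows "emeasure (exceedances u x y n) B = (\<Sum>d\<in>{1, 2}. \<Sum>i\<in>{1..n}.
          if xi d (y i) > u n (x d) \<and> (real i / real n, d) \<in> B then 1 else 0)"
proof -
  let ?A = "sets (restrict_space borel bivariate_space)"
  let ?f = "\<lambda>d i B. if xi d (y i) > u n (x d) \<and> (real i / real n, d) \<in> B then 1 else 0 :: ennreal"
  have f: "?f d i B = (if xi d (y i) > u n (x d) then indicator B (real i / real n, d) else 0)" for d i B
    by (auto simp: indicator_def)
  have "countably_additive ?A (\<lambda>B. \<Sum>d\<in>{1, 2}. \<Sum>i\<in>{1..n}. ?f d i B)"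
    unfolding countably_additive_def f
  proof safe
    fix A :: "nat \<Rightarrow> (real \<times> nat) set"
    assume A: "disjoint_family A"
    let ?g = "\<lambda>d i B. (if xi d (y i) > u n (x d) then indicator B (real i / real n, d) else 0) :: ennreal"
    have 1: "(\<Sum>k. ?g d i (A k)) = ?g d i (\<Union>k. A k)" for d i
      using suminf_indicator[OF A] by auto
    show "(\<Sum>k. \<Sum>d\<in>{1, 2}. \<Sum>i\<in>{1..n}. ?g d i (A k)) = (\<Sum>d\<in>{1, 2}. \<Sum>i\<in>{1..n}. ?g d i (\<Union>k. A k))"
      by (simp only: suminf_sum[OF summableI] 1)
  qed
  then show ?thesis
    unfolding exceedances_def
    using assms sets.sigma_algebra_axioms[of "restrict_space borel bivariate_space"]
    by (subst emeasure_measure_of_sigma) (auto simp: space_bivariate positive_def)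
qed

lemma emeasure_intensity:
  assumes "B \<in> sets (restrict_space borel bivariate_space)"
  shows "emeasure (intensity x) B
    = (\<Sum>d\<in>{1, 2}. ennreal (exp (- x d)) * emeasure lborel {t. (t, d) \<in> B})"
proof -
  let ?A = "sets (restrict_space borel bivariate_space)"
  have "countably_additive ?A
     (\<lambda>B. \<Sum>d\<in>{1, 2}. ennreal (exp (- x d)) * emeasure lborel {t. (t, d) \<in> B})"
    unfolding countably_additive_def
  proof safe
    fix A :: "nat \<Rightarrow> (real \<times> nat) set"
    assume A: "disjoint_family A" "range A \<subseteq> ?A"
    have 1: "(\<Sum>k. emeasure lborel {t. (t, d) \<in> A k}) = emeasure lborel {t. (t, d) \<in> (\<Union>k. A k)}" for d
    proof -
      have "(\<Sum>k. emeasure lborel {t. (t, d) \<in> A k}) = emeasure lborel (\<Union>k. {t. (t, d) \<in> A k})"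
        using A by (intro suminf_emeasure) (auto simp: section_borel disjoint_family_on_def)
      also have "(\<Union>k. {t. (t, d) \<in> A k}) = {t. (t, d) \<in> (\<Union>k. A k)}" by auto
      finally show ?thesis .
    qed
    show "(\<Sum>k. \<Sum>d\<in>{1, 2}. ennreal (exp (- x d)) * emeasure lborel {t. (t, d) \<in> A k})
       = (\<Sum>d\<in>{1, 2}. ennreal (exp (- x d)) * emeasure lborel {t. (t, d) \<in> (\<Union>k. A k)})"
      by (simp only: suminf_sum[OF summableI] ennreal_suminf_cmult 1)
  qed
  then show ?thesis
    unfolding intensity_def
    using assms sets.sigma_algebra_axioms[of "restrict_space borel bivariate_space"]
    by (subst emeasure_measure_of_sigma) (auto simp: space_bivariate positive_def)
qed

lemma topspace_vague: "topspace (vague_topology E) = point_measures E"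
proof -
  have "(\<lambda>_. 0) \<in> compactly_supported_on E"
    by (auto simp: compactly_supported_on_def intro!: exI[of _ "{}"])
  then show ?thesis
    unfolding vague_topology_def topology_generated_by_topspace
    by (auto intro!: exI[of _ "point_measures E"] exI[of _ "\<lambda>_. 0"] exI[of _ UNIV])
qed

lemma exceedances_point_measure: "exceedances u x y n \<in> point_measures bivariate_space"
proof -
  have s: "sets (exceedances u x y n) = sets (restrict_space borel bivariate_space)"
    unfolding exceedances_def
    using sets.sigma_sets_eq[of "restrict_space borel bivariate_space"]
      sets.space_closed[of "restrict_space borel bivariate_space"]
    by (simp add: space_bivariate)
  have e: "\<exists>k::nat. emeasure (exceedances u x y n) B = of_nat k" for B
  proof (cases "B \<in> sets (restrict_space borel bivariate_space)")
    case True
    have "emeasure (exceedances u x y n) B = of_nat (\<Sum>d\<in>{1, 2}. \<Sum>i\<in>{1..n}.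
          if xi d (y i) > u n (x d) \<and> (real i / real n, d) \<in> B then 1 else 0)"
      unfolding emeasure_exceedances[OF True] of_nat_sum by (intro sum.cong refl) auto
    then show ?thesis by blast
  next
    case False
    then show ?thesis by (intro exI[of _ 0]) (simp add: emeasure_notin_sets s)
  qed
  have "\<exists>k::enat. emeasure (exceedances u x y n) B = ennreal_of_enat k" for B
    using e[of B] by (metis ennreal_of_enat_enat)
  moreover have "emeasure (exceedances u x y n) B < \<infinity>" for B
    using e[of B] by (auto simp: of_nat_less_top)
  ultimately show ?thesis
    by (simp add: point_measures_def s)
qed

end

theory Submission
  imports Defs "HOL-Real_Asymp.Real_Asymp"
begin

text \<open>Set \<open>b\<^sub>n = 2 sqrt (ln n)\<close>, so that with probability tending to one all of \<open>X\<^sub>1, \<dots>, X\<^sub>n\<close> are bounded by \<open>b\<^sub>n\<close>;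
  exceedances with \<open>\<bar>X\<^sub>i\<bar> > b\<^sub>n\<close> are discarded. Conditionally on the scales, the remaining exceedances at distinct indices
  \<open>i\<^sub>1, \<dots>, i\<^sub>j\<close> form a rectangle event for a Gaussian vector. If the correlations are at most \<open>\<epsilon> / ln n\<close>, then on
  the cube of side \<open>b\<^sub>n\<close> conditioning on one coordinate at a time compares the joint density with the product of
  standard normal densities up to a factor \<open>exp (O (\<epsilon>))\<close>. This covers all indices at mutual distance at least \<open>n\<close> to a
  small power. An index close to another one forces its scale to exceed \<open>u\<^sub>n / b\<^sub>n\<close>, which by the Weibull tail of \<open>S\<close>
  has probability at most \<open>n\<close> to a fixed negative power, so such clusters are negligible. Hence the probabilities that
  \<open>j\<close> given marked indices all exceed factorize in the sum over all \<open>j\<close>-tuples.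

  Given this, a bounded vaguely continuous functional of the exceedance process is expanded over finite sets of
  indices by Moebius inversion. Each term converges as a Riemann sum, Bonferroni-type bounds control the truncation,
  and the limit is the expectation under a Poisson number of independent points.\<close>

section \<open>Uniqueness for weighted characteristic functions\<close>

text \<open>With the scales frozen, the exceedance sets of the \<open>X\<close> are Borel sets of
  uncontrolled probability, so an additive error in the comparison with independence would be
  useless after integration over the scales. A multiplicative one is not: the factor leaves the
  integral, and independence of the scales splits the rest. This is why the Gaussian estimate is a
  ratio of densities, and why it is confined to a cube, since on the whole space the ratio is not
  close to one. The constant 2 in \<open>b\<^sub>n\<close> makes the discarded part of total
  probability \<open>O (1 / n)\<close>. At short distances no smallness of the correlations is
  available, so the Gaussian factors of clustered indices are dropped and only their scales are
  used. If a large scale costs \<open>n\<close> to the power \<open>- \<delta>\<close>, indices may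
  be called close up to distance \<open>n\<close> to the power \<open>\<delta> / 2\<close>: the
  number of neighbours times the cost still vanishes. Factorization is needed as a total variation
  statement, a sum of absolute differences over all tuples, because the functional is only bounded
  and vaguely continuous and has no product structure to exploit.\<close>

lemma bounded_integrable:
  fixes f :: "'a \<Rightarrow> 'b::{banach, second_countable_topology}"
  assumes "prob_space M" "f \<in> borel_measurable M" "\<And>\<omega>. norm (f \<omega>) \<le> C"
  shows "integrable M f"
proof -
  interpret prob_space M by fact
  show ?thesis by (rule integrable_const_bound[of _ C]) (use assms in auto)
qed

lemma prob_std_normal: "prob_space std_normal_distribution"
  by (rule prob_space_normal_density) simp

section \<open>Gaussian smoothing and Fourier inversion in one coordinate\<close>

text \<open>The Gaussian kernel is its own Fourier transform, hence an average of the characters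
  \<open>iexp (r * z)\<close> over a standard normal \<open>z\<close>. By Fubini a Gaussian average
  of \<open>W\<close> around \<open>y\<close> depends on \<open>X\<close> and \<open>W\<close> only
  through the weighted characteristic function.\<close>

lemma gauss_kernel_Fourier:
  assumes M: "prob_space M" and X[measurable]: "X \<in> borel_measurable M" and W[measurable]: "W \<in> borel_measurable M"
    and C: "\<And>\<omega>. cmod (W \<omega>) \<le> C"
  shows "(CLINT \<omega>|M. of_real (exp (- (s * (X \<omega> - y))\<^sup>2 / 2)) * W \<omega>) =
    (CLINT z|std_normal_distribution. iexp (- s * z * y) * (CLINT \<omega>|M. iexp (s * z * X \<omega>) * W \<omega>))"
proof -
  interpret M: prob_space M by fact
  interpret N: prob_space std_normal_distribution by (rule prob_std_normal)
  interpret P: pair_prob_space M std_normal_distribution ..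
  have [measurable]: "(\<lambda>x. x) \<in> borel_measurable std_normal_distribution" by simp
  have k: "complex_of_real (exp (- r\<^sup>2 / 2)) = (CLINT z|std_normal_distribution. iexp (r * z))" for r
    using fun_cong[OF char_std_normal_distribution, of r] by (simp add: char_def)
  have "(CLINT \<omega>|M. of_real (exp (- (s * (X \<omega> - y))\<^sup>2 / 2)) * W \<omega>) =
      (CLINT \<omega>|M. (CLINT z|std_normal_distribution. iexp (s * (X \<omega> - y) * z) * W \<omega>))"
    unfolding k by simp
  also have "\<dots> = (CLINT z|std_normal_distribution. (CLINT \<omega>|M. iexp (s * (X \<omega> - y) * z) * W \<omega>))"
  proof (rule P.Fubini_integral[symmetric])
    show "integrable (M \<Otimes>\<^sub>M std_normal_distribution) (\<lambda>(\<omega>, z). iexp (s * (X \<omega> - y) * z) * W \<omega>)"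
      by (rule bounded_integrable[where C = C])
        (use C in \<open>auto simp: norm_mult split_beta' intro!: P.prob_space_axioms\<close>)
  qed
  also have "\<dots> = (CLINT z|std_normal_distribution. iexp (- s * z * y) * (CLINT \<omega>|M. iexp (s * z * X \<omega>) * W \<omega>))"
  proof (rule Bochner_Integration.integral_cong[OF refl])
    fix z
    have e: "iexp (s * (X \<omega> - y) * z) * W \<omega> = iexp (- s * z * y) * (iexp (s * z * X \<omega>) * W \<omega>)" for \<omega>
      unfolding mult.assoc[symmetric] exp_add[symmetric]
      by (intro arg_cong2[where f = "(*)"] arg_cong[where f = exp] refl) (simp add: algebra_simps)
    show "(CLINT \<omega>|M. iexp (s * (X \<omega> - y) * z) * W \<omega>) = iexp (- s * z * y) * (CLINT \<omega>|M. iexp (s * z * X \<omega>) * W \<omega>)"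
      unfolding e by (rule integral_mult_right_zero)
  qed
  finally show ?thesis .
qed

text \<open>The substitution \<open>y = X \<omega> + z / s\<close> turns the noise added to
  \<open>X\<close> into a Gaussian kernel around \<open>y\<close>. Integrability of \<open>f\<close>
  lets the integral over the line be taken outside; with \<open>gauss_kernel_Fourier\<close> the
  smoothed expectation becomes a function of the weighted characteristic function alone.\<close>

lemma gauss_smoothing:
  assumes M: "prob_space M" and X[measurable]: "X \<in> borel_measurable M" and W[measurable]: "W \<in> borel_measurable M"
    and C: "\<And>\<omega>. cmod (W \<omega>) \<le> C" and f: "integrable lborel f" and s: "s > 0"
  shows "(CLINT \<omega>|M. of_real (LINT z|std_normal_distribution. f (X \<omega> + z / s)) * W \<omega>) =
     (CLINT y|lborel. of_real (f y * s / sqrt (2 * pi)) * (CLINT \<omega>|M. of_real (exp (- (s * (X \<omega> - y))\<^sup>2 / 2)) * W \<omega>))"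
proof -
  interpret M: prob_space M by fact
  interpret P: pair_sigma_finite M lborel ..
  have [measurable]: "f \<in> borel_measurable borel" using borel_measurable_integrable[OF f] by simp
  have 1: "(LINT z|std_normal_distribution. f (a + z / s)) =
    (LINT y|lborel. f y * (s / sqrt (2 * pi)) * exp (- (s * (a - y))\<^sup>2 / 2))" for a
  proof -
    have "(LINT z|std_normal_distribution. f (a + z / s)) = (LINT z|lborel. std_normal_density z * f (a + z / s))"
      by (subst integral_density) auto
    also have "\<dots> = \<bar>s\<bar> *\<^sub>R (LINT y|lborel. std_normal_density (- s * a + s * y) * f (a + (- s * a + s * y) / s))"
      using s by (intro lborel_integral_real_affine) auto
    also have "\<dots> = (LINT y|lborel. f y * (s / sqrt (2 * pi)) * exp (- (s * (a - y))\<^sup>2 / 2))"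
    proof -
      have "(- s * a + s * y)\<^sup>2 = (s * (a - y))\<^sup>2" for y by algebra
      moreover have "a + (- s * a + s * y) / s = y" for y using s by (simp add: field_simps)
      ultimately show ?thesis using s
        by (simp add: std_normal_density_def integral_mult_right_zero[symmetric] mult_ac del: integral_mult_right_zero)
    qed
    finally show ?thesis .
  qed
  let ?g = "\<lambda>y \<omega>. complex_of_real (f y * (s / sqrt (2 * pi)) * exp (- (s * (X \<omega> - y))\<^sup>2 / 2)) * W \<omega>"
  have "(CLINT \<omega>|M. of_real (LINT z|std_normal_distribution. f (X \<omega> + z / s)) * W \<omega>) = (CLINT \<omega>|M. CLINT y|lborel. ?g y \<omega>)"
    unfolding 1 by (simp del: of_real_mult add: integral_complex_of_real)
  also have "\<dots> = (CLINT y|lborel. CLINT \<omega>|M. ?g y \<omega>)"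
  proof (rule P.Fubini_integral[symmetric])
    have i: "integrable (M \<Otimes>\<^sub>M lborel) (\<lambda>(\<omega>, y). f y * (s / sqrt (2 * pi)) * C)"
    proof (rule P.Fubini_integrable)
      show "(\<lambda>(\<omega>, y). f y * (s / sqrt (2 * pi)) * C) \<in> borel_measurable (M \<Otimes>\<^sub>M lborel)" by measurable
    qed (use f in auto)
    show "integrable (M \<Otimes>\<^sub>M lborel) (\<lambda>(\<omega>, y). ?g y \<omega>)"
    proof (rule Bochner_Integration.integrable_bound[OF i])
      show "(\<lambda>(\<omega>, y). ?g y \<omega>) \<in> borel_measurable (M \<Otimes>\<^sub>M lborel)" by measurable
      have "cmod (?g y \<omega>) \<le> norm (f y * (s / sqrt (2 * pi)) * C)" for y \<omega>
      proof -
        have "0 \<le> C" using C[of \<omega>] norm_ge_zero order_trans by blast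
        have "exp (- (s * (X \<omega> - y))\<^sup>2 / 2) \<le> 1" by simp
        then have "exp (- (s * (X \<omega> - y))\<^sup>2 / 2) * cmod (W \<omega>) \<le> 1 * C"
          using C[of \<omega>] by (intro mult_mono) auto
        then have "\<bar>f y * (s / sqrt (2 * pi))\<bar> * (exp (- (s * (X \<omega> - y))\<^sup>2 / 2) * cmod (W \<omega>)) \<le> \<bar>f y * (s / sqrt (2 * pi))\<bar> * C"
          by (intro mult_left_mono) auto
        then show ?thesis using \<open>0 \<le> C\<close> s
          by (simp add: norm_mult abs_mult norm_divide mult_ac del: of_real_mult of_real_divide)
      qed
      then show "AE x in M \<Otimes>\<^sub>M lborel. norm (case x of (\<omega>, y) \<Rightarrow> ?g y \<omega>) \<le> norm (case x of (\<omega>, y) \<Rightarrow> f y * (s / sqrt (2 * pi)) * C)"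
        by (auto simp: split_beta')
    qed
  qed
  also have "\<dots> = (CLINT y|lborel. of_real (f y * s / sqrt (2 * pi)) * (CLINT \<omega>|M. of_real (exp (- (s * (X \<omega> - y))\<^sup>2 / 2)) * W \<omega>))"
    by (intro Bochner_Integration.integral_cong refl)
      (simp add: integral_mult_right_zero[symmetric] mult_ac del: integral_mult_right_zero)
  finally show ?thesis .
qed

text \<open>The noise \<open>z / (n + 1)\<close> disappears in the limit; dominated convergence is
  applied first over \<open>z\<close> and then over \<open>\<omega>\<close>.\<close>

lemma smoothing_limit:
  assumes M: "prob_space M" and X[measurable]: "X \<in> borel_measurable M" and W[measurable]: "W \<in> borel_measurable M"
    and C: "\<And>\<omega>. cmod (W \<omega>) \<le> C" and f: "continuous_on UNIV f" "\<And>y. \<bar>f y\<bar> \<le> K"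
  shows "(\<lambda>n. CLINT \<omega>|M. of_real (LINT z|std_normal_distribution. f (X \<omega> + z / real (Suc n))) * W \<omega>)
     \<longlonglongrightarrow> (CLINT \<omega>|M. of_real (f (X \<omega>)) * W \<omega>)"
proof -
  interpret M: prob_space M by fact
  interpret N: prob_space std_normal_distribution by (rule prob_std_normal)
  have [measurable]: "f \<in> borel_measurable borel" using f(1) by (rule borel_measurable_continuous_onI)
  have [measurable]: "(\<lambda>x. x) \<in> borel_measurable std_normal_distribution" by simp
  have K: "0 \<le> K" using f(2)[of 0] by simp
  have b: "\<bar>LINT z|std_normal_distribution. f (a + z / real (Suc n))\<bar> \<le> K" for a n
  proof -
    have "\<bar>LINT z|std_normal_distribution. f (a + z / real (Suc n))\<bar> \<le> (LINT z|std_normal_distribution. K)"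
      using N.prob_space_axioms f(2) by (intro integral_abs_bound_integral) (auto intro!: bounded_integrable[where C = K])
    then show ?thesis by (simp add: N.prob_space[simplified])
  qed
  have l: "(\<lambda>n. LINT z|std_normal_distribution. f (a + z / real (Suc n))) \<longlonglongrightarrow> f a" for a
  proof -
    have "(\<lambda>n. LINT z|std_normal_distribution. f (a + z / real (Suc n))) \<longlonglongrightarrow> (LINT z|std_normal_distribution. f (a + 0))"
    proof (rule integral_dominated_convergence[where w = "\<lambda>_. K"])
      show "AE z in std_normal_distribution. (\<lambda>n. f (a + z / real (Suc n))) \<longlonglongrightarrow> f (a + 0)"
      proof (rule AE_I2)
        fix z :: real
        have "(\<lambda>n. a + z / real (Suc n)) \<longlonglongrightarrow> a + 0"
          by (intro tendsto_add tendsto_const LIMSEQ_Suc lim_const_over_n)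
        then show "(\<lambda>n. f (a + z / real (Suc n))) \<longlonglongrightarrow> f (a + 0)"
          by (rule continuous_on_tendsto_compose[OF f(1)]) auto
      qed
    qed (use f in auto)
    then show ?thesis by (simp add: N.prob_space[simplified])
  qed
  show ?thesis
  proof (rule integral_dominated_convergence[where w = "\<lambda>_. K * C"])
    show "AE \<omega> in M. (\<lambda>n. complex_of_real (LINT z|std_normal_distribution. f (X \<omega> + z / real (Suc n))) * W \<omega>) \<longlonglongrightarrow> of_real (f (X \<omega>)) * W \<omega>"
      using l by (auto intro!: tendsto_intros)
    show "AE \<omega> in M. cmod (complex_of_real (LINT z|std_normal_distribution. f (X \<omega> + z / real (Suc n))) * W \<omega>) \<le> K * C" for n
      using C b K by (auto simp: norm_mult intro!: mult_mono)
  qed auto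
qed

lemma weighted_char_unique_cont:
  assumes M: "prob_space M" "X \<in> borel_measurable M" "W \<in> borel_measurable M" "\<And>\<omega>. cmod (W \<omega>) \<le> C"
    and M': "prob_space M'" "X' \<in> borel_measurable M'" "W' \<in> borel_measurable M'" "\<And>\<omega>. cmod (W' \<omega>) \<le> C'"
    and eq: "\<And>t. (CLINT \<omega>|M. iexp (t * X \<omega>) * W \<omega>) = (CLINT \<omega>|M'. iexp (t * X' \<omega>) * W' \<omega>)"
    and f: "continuous_on UNIV f" "\<And>y. \<bar>f y\<bar> \<le> K" "integrable lborel f"
  shows "(CLINT \<omega>|M. of_real (f (X \<omega>)) * W \<omega>) = (CLINT \<omega>|M'. of_real (f (X' \<omega>)) * W' \<omega>)"
proof (rule LIMSEQ_unique[OF smoothing_limit[OF M f(1,2)]])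
  have "(CLINT \<omega>|M. of_real (LINT z|std_normal_distribution. f (X \<omega> + z / real (Suc n))) * W \<omega>) =
    (CLINT \<omega>|M'. of_real (LINT z|std_normal_distribution. f (X' \<omega> + z / real (Suc n))) * W' \<omega>)" for n
    unfolding gauss_smoothing[OF M f(3) of_nat_0_less_iff[THEN iffD2, OF zero_less_Suc]]
      gauss_smoothing[OF M' f(3) of_nat_0_less_iff[THEN iffD2, OF zero_less_Suc]]
      gauss_kernel_Fourier[OF M] gauss_kernel_Fourier[OF M'] eq ..
  then show "(\<lambda>n. CLINT \<omega>|M. of_real (LINT z|std_normal_distribution. f (X \<omega> + z / real (Suc n))) * W \<omega>)
     \<longlonglongrightarrow> (CLINT \<omega>|M'. of_real (f (X' \<omega>)) * W' \<omega>)"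
    using smoothing_limit[OF M' f(1,2)] by simp
qed

text \<open>The weight \<open>W\<close> carries indicators of the coordinates already treated, so that the characteristic
  function of a vector can be inverted one coordinate at a time.\<close>

lemma weighted_char_unique:
  assumes M: "prob_space M" "X \<in> borel_measurable M" "W \<in> borel_measurable M" "\<And>\<omega>. cmod (W \<omega>) \<le> C"
    and M': "prob_space M'" "X' \<in> borel_measurable M'" "W' \<in> borel_measurable M'" "\<And>\<omega>. cmod (W' \<omega>) \<le> C'"
    and eq: "\<And>t. (CLINT \<omega>|M. iexp (t * X \<omega>) * W \<omega>) = (CLINT \<omega>|M'. iexp (t * X' \<omega>) * W' \<omega>)"
    and B: "B \<in> sets borel"
  shows "(CLINT \<omega>|M. indicator B (X \<omega>) * W \<omega>) = (CLINT \<omega>|M'. indicator B (X' \<omega>) * W' \<omega>)"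
proof -
  have [measurable]: "X \<in> borel_measurable M" "W \<in> borel_measurable M" "X' \<in> borel_measurable M'" "W' \<in> borel_measurable M'"
    by fact+
  define G where "G = range (\<lambda>(a, b). {a..b::real})"
  have B': "B \<in> sigma_sets UNIV G"
    using B by (subst (asm) borel_eq_atLeastAtMost) (simp add: G_def)
  have mb: "A \<in> sigma_sets UNIV G \<Longrightarrow> A \<in> sets borel" for A
    by (subst borel_eq_atLeastAtMost) (simp add: G_def)
  show ?thesis
    using B'
  proof (induction rule: sigma_sets_induct_disjoint[OF _ _ B'])
    case 1
    have "{a..b} \<inter> {c..d} = {max a c..min b d}" for a b c d :: real by auto
    then show ?case unfolding G_def Int_stable_def by auto
  next
    case 2 show ?case by simp
  next
    case (3 A)
    then obtain a b where A: "A = {a..b}" by (auto simp: G_def)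
    \<comment> \<open>Trapezoids around the interval: 1 on it, with slopes of width
      \<open>1 / (n + 1)\<close>, hence continuous, integrable and convergent to its
      indicator.\<close>
    define f where "f n y = max 0 (min 1 (1 - real (Suc n) * max (a - y) (y - b)))" for n y
    have f01: "0 \<le> f n y" "f n y \<le> 1" for n y by (auto simp: f_def)
    have fc: "continuous_on UNIV (f n)" for n unfolding f_def[abs_def] by (intro continuous_intros)
    have fz: "f n y = 0" if "y \<notin> {a-1..b+1}" for n y
    proof -
      have "1 \<le> max (a - y) (y - b)" using that by auto
      then have "1 * 1 \<le> real (Suc n) * max (a - y) (y - b)" by (intro mult_mono) auto
      then show ?thesis by (simp add: f_def)
    qed
    have fi: "integrable lborel (f n)" for n
    proof (rule Bochner_Integration.integrable_bound[where f = "indicator {a-1..b+1} :: real \<Rightarrow> real"])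
      show "f n \<in> borel_measurable lborel" using borel_measurable_continuous_onI[OF fc] by simp
      show "AE x in lborel. norm (f n x) \<le> norm (indicator {a - 1..b + 1} x :: real)"
        using f01 fz by (auto simp: indicator_def)
    qed (simp add: integrable_indicator_iff emeasure_lborel_Icc_eq)
    have [measurable]: "f n \<in> borel_measurable borel" for n by (rule borel_measurable_continuous_onI[OF fc])
    have fl: "(\<lambda>n. f n y) \<longlonglongrightarrow> indicator A y" for y
    proof (cases "y \<in> A")
      case True
      then have "real (Suc n) * max (a - y) (y - b) \<le> 0" for n by (intro mult_nonneg_nonpos) (auto simp: A)
      then have "f n y = 1" for n unfolding f_def using max_def min_def by (smt (verit))
      then show ?thesis using True by simp
    next
      case False
      then have m: "0 < max (a - y) (y - b)" by (auto simp: A)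
      obtain N where N: "1 < real N * max (a - y) (y - b)" using reals_Archimedean3[OF m] by blast
      have "f n y = 0" if "n \<ge> N" for n
      proof -
        have "real N * max (a - y) (y - b) \<le> real (Suc n) * max (a - y) (y - b)"
          using that m by (intro mult_right_mono) auto
        then show ?thesis using N by (simp add: f_def)
      qed
      then have "\<forall>\<^sub>F n in sequentially. f n y = indicator A y"
        using False by (auto simp: eventually_sequentially)
      then show ?thesis by (rule tendsto_eventually)
    qed
    have lim: "(\<lambda>n. CLINT \<omega>|N. of_real (f n (Y \<omega>)) * V \<omega>) \<longlonglongrightarrow> (CLINT \<omega>|N. indicator A (Y \<omega>) * V \<omega>)"
      if N: "prob_space N" and Y[measurable]: "Y \<in> borel_measurable N" and V[measurable]: "V \<in> borel_measurable N"
        and D: "\<And>\<omega>. cmod (V \<omega>) \<le> D" for N :: "'z measure" and Y V D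
    proof (rule integral_dominated_convergence[where w = "\<lambda>_. D"])
      interpret N: prob_space N by fact
      show "integrable N (\<lambda>_. D)" by simp
      have [measurable]: "A \<in> sets borel" by (simp add: A)
      show "(\<lambda>\<omega>. indicator A (Y \<omega>) * V \<omega>) \<in> borel_measurable N" by measurable
      show "AE \<omega> in N. (\<lambda>n. of_real (f n (Y \<omega>)) * V \<omega>) \<longlonglongrightarrow> indicator A (Y \<omega>) * V \<omega>"
      proof (rule AE_I2)
        fix \<omega>
        have "(\<lambda>n. complex_of_real (f n (Y \<omega>)) * V \<omega>) \<longlonglongrightarrow> of_real (indicator A (Y \<omega>)) * V \<omega>"
          by (intro tendsto_intros fl)
        then show "(\<lambda>n. of_real (f n (Y \<omega>)) * V \<omega>) \<longlonglongrightarrow> indicator A (Y \<omega>) * V \<omega>"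
          by (simp add: indicator_def of_bool_def split: if_splits)
      qed
      show "AE \<omega> in N. cmod (of_real (f n (Y \<omega>)) * V \<omega>) \<le> D" for n
      proof (rule AE_I2)
        fix \<omega>
        have "f n (Y \<omega>) * cmod (V \<omega>) \<le> 1 * D" using f01 D by (intro mult_mono) auto
        then show "cmod (of_real (f n (Y \<omega>)) * V \<omega>) \<le> D" using f01 by (simp add: norm_mult)
      qed
    qed measurable
    have "(CLINT \<omega>|M. of_real (f n (X \<omega>)) * W \<omega>) = (CLINT \<omega>|M'. of_real (f n (X' \<omega>)) * W' \<omega>)" for n
      by (rule weighted_char_unique_cont[OF M M' eq fc _ fi, of n 1]) (use f01[of n] in auto)
    with lim[OF M] have "(\<lambda>n. CLINT \<omega>|M'. of_real (f n (X' \<omega>)) * W' \<omega>) \<longlonglongrightarrow> (CLINT \<omega>|M. indicator A (X \<omega>) * W \<omega>)"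
      by simp
    then show ?case using lim[OF M'] by (rule LIMSEQ_unique)
  next
    case 4 show ?case by simp
  next
    \<comment> \<open>Complements also need equality of the total weights, which is the hypothesis
      \<open>eq\<close> at frequency 0.\<close>
    case (5 A)
    have [measurable]: "A \<in> sets borel" by (rule mb) fact
    have "(CLINT \<omega>|N. indicator (UNIV - A) (Y \<omega>) * V \<omega>) = (CLINT \<omega>|N. V \<omega>) - (CLINT \<omega>|N. indicator A (Y \<omega>) * V \<omega>)"
      if N: "prob_space N" and Y[measurable]: "Y \<in> borel_measurable N" and V[measurable]: "V \<in> borel_measurable N"
        and D: "\<And>\<omega>. cmod (V \<omega>) \<le> D" for N :: "'z measure" and Y V D
    proof -
      have "integrable N V" by (rule bounded_integrable[OF N V D])
      moreover have "integrable N (\<lambda>\<omega>. indicator A (Y \<omega>) * V \<omega>)"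
      proof (rule bounded_integrable[OF N, where C = D])
        fix \<omega> show "cmod (indicator A (Y \<omega>) * V \<omega>) \<le> D"
          using D[of \<omega>] order_trans[OF norm_ge_zero D[of \<omega>]] by (auto simp: indicator_def)
      qed measurable
      moreover have "indicator (UNIV - A) y * v = v - indicator A y * v" for y and v :: complex
        by (simp add: indicator_def)
      ultimately show ?thesis by simp
    qed
    note this[OF M] this[OF M']
    moreover have "(CLINT \<omega>|M. W \<omega>) = (CLINT \<omega>|M'. W' \<omega>)" using eq[of 0] by simp
    ultimately show ?case using 5 by simp
  next
    case (6 A)
    have mA[measurable]: "A i \<in> sets borel" for i by (rule mb) (use 6(2) in auto)
    have lim: "(\<lambda>n. \<Sum>i<n. CLINT \<omega>|N. indicator (A i) (Y \<omega>) * V \<omega>) \<longlonglongrightarrow> (CLINT \<omega>|N. indicator (\<Union>i. A i) (Y \<omega>) * V \<omega>)"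
      if N: "prob_space N" and Y[measurable]: "Y \<in> borel_measurable N" and V[measurable]: "V \<in> borel_measurable N"
        and D: "\<And>\<omega>. cmod (V \<omega>) \<le> D" for N :: "'z measure" and Y V D
    proof -
      interpret N: prob_space N by fact
      have D0: "0 \<le> D" using D order_trans[OF norm_ge_zero] by blast
      have s: "(\<Sum>i<n. CLINT \<omega>|N. indicator (A i) (Y \<omega>) * V \<omega>) = (CLINT \<omega>|N. indicator (\<Union>i<n. A i) (Y \<omega>) * V \<omega>)" for n
      proof -
        have "integrable N (\<lambda>\<omega>. indicator (A i) (Y \<omega>) * V \<omega>)" for i
          by (rule bounded_integrable[OF N, where C = D]) (use D D0 in \<open>auto simp: indicator_def\<close>)
        then have "(\<Sum>i<n. CLINT \<omega>|N. indicator (A i) (Y \<omega>) * V \<omega>) = (CLINT \<omega>|N. \<Sum>i<n. indicator (A i) (Y \<omega>) * V \<omega>)"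
          by (intro Bochner_Integration.integral_sum[symmetric])
        moreover have "(\<Sum>i<n. indicator (A i) y * v) = indicator (\<Union>i<n. A i) y * v" for y and v :: complex
          using 6(1) by (subst indicator_UN_disjoint)
            (auto simp: disjoint_family_on_def sum_distrib_right)
        ultimately show ?thesis by simp
      qed
      show ?thesis unfolding s
      proof (rule integral_dominated_convergence[where w = "\<lambda>_. D"])
        show "AE \<omega> in N. (\<lambda>n. indicator (\<Union>i<n. A i) (Y \<omega>) * V \<omega>) \<longlonglongrightarrow> indicator (\<Union>i. A i) (Y \<omega>) * V \<omega>"
          by (intro AE_I2 tendsto_mult tendsto_const LIMSEQ_indicator_UN)
        show "AE \<omega> in N. cmod (indicator (\<Union>i<n. A i) (Y \<omega>) * V \<omega>) \<le> D" for n
          using D D0 by (auto simp: indicator_def)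
        have mU: "(\<Union>i. A i) \<in> sets borel" "(\<Union>i<n. A i) \<in> sets borel" for n
          by (rule sets.countable_UN, use mA in blast) (rule sets.finite_UN[OF finite_lessThan], rule mA)
        show "(\<lambda>\<omega>. indicator (\<Union>i. A i) (Y \<omega>) * V \<omega>) \<in> borel_measurable N"
          by (intro borel_measurable_times V measurable_compose[OF Y] borel_measurable_indicator mU)+
        show "(\<lambda>\<omega>. indicator (\<Union>i\<in>{..<n}. A i) (Y \<omega>) * V \<omega>) \<in> borel_measurable N" for n
          by (intro borel_measurable_times V measurable_compose[OF Y] borel_measurable_indicator mU)+
      qed simp
    qed
    have "(\<Sum>i<n. CLINT \<omega>|M. indicator (A i) (X \<omega>) * W \<omega>) = (\<Sum>i<n. CLINT \<omega>|M'. indicator (A i) (X' \<omega>) * W' \<omega>)" for n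
      by (intro sum.cong refl 6(3)) (use 6(2) in auto)
    with lim[OF M] have "(\<lambda>n. \<Sum>i<n. CLINT \<omega>|M'. indicator (A i) (X' \<omega>) * W' \<omega>)
        \<longlonglongrightarrow> (CLINT \<omega>|M. indicator (\<Union>i. A i) (X \<omega>) * W \<omega>)" by simp
    then show ?case using lim[OF M'] by (rule LIMSEQ_unique)
  qed
qed

section \<open>From one coordinate to rectangle events\<close>

lemma measure_rectangle_eq_integral:
  assumes M: "prob_space M" and J: "finite J" and X: "\<And>i. i \<in> J \<Longrightarrow> X i \<in> borel_measurable M"
    and B: "\<And>i. i \<in> J \<Longrightarrow> B i \<in> sets borel"
  shows "(CLINT \<omega>|M. (\<Prod>i\<in>J. indicator (B i) (X i \<omega>))) = measure M {\<omega>\<in>space M. \<forall>i\<in>J. X i \<omega> \<in> B i}"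
proof -
  interpret prob_space M by fact
  have [measurable]: "{\<omega>\<in>space M. \<forall>i\<in>J. X i \<omega> \<in> B i} \<in> sets M"
    using X B J by (intro sets.sets_Collect_finite_All) (auto intro: measurable_sets_Collect)
  have "(CLINT \<omega>|M. (\<Prod>i\<in>J. indicator (B i) (X i \<omega>))) = (CLINT \<omega>|M. of_real (indicator {\<omega>\<in>space M. \<forall>i\<in>J. X i \<omega> \<in> B i} \<omega>))"
  proof (intro Bochner_Integration.integral_cong refl)
    fix \<omega> assume "\<omega> \<in> space M"
    then show "(\<Prod>i\<in>J. indicator (B i) (X i \<omega>)) = complex_of_real (indicator {\<omega>\<in>space M. \<forall>i\<in>J. X i \<omega> \<in> B i} \<omega>)"
      using J by (cases "\<forall>i\<in>J. X i \<omega> \<in> B i") (auto simp: indicator_def prod_zero_iff)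
  qed
  then show ?thesis by (simp add: integral_complex_of_real)
qed

lemma rectangle_weight:
  fixes X :: "'i \<Rightarrow> 'a \<Rightarrow> real"
  assumes A: "finite A" "finite D" and X: "\<And>i. i \<in> A \<union> D \<Longrightarrow> X i \<in> borel_measurable M"
    and B: "\<And>i. i \<in> A \<Longrightarrow> B i \<in> sets borel"
  shows "(\<lambda>\<omega>. (\<Prod>i\<in>A. indicator (B i) (X i \<omega>)) * iexp (\<Sum>i\<in>D. t i * X i \<omega>)) \<in> borel_measurable M"
    and "cmod ((\<Prod>i\<in>A. indicator (B i) (X i \<omega>)) * iexp (\<Sum>i\<in>D. t i * X i \<omega>)) \<le> 1"
proof -
  have [measurable]: "\<And>i. i \<in> A \<Longrightarrow> X i \<in> borel_measurable M" "\<And>i. i \<in> D \<Longrightarrow> X i \<in> borel_measurable M"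
    "\<And>i. i \<in> A \<Longrightarrow> B i \<in> sets borel" using X B by auto
  show "(\<lambda>\<omega>. (\<Prod>i\<in>A. indicator (B i) (X i \<omega>)) * iexp (\<Sum>i\<in>D. t i * X i \<omega>)) \<in> borel_measurable M"
    by measurable
  show "cmod ((\<Prod>i\<in>A. indicator (B i) (X i \<omega>)) * iexp (\<Sum>i\<in>D. t i * X i \<omega>)) \<le> 1"
    by (auto simp: norm_mult prod_norm[symmetric] intro!: prod_le_1) (simp add: indicator_def)
qed

text \<open>Coordinates pass one at a time from the character to the indicators: with all others
  frozen in a weight bounded by 1, \<open>weighted_char_unique\<close> inverts in the coordinate
  \<open>a\<close>. The claim for \<open>A\<close> must hold for all frequency vectors
  \<open>t\<close>, since the step uses it with the frequency at \<open>a\<close> varying.\<close>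

lemma family_char_unique:
  fixes X :: "'i \<Rightarrow> 'a \<Rightarrow> real" and X' :: "'i \<Rightarrow> 'b \<Rightarrow> real"
  assumes J: "finite J" and M: "prob_space M" "\<And>i. i \<in> J \<Longrightarrow> X i \<in> borel_measurable M"
    and M': "prob_space M'" "\<And>i. i \<in> J \<Longrightarrow> X' i \<in> borel_measurable M'"
    and eq: "\<And>t. (CLINT \<omega>|M. iexp (\<Sum>i\<in>J. t i * X i \<omega>)) = (CLINT \<omega>|M'. iexp (\<Sum>i\<in>J. t i * X' i \<omega>))"
    and B: "\<And>i. i \<in> J \<Longrightarrow> B i \<in> sets borel"
  shows "measure M {\<omega>\<in>space M. \<forall>i\<in>J. X i \<omega> \<in> B i} = measure M' {\<omega>\<in>space M'. \<forall>i\<in>J. X' i \<omega> \<in> B i}"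
proof -
  have "(CLINT \<omega>|M. (\<Prod>i\<in>A. indicator (B i) (X i \<omega>)) * iexp (\<Sum>i\<in>J - A. t i * X i \<omega>)) =
    (CLINT \<omega>|M'. (\<Prod>i\<in>A. indicator (B i) (X' i \<omega>)) * iexp (\<Sum>i\<in>J - A. t i * X' i \<omega>))"
    if "A \<subseteq> J" for A t
    using finite_subset[OF that J] that
  proof (induction A arbitrary: t rule: finite_induct)
    case empty then show ?case using eq by simp
  next
    case (insert a A)
    let ?D = "J - insert a A"
    have D: "J - A = insert a ?D" "a \<notin> ?D" "finite ?D" using insert.hyps insert.prems J by auto
    have s: "iexp (\<tau> * y a) * ((\<Prod>i\<in>A. indicator (B i) (y i)) * iexp (\<Sum>i\<in>?D. t i * y i)) =
      (\<Prod>i\<in>A. indicator (B i) (y i)) * iexp (\<Sum>i\<in>J - A. (t(a := \<tau>)) i * y i)" for y :: "'i \<Rightarrow> real" and \<tau>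
    proof -
      have "(\<Sum>i\<in>J - A. (t(a := \<tau>)) i * y i) = \<tau> * y a + (\<Sum>i\<in>?D. t i * y i)"
        unfolding D(1) sum.insert[OF D(3,2)] using D(2) by (auto intro!: sum.cong)
      then show ?thesis by (simp add: distrib_left mult.left_commute[of "exp (\<i> * (complex_of_real \<tau> * complex_of_real (y a)))"] exp_add[symmetric])
    qed
    have w: "(\<lambda>\<omega>. (\<Prod>i\<in>A. indicator (B i) (X i \<omega>)) * iexp (\<Sum>i\<in>?D. t i * X i \<omega>)) \<in> borel_measurable M"
      "\<And>\<omega>. cmod ((\<Prod>i\<in>A. indicator (B i) (X i \<omega>)) * iexp (\<Sum>i\<in>?D. t i * X i \<omega>)) \<le> 1"
      by (rule rectangle_weight; use insert.hyps insert.prems B M(2) J in auto)+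
    have w': "(\<lambda>\<omega>. (\<Prod>i\<in>A. indicator (B i) (X' i \<omega>)) * iexp (\<Sum>i\<in>?D. t i * X' i \<omega>)) \<in> borel_measurable M'"
      "\<And>\<omega>. cmod ((\<Prod>i\<in>A. indicator (B i) (X' i \<omega>)) * iexp (\<Sum>i\<in>?D. t i * X' i \<omega>)) \<le> 1"
      by (rule rectangle_weight; use insert.hyps insert.prems B M'(2) J in auto)+
    have "(CLINT \<omega>|M. indicator (B a) (X a \<omega>) * ((\<Prod>i\<in>A. indicator (B i) (X i \<omega>)) * iexp (\<Sum>i\<in>?D. t i * X i \<omega>))) =
      (CLINT \<omega>|M'. indicator (B a) (X' a \<omega>) * ((\<Prod>i\<in>A. indicator (B i) (X' i \<omega>)) * iexp (\<Sum>i\<in>?D. t i * X' i \<omega>)))"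
    proof (rule weighted_char_unique[OF M(1) _ w M'(1) _ w'])
      show "(CLINT \<omega>|M. iexp (\<tau> * X a \<omega>) * ((\<Prod>i\<in>A. indicator (B i) (X i \<omega>)) * iexp (\<Sum>i\<in>?D. t i * X i \<omega>))) =
        (CLINT \<omega>|M'. iexp (\<tau> * X' a \<omega>) * ((\<Prod>i\<in>A. indicator (B i) (X' i \<omega>)) * iexp (\<Sum>i\<in>?D. t i * X' i \<omega>)))" for \<tau>
        unfolding s[of \<tau> "\<lambda>i. X i \<omega>" for \<omega>] s[of \<tau> "\<lambda>i. X' i \<omega>" for \<omega>] by (rule insert.IH) (use insert.prems in auto)
    qed (use insert.prems B M M' in auto)
    then show ?case using insert.hyps by (simp add: mult.assoc)
  qed
  from this[of J] have "(CLINT \<omega>|M. (\<Prod>i\<in>J. indicator (B i) (X i \<omega>))) = (CLINT \<omega>|M'. (\<Prod>i\<in>J. indicator (B i) (X' i \<omega>)))"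
    by simp
  then show ?thesis
    using M M' J B by (simp add: measure_rectangle_eq_integral)
qed

text \<open>The same induction, but the law is compared with itself: the weight made of the other
  coordinates is replaced by the constant \<open>c\<close>, which is its expectation. A factorizing
  characteristic function thereby gives independence on rectangles.\<close>

lemma rectangle_of_char_product:
  fixes X :: "'i \<Rightarrow> 'a \<Rightarrow> real"
  assumes J: "finite J" and M: "prob_space M" "\<And>i. i \<in> J \<Longrightarrow> X i \<in> borel_measurable M"
    and eq: "\<And>t. (CLINT \<omega>|M. iexp (\<Sum>i\<in>J. t i * X i \<omega>)) = (\<Prod>i\<in>J. CLINT \<omega>|M. iexp (t i * X i \<omega>))"
    and B: "\<And>i. i \<in> J \<Longrightarrow> B i \<in> sets borel"
  shows "measure M {\<omega>\<in>space M. \<forall>i\<in>J. X i \<omega> \<in> B i} = (\<Prod>i\<in>J. measure M {\<omega>\<in>space M. X i \<omega> \<in> B i})"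
proof -
  interpret prob_space M by fact
  have ind: "(CLINT \<omega>|M. indicator (B a) (X a \<omega>)) = of_real (measure M {\<omega>\<in>space M. X a \<omega> \<in> B a})" if "a \<in> J" for a
    using measure_rectangle_eq_integral[OF M(1), of "{a}" X B] that M B by simp
  have "(CLINT \<omega>|M. (\<Prod>i\<in>A. indicator (B i) (X i \<omega>)) * iexp (\<Sum>i\<in>J - A. t i * X i \<omega>)) =
    of_real (\<Prod>i\<in>A. measure M {\<omega>\<in>space M. X i \<omega> \<in> B i}) * (\<Prod>i\<in>J - A. CLINT \<omega>|M. iexp (t i * X i \<omega>))"
    if "A \<subseteq> J" for A t
    using finite_subset[OF that J] that
  proof (induction A arbitrary: t rule: finite_induct)
    case empty then show ?case using eq by simp
  next
    case (insert a A)
    let ?D = "J - insert a A"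
    have D: "J - A = insert a ?D" "a \<notin> ?D" "finite ?D" using insert.hyps insert.prems J by auto
    define c where "c = complex_of_real (\<Prod>i\<in>A. measure M {\<omega>\<in>space M. X i \<omega> \<in> B i}) * (\<Prod>i\<in>?D. CLINT \<omega>|M. iexp (t i * X i \<omega>))"
    have s: "iexp (\<tau> * y a) * ((\<Prod>i\<in>A. indicator (B i) (y i)) * iexp (\<Sum>i\<in>?D. t i * y i)) =
      (\<Prod>i\<in>A. indicator (B i) (y i)) * iexp (\<Sum>i\<in>J - A. (t(a := \<tau>)) i * y i)" for y :: "'i \<Rightarrow> real" and \<tau>
    proof -
      have "(\<Sum>i\<in>J - A. (t(a := \<tau>)) i * y i) = \<tau> * y a + (\<Sum>i\<in>?D. t i * y i)"
        unfolding D(1) sum.insert[OF D(3,2)] using D(2) by (auto intro!: sum.cong)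
      then show ?thesis by (simp add: distrib_left mult.left_commute[of "exp (\<i> * (complex_of_real \<tau> * complex_of_real (y a)))"] exp_add[symmetric])
    qed
    have w: "(\<lambda>\<omega>. (\<Prod>i\<in>A. indicator (B i) (X i \<omega>)) * iexp (\<Sum>i\<in>?D. t i * X i \<omega>)) \<in> borel_measurable M"
      "\<And>\<omega>. cmod ((\<Prod>i\<in>A. indicator (B i) (X i \<omega>)) * iexp (\<Sum>i\<in>?D. t i * X i \<omega>)) \<le> 1"
      by (rule rectangle_weight; use insert.hyps insert.prems B M(2) J in auto)+
    have "(CLINT \<omega>|M. indicator (B a) (X a \<omega>) * ((\<Prod>i\<in>A. indicator (B i) (X i \<omega>)) * iexp (\<Sum>i\<in>?D. t i * X i \<omega>))) =
      (CLINT \<omega>|M. indicator (B a) (X a \<omega>) * c)"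
    proof (rule weighted_char_unique[OF M(1) _ w M(1), where C' = "cmod c"])
      show "(CLINT \<omega>|M. iexp (\<tau> * X a \<omega>) * ((\<Prod>i\<in>A. indicator (B i) (X i \<omega>)) * iexp (\<Sum>i\<in>?D. t i * X i \<omega>))) =
        (CLINT \<omega>|M. iexp (\<tau> * X a \<omega>) * c)" for \<tau>
      proof -
        have "(\<Prod>i\<in>J - A. CLINT \<omega>|M. iexp ((t(a := \<tau>)) i * X i \<omega>)) =
          (CLINT \<omega>|M. iexp (\<tau> * X a \<omega>)) * (\<Prod>i\<in>?D. CLINT \<omega>|M. iexp (t i * X i \<omega>))"
          unfolding D(1) prod.insert[OF D(3,2)] using D(2) by (auto intro!: prod.cong)
        then show ?thesis
          using insert.IH[of "t(a := \<tau>)"] insert.prems unfolding s[of \<tau> "\<lambda>i. X i \<omega>" for \<omega>] by (simp add: c_def)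
      qed
    qed (use insert.prems B M in auto)
    also have "\<dots> = of_real (measure M {\<omega>\<in>space M. X a \<omega> \<in> B a}) * c"
      using ind[of a] insert.prems by simp
    finally show ?case using insert.hyps by (simp add: mult.assoc c_def)
  qed
  from this[of J] have "(CLINT \<omega>|M. (\<Prod>i\<in>J. indicator (B i) (X i \<omega>))) = of_real (\<Prod>i\<in>J. measure M {\<omega>\<in>space M. X i \<omega> \<in> B i})"
    by simp
  then have "complex_of_real (measure M {\<omega>\<in>space M. \<forall>i\<in>J. X i \<omega> \<in> B i}) = of_real (\<Prod>i\<in>J. measure M {\<omega>\<in>space M. X i \<omega> \<in> B i})"
    using M J B by (simp add: measure_rectangle_eq_integral del: of_real_prod)
  then show ?thesis by (simp only: of_real_eq_iff)
qed

section \<open>Rectangle probabilities of weakly correlated Gaussian vectors\<close>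

text \<open>Shifting the set is traded for shifting the mean, so that two laws can be compared
  through their densities on one set \<open>B\<close>.\<close>

lemma normal_emeasure_shift:
  assumes B[measurable]: "B \<in> sets borel" and \<sigma>: "\<sigma> > 0"
  shows "emeasure (density lborel (normal_density 0 \<sigma>)) {z. m + z \<in> B} = (\<integral>\<^sup>+y. ennreal (normal_density m \<sigma> y) * indicator B y \<partial>lborel)"
proof -
  have "{z. m + z \<in> B} \<in> sets borel"
    using measurable_sets[of "\<lambda>z. m + z" borel borel B] B by (simp add: vimage_def)
  then have "emeasure (density lborel (normal_density 0 \<sigma>)) {z. m + z \<in> B} =
      (\<integral>\<^sup>+z. ennreal (normal_density 0 \<sigma> z) * indicator {z. m + z \<in> B} z \<partial>lborel)"
    by (subst emeasure_density) auto
  also have "\<dots> = (\<integral>\<^sup>+z. ennreal (normal_density m \<sigma> (m + 1 * z)) * indicator B (m + 1 * z) \<partial>lborel)"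
    by (intro nn_integral_cong) (auto simp: normal_density_def indicator_def)
  also have "\<dots> = (\<integral>\<^sup>+y. ennreal (normal_density m \<sigma> y) * indicator B y \<partial>lborel)"
    using nn_integral_real_affine[of "\<lambda>y. ennreal (normal_density m \<sigma> y) * indicator B y" 1 m] by simp
  finally show ?thesis .
qed

lemma char_normal:
  assumes \<sigma>: "\<sigma> > 0"
  shows "(CLINT z|density lborel (normal_density \<mu> \<sigma>). iexp (t * z)) = iexp (t * \<mu>) * exp (- (\<sigma>\<^sup>2 * t\<^sup>2) / 2)"
proof -
  have "(CLINT z|density lborel (normal_density \<mu> \<sigma>). iexp (t * z)) = (CLINT z|lborel. normal_density \<mu> \<sigma> z *\<^sub>R iexp (t * z))"
    using \<sigma> by (intro integral_density) auto
  also have "\<dots> = \<bar>\<sigma>\<bar> *\<^sub>R (CLINT z|lborel. normal_density \<mu> \<sigma> (\<mu> + \<sigma> * z) *\<^sub>R iexp (t * (\<mu> + \<sigma> * z)))"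
    using \<sigma> by (intro lborel_integral_real_affine) auto
  also have "\<dots> = (CLINT z|lborel. iexp (t * \<mu>) * (std_normal_density z *\<^sub>R iexp ((t * \<sigma>) * z)))"
  proof -
    have "\<sigma> * normal_density \<mu> \<sigma> (\<mu> + \<sigma> * z) = std_normal_density z" for z
      using \<sigma> by (simp add: normal_density_def power_mult_distrib real_sqrt_mult)
    moreover have "iexp (t * (\<mu> + \<sigma> * z)) = iexp (t * \<mu>) * iexp ((t * \<sigma>) * z)" for z
      unfolding exp_add[symmetric] by (simp add: algebra_simps)
    ultimately show ?thesis
      using \<sigma> by (simp add: integral_scaleR_right[symmetric] del: integral_scaleR_right of_real_mult)
  qed
  also have "\<dots> = iexp (t * \<mu>) * char std_normal_distribution (t * \<sigma>)"
    unfolding char_def by (subst integral_mult_right_zero, subst integral_density) auto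
  also have "\<dots> = iexp (t * \<mu>) * exp (- (\<sigma>\<^sup>2 * t\<^sup>2) / 2)"
    by (simp add: char_std_normal_distribution power_mult_distrib mult.commute)
  finally show ?thesis .
qed

text \<open>The exponents differ by at most a multiple of \<open>\<eta> b\<^sup>2\<close>, which is bounded when \<open>b\<^sup>2\<close> is of order \<open>ln n\<close>
  and \<open>\<eta>\<close> of order \<open>1 / ln n\<close>.\<close>

lemma normal_density_ratio:
  assumes \<eta>: "0 \<le> \<eta>" "\<eta> \<le> 1/4" and b: "1 \<le> b" and v: "\<bar>v - 1\<bar> \<le> \<eta>" and m: "\<bar>m\<bar> \<le> \<eta> * b" and y: "\<bar>y\<bar> \<le> b"
  shows "normal_density m (sqrt v) y \<le> exp (4 * \<eta> * b\<^sup>2) * std_normal_density y"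
    and "exp (- (4 * \<eta> * b\<^sup>2)) * std_normal_density y \<le> normal_density m (sqrt v) y"
proof -
  have v0: "3/4 \<le> v" "v \<le> 1 + \<eta>" "1 - \<eta> \<le> v" using v \<eta> by auto
  define r where "r = 1 / sqrt v"
  \<comment> \<open>The ratio to the standard density is \<open>r * exp d\<close>. Below,
    \<open>r\<close> is shown to lie between \<open>exp (- \<eta>)\<close> and
    \<open>exp \<eta>\<close>, and \<open>\<bar>d\<bar>\<close> to be at most
    \<open>3 * \<eta> * b\<^sup>2\<close>; since \<open>1 \<le> b\<close>, this adds up to the
    constant 4.\<close>
  define d where "d = y\<^sup>2 / 2 - (y - m)\<^sup>2 / (2 * v)"
  have "exp d * exp (- y\<^sup>2 / 2) = exp (- (y - m)\<^sup>2 / (2 * v))"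
    unfolding exp_add[symmetric] by (simp add: d_def)
  then have eq: "normal_density m (sqrt v) y = r * exp d * std_normal_density y"
    using v0 by (simp add: normal_density_def r_def real_sqrt_mult mult.assoc)
  have "exp (- 2 * \<eta>) \<le> 1 - \<eta>"
  proof -
    have "- \<eta> - 2 * \<eta>\<^sup>2 \<le> ln (1 - \<eta>)" using \<eta> by (intro ln_one_minus_pos_lower_bound) auto
    moreover have "\<eta>\<^sup>2 \<le> \<eta> * (1/4)" using \<eta> unfolding power2_eq_square by (intro mult_left_mono) auto
    ultimately have "- 2 * \<eta> \<le> ln (1 - \<eta>)" using \<eta> by linarith
    then show ?thesis using \<eta> by (subst (asm) ln_ge_iff) auto
  qed
  then have "exp (- 2 * \<eta>) \<le> v" using v0 by simp
  then have "sqrt (exp (- 2 * \<eta>)) \<le> sqrt v" by (rule real_sqrt_le_mono)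
  moreover have "sqrt (exp (- 2 * \<eta>)) = exp (- \<eta>)"
    by (rule real_sqrt_unique) (auto simp: power2_eq_square exp_add[symmetric])
  ultimately have "exp (- \<eta>) \<le> sqrt v" by (simp only:)
  then have "1 / sqrt v \<le> 1 / exp (- \<eta>)" by (intro divide_left_mono) (use v0 in auto)
  then have r1: "r \<le> exp \<eta>" by (simp add: r_def exp_minus field_simps)
  have "v \<le> exp \<eta>" using v0(2) exp_ge_add_one_self[of \<eta>] by linarith
  also have "exp \<eta> \<le> exp (2 * \<eta>)" using \<eta> by simp
  finally have "sqrt v \<le> sqrt (exp (2 * \<eta>))" by simp
  moreover have "sqrt (exp (2 * \<eta>)) = exp \<eta>"
    by (rule real_sqrt_unique) (auto simp: power2_eq_square exp_add[symmetric])
  ultimately have "sqrt v \<le> exp \<eta>" by simp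
  then have "1 / exp \<eta> \<le> 1 / sqrt v" by (intro divide_left_mono) (use v0 in auto)
  then have r2: "exp (- \<eta>) \<le> r" by (simp add: r_def exp_minus field_simps)
  have b2: "1 \<le> b\<^sup>2" using b by simp
  have "\<bar>d\<bar> \<le> 3 * \<eta> * b\<^sup>2"
  proof -
    have "d = ((v - 1) * y\<^sup>2 + 2 * y * m - m\<^sup>2) / (2 * v)"
      using v0 by (simp add: d_def field_simps power2_eq_square)
    moreover have "\<bar>(v - 1) * y\<^sup>2\<bar> \<le> \<eta> * b\<^sup>2"
    proof -
      have "y\<^sup>2 \<le> b\<^sup>2" using y b by (intro power2_le_iff_abs_le[THEN iffD2]) auto
      then show ?thesis unfolding abs_mult using v by (intro mult_mono) auto
    qed
    moreover have "\<bar>2 * y * m\<bar> \<le> 2 * b * (\<eta> * b)"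
      unfolding abs_mult using m y b by (intro mult_mono) auto
    moreover have "\<bar>m\<^sup>2\<bar> \<le> \<eta> * b\<^sup>2"
    proof -
      have "\<bar>m\<^sup>2\<bar> \<le> (\<eta> * b) * (\<eta> * b)" using m \<eta> b unfolding abs_mult power2_eq_square by (intro mult_mono) auto
      also have "\<dots> = \<eta> * (\<eta> * b\<^sup>2)" by (simp add: power2_eq_square)
      also have "\<dots> \<le> \<eta> * (1 * b\<^sup>2)" using \<eta> by (intro mult_left_mono mult_right_mono) auto
      finally show ?thesis by simp
    qed
    ultimately have "\<bar>d\<bar> \<le> (\<eta> * b\<^sup>2 + 2 * b * (\<eta> * b) + \<eta> * b\<^sup>2) / (2 * v)"
    proof -
      assume "d = ((v - 1) * y\<^sup>2 + 2 * y * m - m\<^sup>2) / (2 * v)" "\<bar>(v - 1) * y\<^sup>2\<bar> \<le> \<eta> * b\<^sup>2"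
        "\<bar>2 * y * m\<bar> \<le> 2 * b * (\<eta> * b)" "\<bar>m\<^sup>2\<bar> \<le> \<eta> * b\<^sup>2"
      moreover from this have "\<bar>(v - 1) * y\<^sup>2 + 2 * y * m - m\<^sup>2\<bar> \<le> \<eta> * b\<^sup>2 + 2 * b * (\<eta> * b) + \<eta> * b\<^sup>2"
        by linarith
      ultimately show ?thesis using v0 by (simp only: abs_divide) (intro frac_le, auto)
    qed
    also have "\<dots> = (4 * \<eta> * b\<^sup>2) / (2 * v)" by (simp add: power2_eq_square algebra_simps)
    also have "\<dots> \<le> (4 * \<eta> * b\<^sup>2) / (2 * (3/4))" using v0 \<eta> by (intro divide_left_mono) auto
    also have "\<dots> \<le> 3 * \<eta> * b\<^sup>2" using \<eta> by simp
    finally show ?thesis .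
  qed
  moreover have "\<eta> \<le> \<eta> * b\<^sup>2" using \<eta> b2 mult_left_mono[of 1 "b\<^sup>2" \<eta>] by simp
  ultimately have d: "\<eta> + d \<le> 4 * \<eta> * b\<^sup>2" "- (4 * \<eta> * b\<^sup>2) \<le> - \<eta> + d" by linarith+
  have "r * exp d \<le> exp \<eta> * exp d" using r1 by (intro mult_right_mono) auto
  also have "\<dots> = exp (\<eta> + d)" by (simp add: exp_add)
  also have "\<dots> \<le> exp (4 * \<eta> * b\<^sup>2)" using d by (subst exp_le_cancel_iff)
  finally show "normal_density m (sqrt v) y \<le> exp (4 * \<eta> * b\<^sup>2) * std_normal_density y"
    unfolding eq by (rule mult_right_mono) simp
  have "exp (- (4 * \<eta> * b\<^sup>2)) \<le> exp (- \<eta> + d)" using d by (subst exp_le_cancel_iff)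
  also have "\<dots> = exp (- \<eta>) * exp d" by (simp only: exp_add)
  also have "\<dots> \<le> r * exp d" using r2 by (intro mult_right_mono) auto
  finally show "exp (- (4 * \<eta> * b\<^sup>2)) * std_normal_density y \<le> normal_density m (sqrt v) y"
    unfolding eq by (rule mult_right_mono) simp
qed

lemma normal_measure_ratio:
  assumes \<eta>: "0 \<le> \<eta>" "\<eta> \<le> 1/4" and b: "1 \<le> b" and v: "\<bar>v - 1\<bar> \<le> \<eta>" and m: "\<bar>m\<bar> \<le> \<eta> * b"
    and B[measurable]: "B \<in> sets borel" and Bb: "B \<subseteq> {-b..b}"
  shows "measure (density lborel (normal_density 0 (sqrt v))) {z. m + z \<in> B} \<le> exp (4 * \<eta> * b\<^sup>2) * measure std_normal_distribution B"
    and "exp (- (4 * \<eta> * b\<^sup>2)) * measure std_normal_distribution B \<le> measure (density lborel (normal_density 0 (sqrt v))) {z. m + z \<in> B}"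
proof -
  have s: "0 < sqrt v" using v \<eta> by auto
  have Bb': "y \<in> B \<Longrightarrow> \<bar>y\<bar> \<le> b" for y using Bb by (auto simp: abs_le_iff)
  interpret N: prob_space "density lborel (normal_density 0 (sqrt v))" by (rule prob_space_normal_density) fact
  interpret G: prob_space std_normal_distribution by (rule prob_std_normal)
  let ?e = "exp (4 * \<eta> * b\<^sup>2)" and ?e' = "exp (- (4 * \<eta> * b\<^sup>2))"
  have g: "emeasure std_normal_distribution B = (\<integral>\<^sup>+y. ennreal (std_normal_density y) * indicator B y \<partial>lborel)"
    by (subst emeasure_density) auto
  have "emeasure (density lborel (normal_density 0 (sqrt v))) {z. m + z \<in> B} \<le> ennreal ?e * emeasure std_normal_distribution B"
    unfolding normal_emeasure_shift[OF B s] g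
  proof (subst nn_integral_cmult[symmetric])
    show "(\<integral>\<^sup>+y. ennreal (normal_density m (sqrt v) y) * indicator B y \<partial>lborel) \<le> (\<integral>\<^sup>+y. ennreal ?e * (ennreal (std_normal_density y) * indicator B y) \<partial>lborel)"
    proof (rule nn_integral_mono)
      fix y show "ennreal (normal_density m (sqrt v) y) * indicator B y \<le> ennreal ?e * (ennreal (std_normal_density y) * indicator B y)"
        using normal_density_ratio(1)[OF \<eta> b v m, of y] Bb'[of y]
        by (cases "y \<in> B") (auto simp: ennreal_mult[symmetric] intro!: ennreal_leI)
    qed
  qed simp
  then show "measure (density lborel (normal_density 0 (sqrt v))) {z. m + z \<in> B} \<le> ?e * measure std_normal_distribution B"
    by (simp add: N.emeasure_eq_measure G.emeasure_eq_measure ennreal_mult[symmetric])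
  have "ennreal ?e' * emeasure std_normal_distribution B \<le> emeasure (density lborel (normal_density 0 (sqrt v))) {z. m + z \<in> B}"
    unfolding normal_emeasure_shift[OF B s] g
  proof (subst nn_integral_cmult[symmetric])
    show "(\<integral>\<^sup>+y. ennreal ?e' * (ennreal (std_normal_density y) * indicator B y) \<partial>lborel) \<le> (\<integral>\<^sup>+y. ennreal (normal_density m (sqrt v) y) * indicator B y \<partial>lborel)"
    proof (rule nn_integral_mono)
      fix y show "ennreal ?e' * (ennreal (std_normal_density y) * indicator B y) \<le> ennreal (normal_density m (sqrt v) y) * indicator B y"
        using normal_density_ratio(2)[OF \<eta> b v m, of y] Bb'[of y]
        by (cases "y \<in> B") (auto simp: ennreal_mult[symmetric] intro!: ennreal_leI)
    qed
  qed simp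
  then show "?e' * measure std_normal_distribution B \<le> measure (density lborel (normal_density 0 (sqrt v))) {z. m + z \<in> B}"
    by (simp add: N.emeasure_eq_measure G.emeasure_eq_measure ennreal_mult[symmetric])
qed

section \<open>Gaussian families and regression on one coordinate\<close>

text \<open>Characteristic functions instead of densities: singular covariances need no separate
  treatment, and regression residuals are obtained merely by choosing frequencies.\<close>

definition gaussian_family :: "'a measure \<Rightarrow> 'i set \<Rightarrow> ('i \<Rightarrow> 'a \<Rightarrow> real) \<Rightarrow> ('i \<Rightarrow> 'i \<Rightarrow> real) \<Rightarrow> bool" where
  "gaussian_family M J Z c \<longleftrightarrow> (\<forall>i\<in>J. Z i \<in> borel_measurable M) \<and>
    (\<forall>t. (CLINT \<omega>|M. iexp (\<Sum>i\<in>J. t i * Z i \<omega>)) = exp (- (\<Sum>i\<in>J. \<Sum>k\<in>J. c i k * t i * t k) / 2))"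

text \<open>Completing the square in \<open>t a\<close>. The remaining coefficients form the Schur
  complement of \<open>c a a\<close>, the conditional covariance given the coordinate
  \<open>a\<close>.\<close>

lemma quadratic_insert:
  fixes c :: "'i \<Rightarrow> 'i \<Rightarrow> real"
  assumes J: "finite J" "a \<notin> J" and sym: "\<And>i. i \<in> J \<Longrightarrow> c i a = c a i" and v: "c a a \<noteq> 0"
  shows "(\<Sum>i\<in>insert a J. \<Sum>k\<in>insert a J. c i k * t i * t k) =
    c a a * (t a + (\<Sum>i\<in>J. t i * (c a i / c a a)))\<^sup>2 + (\<Sum>i\<in>J. \<Sum>k\<in>J. (c i k - c a i * c a k / c a a) * t i * t k)"
proof -
  define s where "s = (\<Sum>i\<in>J. c a i * t i)"
  have s': "(\<Sum>i\<in>J. t i * (c a i / c a a)) = s / c a a"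
    unfolding s_def sum_divide_distrib by (intro sum.cong) (auto simp: mult.commute)
  have "(\<Sum>i\<in>J. \<Sum>k\<in>J. (c i k - c a i * c a k / c a a) * t i * t k) =
    (\<Sum>i\<in>J. \<Sum>k\<in>J. c i k * t i * t k) - (\<Sum>i\<in>J. \<Sum>k\<in>J. (c a i * t i) * (c a k * t k)) / c a a"
    unfolding sum_divide_distrib sum_subtractf[symmetric] by (intro sum.cong refl) (simp add: field_simps)
  also have "(\<Sum>i\<in>J. \<Sum>k\<in>J. (c a i * t i) * (c a k * t k)) = s\<^sup>2"
    unfolding s_def power2_eq_square sum_product ..
  finally have 1: "(\<Sum>i\<in>J. \<Sum>k\<in>J. (c i k - c a i * c a k / c a a) * t i * t k) = (\<Sum>i\<in>J. \<Sum>k\<in>J. c i k * t i * t k) - s\<^sup>2 / c a a" .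
  have "(\<Sum>i\<in>J. c i a * t i * t a) = s * t a"
    unfolding s_def sum_distrib_right using sym by (intro sum.cong) auto
  moreover have "(\<Sum>k\<in>J. c a k * t a * t k) = s * t a"
    unfolding s_def sum_distrib_right by (intro sum.cong) auto
  ultimately have 2: "(\<Sum>i\<in>insert a J. \<Sum>k\<in>insert a J. c i k * t i * t k) =
      c a a * (t a)\<^sup>2 + 2 * s * t a + (\<Sum>i\<in>J. \<Sum>k\<in>J. c i k * t i * t k)"
    using J by (simp add: sum.distrib power2_eq_square)
  show ?thesis unfolding 1 2 s' using v by (simp add: field_simps power2_eq_square)
qed

text \<open>The frequency \<open>- s\<close> at \<open>a\<close> both produces the residuals in the
  linear form and annihilates the square in \<open>quadratic_insert\<close>, so only the Schur
  complement remains.\<close>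

lemma gaussian_family_residual:
  assumes G: "gaussian_family M (insert a J) Z c" and J: "finite J" "a \<notin> J"
    and sym: "\<And>i. i \<in> J \<Longrightarrow> c i a = c a i" and v: "c a a \<noteq> 0"
  shows "gaussian_family M J (\<lambda>i \<omega>. Z i \<omega> - c a i / c a a * Z a \<omega>) (\<lambda>i k. c i k - c a i * c a k / c a a)"
  unfolding gaussian_family_def
proof safe
  fix i assume "i \<in> J"
  then show "(\<lambda>\<omega>. Z i \<omega> - c a i / c a a * Z a \<omega>) \<in> borel_measurable M"
    using G by (auto simp: gaussian_family_def)
next
  fix t :: "'b \<Rightarrow> real"
  define s where "s = (\<Sum>i\<in>J. t i * (c a i / c a a))"
  let ?t = "t(a := - s)"
  have tJ: "(\<Sum>i\<in>J. ?t i * f i) = (\<Sum>i\<in>J. t i * f i)" for f :: "'b \<Rightarrow> real"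
    using J by (intro sum.cong) auto
  have "(CLINT \<omega>|M. iexp (\<Sum>i\<in>J. t i * (Z i \<omega> - c a i / c a a * Z a \<omega>))) = (CLINT \<omega>|M. iexp (\<Sum>i\<in>insert a J. ?t i * Z i \<omega>))"
  proof -
    have "(\<Sum>i\<in>J. t i * (Z i \<omega> - c a i / c a a * Z a \<omega>)) = (\<Sum>i\<in>insert a J. ?t i * Z i \<omega>)" for \<omega>
    proof -
      have "(\<Sum>i\<in>insert a J. ?t i * Z i \<omega>) = - s * Z a \<omega> + (\<Sum>i\<in>J. t i * Z i \<omega>)"
        unfolding tJ[of "\<lambda>i. Z i \<omega>", symmetric] using J by (simp del: fun_upd_apply add: fun_upd_same)
      moreover have "(\<Sum>i\<in>J. t i * (Z i \<omega> - c a i / c a a * Z a \<omega>)) = (\<Sum>i\<in>J. t i * Z i \<omega>) - s * Z a \<omega>"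
        unfolding s_def sum_distrib_right sum_subtractf[symmetric] by (intro sum.cong) (auto simp: algebra_simps)
      ultimately show ?thesis by simp
    qed
    then show ?thesis by simp
  qed
  also have "\<dots> = exp (- (\<Sum>i\<in>insert a J. \<Sum>k\<in>insert a J. c i k * ?t i * ?t k) / 2)"
    using G unfolding gaussian_family_def by blast
  also have "(\<Sum>i\<in>insert a J. \<Sum>k\<in>insert a J. c i k * ?t i * ?t k) = (\<Sum>i\<in>J. \<Sum>k\<in>J. (c i k - c a i * c a k / c a a) * t i * t k)"
  proof -
    have "?t a + (\<Sum>i\<in>J. ?t i * (c a i / c a a)) = 0" unfolding tJ by (simp add: s_def)
    moreover have "(\<Sum>i\<in>J. \<Sum>k\<in>J. (c i k - c a i * c a k / c a a) * ?t i * ?t k) = (\<Sum>i\<in>J. \<Sum>k\<in>J. (c i k - c a i * c a k / c a a) * t i * t k)"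
      using J by (intro sum.cong refl) auto
    ultimately show ?thesis
      using quadratic_insert[where c = c and t = ?t, OF J sym v] by simp
  qed
  finally show "(CLINT \<omega>|M. iexp (\<Sum>i\<in>J. t i * (Z i \<omega> - c a i / c a a * Z a \<omega>))) =
    exp (- (\<Sum>i\<in>J. \<Sum>k\<in>J. (c i k - c a i * c a k / c a a) * t i * t k) / 2)" .
qed

text \<open>\<open>Z a\<close> is independent of the regression residuals. Instead of proving this,
  the vector is rebuilt on \<open>N \<Otimes>\<^sub>M M\<close> from a fresh normal first coordinate
  and the residuals; both vectors have the same characteristic function, so rectangle probabilities
  agree, and Fubini over the first coordinate gives the formula.\<close>

lemma emeasure_gaussian_split:
  fixes Z :: "'i \<Rightarrow> 'a \<Rightarrow> real"
  assumes M: "prob_space M" and G: "gaussian_family M (insert a J) Z c" and J: "finite J" "a \<notin> J"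
    and sym: "\<And>i. i \<in> J \<Longrightarrow> c i a = c a i" and v: "c a a > 0"
    and B: "\<And>i. i \<in> insert a J \<Longrightarrow> B i \<in> sets borel"
  defines "N \<equiv> density lborel (normal_density 0 (sqrt (c a a)))"
  shows "ennreal (measure M {\<omega>\<in>space M. \<forall>i\<in>insert a J. Z i \<omega> \<in> B i}) =
    (\<integral>\<^sup>+z. indicator (B a) z * ennreal (measure M {\<omega>\<in>space M. \<forall>i\<in>J. c a i / c a a * z + (Z i \<omega> - c a i / c a a * Z a \<omega>) \<in> B i}) \<partial>N)"
proof -
  interpret M: prob_space M by fact
  interpret N: prob_space N unfolding N_def using v by (intro prob_space_normal_density) simp
  interpret P: pair_prob_space N M ..
  have sN[simp]: "sets N = sets borel" "space N = UNIV" by (auto simp: N_def)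
  define \<alpha> where "\<alpha> i = c a i / c a a" for i
  define Z' where "Z' i \<omega> = Z i \<omega> - \<alpha> i * Z a \<omega>" for i \<omega>
  define W where "W i x = (if i = a then fst x else \<alpha> i * fst x + Z' i (snd x))" for i and x :: "real \<times> 'a"
  have Zm[measurable]: "\<And>i. i \<in> insert a J \<Longrightarrow> Z i \<in> borel_measurable M"
    using G by (auto simp: gaussian_family_def)
  have Z'm[measurable]: "i \<in> J \<Longrightarrow> Z' i \<in> borel_measurable M" for i
    unfolding Z'_def[abs_def] by measurable
  have fm: "fst \<in> borel_measurable (N \<Otimes>\<^sub>M M)" by (subst measurable_cong_sets[OF refl sN(1)[symmetric]]) simp
  have Wm: "W i \<in> borel_measurable (N \<Otimes>\<^sub>M M)" if "i \<in> insert a J" for i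
    using that fm by (cases "i = a") (auto simp: W_def[abs_def] intro!: borel_measurable_add borel_measurable_times measurable_compose[OF measurable_snd Z'm])
  have char: "(CLINT \<omega>|M. iexp (\<Sum>i\<in>insert a J. t i * Z i \<omega>)) = (CLINT x|N \<Otimes>\<^sub>M M. iexp (\<Sum>i\<in>insert a J. t i * W i x))" for t
  proof -
    define s where "s = (\<Sum>i\<in>J. t i * \<alpha> i)"
    define q where "q = (\<Sum>i\<in>J. \<Sum>k\<in>J. (c i k - c a i * c a k / c a a) * t i * t k)"
    have split: "iexp (\<Sum>i\<in>insert a J. t i * W i x) = iexp ((t a + s) * fst x) * iexp (\<Sum>i\<in>J. t i * Z' i (snd x))" for x
    proof -
      have "(\<Sum>i\<in>J. t i * W i x) = (\<Sum>i\<in>J. t i * \<alpha> i * fst x + t i * Z' i (snd x))"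
        using J by (intro sum.cong) (auto simp: W_def algebra_simps)
      then have "(\<Sum>i\<in>insert a J. t i * W i x) = (t a + s) * fst x + (\<Sum>i\<in>J. t i * Z' i (snd x))"
        using J by (simp add: W_def s_def sum.distrib sum_distrib_right distrib_right)
      then show ?thesis by (simp add: exp_add[symmetric] distrib_left)
    qed
    have "(\<lambda>x. \<Sum>i\<in>insert a J. t i * W i x) \<in> borel_measurable (N \<Otimes>\<^sub>M M)"
      by (intro borel_measurable_sum borel_measurable_times borel_measurable_const Wm)
    then have "(\<lambda>x. iexp (\<Sum>i\<in>insert a J. t i * W i x)) \<in> borel_measurable (N \<Otimes>\<^sub>M M)"
      by (rule measurable_compose) simp
    then have int: "complex_integrable (N \<Otimes>\<^sub>M M) (\<lambda>x. iexp (\<Sum>i\<in>insert a J. t i * W i x))"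
      by (rule bounded_integrable[OF P.prob_space_axioms, where C = 1]) (simp only: norm_exp_i_times order_refl)
    have "(CLINT x|N \<Otimes>\<^sub>M M. iexp (\<Sum>i\<in>insert a J. t i * W i x)) =
      (CLINT z|N. CLINT \<omega>|M. iexp (\<Sum>i\<in>insert a J. t i * W i (z, \<omega>)))"
      by (rule P.integral_fst'[OF int, symmetric])
    also have "\<dots> = (CLINT z|N. CLINT \<omega>|M. iexp ((t a + s) * z) * iexp (\<Sum>i\<in>J. t i * Z' i \<omega>))"
      unfolding split fst_conv snd_conv ..
    also have "\<dots> = (CLINT z|N. iexp ((t a + s) * z)) * (CLINT \<omega>|M. iexp (\<Sum>i\<in>J. t i * Z' i \<omega>))"
      by (simp only: integral_mult_right_zero integral_mult_left_zero)
    also have "\<dots> = exp (- (c a a * (t a + s)\<^sup>2) / 2) * exp (- q / 2)"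
    proof -
      have "(CLINT \<omega>|M. iexp (\<Sum>i\<in>J. t i * Z' i \<omega>)) = exp (- q / 2)"
        using gaussian_family_residual[OF G J sym] v unfolding gaussian_family_def q_def Z'_def \<alpha>_def by simp
      moreover have "(CLINT z|N. iexp ((t a + s) * z)) = exp (- (c a a * (t a + s)\<^sup>2) / 2)"
        unfolding N_def using char_normal[of "sqrt (c a a)" 0 "t a + s"] v by simp
      ultimately show ?thesis by simp
    qed
    also have "\<dots> = exp (- (\<Sum>i\<in>insert a J. \<Sum>k\<in>insert a J. c i k * t i * t k) / 2)"
    proof -
      have "exp (- (c a a * (t a + s)\<^sup>2) / 2) * exp (- q / 2) = exp (- (c a a * (t a + s)\<^sup>2 + q) / 2)"
        unfolding exp_add[symmetric] by (simp add: field_simps)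
      then show ?thesis
        using quadratic_insert[where c = c and t = t, OF J sym] v unfolding s_def q_def \<alpha>_def by (simp add: of_real_mult[symmetric] del: of_real_mult)
    qed
    also have "\<dots> = (CLINT \<omega>|M. iexp (\<Sum>i\<in>insert a J. t i * Z i \<omega>))"
      using G unfolding gaussian_family_def by simp
    finally show ?thesis by simp
  qed
  define A where "A = {x\<in>space (N \<Otimes>\<^sub>M M). \<forall>i\<in>insert a J. W i x \<in> B i}"
  have A: "A \<in> sets (N \<Otimes>\<^sub>M M)"
    unfolding A_def
  proof (rule sets.sets_Collect_finite_All)
    show "{x \<in> space (N \<Otimes>\<^sub>M M). W i x \<in> B i} \<in> sets (N \<Otimes>\<^sub>M M)" if "i \<in> insert a J" for i
      using measurable_sets[OF Wm[OF that] B[OF that]] by (simp add: vimage_def Int_def conj_commute)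
  qed (use J in simp)
  have "measure M {\<omega>\<in>space M. \<forall>i\<in>insert a J. Z i \<omega> \<in> B i} = measure (N \<Otimes>\<^sub>M M) A"
    unfolding A_def by (rule family_char_unique[OF _ M Zm P.prob_space_axioms Wm char B]) (use J in simp)
  then have "ennreal (measure M {\<omega>\<in>space M. \<forall>i\<in>insert a J. Z i \<omega> \<in> B i}) = emeasure (N \<Otimes>\<^sub>M M) A"
    by (simp add: P.emeasure_eq_measure)
  also have "\<dots> = (\<integral>\<^sup>+z. emeasure M (Pair z -` A) \<partial>N)"
    by (rule M.emeasure_pair_measure_alt) fact
  also have "\<dots> = (\<integral>\<^sup>+z. indicator (B a) z * ennreal (measure M {\<omega>\<in>space M. \<forall>i\<in>J. \<alpha> i * z + Z' i \<omega> \<in> B i}) \<partial>N)"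
  proof (rule nn_integral_cong)
    fix z
    have "Pair z -` A = (if z \<in> B a then {\<omega>\<in>space M. \<forall>i\<in>J. \<alpha> i * z + Z' i \<omega> \<in> B i} else {})"
      using J by (auto simp: A_def W_def space_pair_measure)
    then show "emeasure M (Pair z -` A) = indicator (B a) z * ennreal (measure M {\<omega>\<in>space M. \<forall>i\<in>J. \<alpha> i * z + Z' i \<omega> \<in> B i})"
      by (simp add: M.emeasure_eq_measure)
  qed
  finally show ?thesis by (simp add: \<alpha>_def Z'_def)
qed

text \<open>Peeling off a coordinate replaces the others by regression residuals, whose covariances are perturbed by at most
  \<open>3 \<eta>\<close>, and shifts them by at most \<open>3 \<eta> b\<close>; hence the shifts \<open>m\<close> and the powers of the dimension.\<close>

lemma gaussian_rectangle_comparison: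
  fixes Z :: "'i \<Rightarrow> 'a \<Rightarrow> real"
  assumes J: "finite J" and M: "prob_space M" and G: "gaussian_family M J Z c"
    and sym: "\<And>i k. i \<in> J \<Longrightarrow> k \<in> J \<Longrightarrow> c i k = c k i"
    and c: "\<And>i k. i \<in> J \<Longrightarrow> k \<in> J \<Longrightarrow> \<bar>c i k - of_bool (i = k)\<bar> \<le> \<eta>"
    and \<eta>: "0 \<le> \<eta>" "3 ^ card J * \<eta> \<le> 1/4" and b: "1 \<le> b"
    and m: "\<And>i. i \<in> J \<Longrightarrow> \<bar>m i\<bar> \<le> \<eta> * b"
    and B: "\<And>i. i \<in> J \<Longrightarrow> B i \<in> sets borel" "\<And>i. i \<in> J \<Longrightarrow> B i \<subseteq> {-b..b}"
  shows "measure M {\<omega>\<in>space M. \<forall>i\<in>J. m i + Z i \<omega> \<in> B i} \<le> exp (4 * 4 ^ card J * \<eta> * b\<^sup>2) * (\<Prod>i\<in>J. measure std_normal_distribution (B i))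
    \<and> exp (- (4 * 4 ^ card J * \<eta> * b\<^sup>2)) * (\<Prod>i\<in>J. measure std_normal_distribution (B i)) \<le> measure M {\<omega>\<in>space M. \<forall>i\<in>J. m i + Z i \<omega> \<in> B i}"
  using J G sym c \<eta> m B
proof (induction J arbitrary: Z c \<eta> m rule: finite_induct)
  case empty
  interpret prob_space M by fact
  show ?case using empty.prems by (simp add: prob_space)
next
  case (insert a J)
  interpret M: prob_space M by fact
  define v where "v = c a a"
  have card: "card (insert a J) = Suc (card J)" using insert.hyps by simp
  have \<eta>3: "\<eta> \<le> 1/12"
  proof -
    have "3 * \<eta> \<le> 3 ^ Suc (card J) * \<eta>" using insert.prems(4) by (intro mult_right_mono) auto
    then show ?thesis using insert.prems(5) card by simp
  qed
  have \<eta>0: "0 \<le> \<eta>" by fact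
  have v: "\<bar>v - 1\<bar> \<le> \<eta>" using insert.prems(3)[of a a] by (simp add: v_def)
  then have v0: "0 < v" "3/4 \<le> v" "v \<le> 5/4" using \<eta>3 by auto
  define N where "N = density lborel (normal_density 0 (sqrt v))"
  interpret N: prob_space N unfolding N_def using v0 by (intro prob_space_normal_density) simp
  define \<alpha> where "\<alpha> i = c a i / v" for i
  define Z' where "Z' i \<omega> = Z i \<omega> - \<alpha> i * Z a \<omega>" for i \<omega>
  define c' where "c' i k = c i k - c a i * c a k / v" for i k
  have ca: "\<bar>c a i\<bar> \<le> \<eta>" if "i \<in> J" for i
    using insert.prems(3)[of a i] that insert.hyps by (cases "a = i") auto
  have G': "gaussian_family M J Z' c'"
    using gaussian_family_residual[OF insert.prems(1) insert.hyps(1,2)] insert.prems(2) v0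
    unfolding Z'_def[abs_def] c'_def[abs_def] \<alpha>_def v_def by auto
  have \<alpha>: "\<bar>\<alpha> i\<bar> \<le> 4/3 * \<eta>" if "i \<in> J" for i
  proof -
    have "\<bar>\<alpha> i\<bar> \<le> \<eta> / (3/4)" unfolding \<alpha>_def abs_divide using ca[OF that] v0 \<eta>0 by (intro frac_le) auto
    then show ?thesis by simp
  qed
  \<comment> \<open>Regression changes a covariance by at most \<open>4/3 * \<eta>\<close>, so
    \<open>3 * \<eta>\<close> leaves room; this is the base 3 in the smallness condition on
    \<open>\<eta>\<close>.\<close>
  have c': "\<bar>c' i k - of_bool (i = k)\<bar> \<le> 3 * \<eta>" if "i \<in> J" "k \<in> J" for i k
  proof -
    have "\<bar>c a i * c a k / v\<bar> = \<bar>c a i\<bar> * \<bar>\<alpha> k\<bar>" by (simp add: \<alpha>_def abs_mult abs_divide)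
    also have "\<dots> \<le> 1 * (4/3 * \<eta>)" using ca[OF that(1)] \<alpha>[OF that(2)] \<eta>3 \<eta>0 by (intro mult_mono) auto
    finally have "\<bar>c a i * c a k / v\<bar> \<le> 4/3 * \<eta>" by simp
    moreover have "\<bar>c i k - of_bool (i = k)\<bar> \<le> \<eta>" using insert.prems(3) that by auto
    ultimately show ?thesis unfolding c'_def using \<eta>0 by linarith
  qed
  let ?U = "\<Prod>i\<in>J. measure std_normal_distribution (B i)"
  let ?E = "4 * 4 ^ card J * (3 * \<eta>) * b\<^sup>2"
  let ?p = "\<lambda>z. measure M {\<omega>\<in>space M. \<forall>i\<in>J. (m i + \<alpha> i * z) + Z' i \<omega> \<in> B i}"
  define A where "A = {z. m a + z \<in> B a}"
  have bnd: "?p z \<le> exp ?E * ?U \<and> exp (- ?E) * ?U \<le> ?p z" if "z \<in> A" for z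
  proof (rule insert.IH[OF G'])
    have "m a + z \<in> {-b..b}" using that insert.prems(8)[of a] by (auto simp: A_def)
    \<comment> \<open>On the shifted set the conditioning value stays within
      \<open>13/12 * b\<close>. The new shift is then at most
      \<open>\<eta> * b + 4/3 * 13/12 * \<eta> * b\<close>, below the \<open>3 * \<eta> * b\<close>
      allowed by the induction hypothesis.\<close>
    then have z: "\<bar>z\<bar> \<le> (13/12) * b"
    proof -
      have "\<eta> * b \<le> (1/12) * b" using \<eta>3 b by (intro mult_right_mono) auto
      moreover have "\<bar>m a\<bar> \<le> \<eta> * b" using insert.prems(6) by blast
      moreover have "- b \<le> m a + z" "m a + z \<le> b" using \<open>m a + z \<in> {-b..b}\<close> by auto
      ultimately show ?thesis by linarith
    qed
    fix i assume i: "i \<in> J"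
    have "\<bar>\<alpha> i * z\<bar> \<le> (4/3 * \<eta>) * ((13/12) * b)"
      unfolding abs_mult using \<alpha>[OF i] z \<eta>0 by (intro mult_mono) auto
    moreover have "\<bar>m i\<bar> \<le> \<eta> * b" using insert.prems(6) i by auto
    moreover have "(4/3 * \<eta>) * ((13/12) * b) \<le> 2 * (\<eta> * b)" using \<eta>0 b by simp
    ultimately show "\<bar>m i + \<alpha> i * z\<bar> \<le> 3 * \<eta> * b" by linarith
  qed (use insert.prems c' card \<eta>0 in \<open>auto simp: c'_def mult.commute\<close>)
  have shift: "{y. m i + y \<in> B i} \<in> sets borel" if "i \<in> insert a J" for i
    using measurable_sets[of "\<lambda>y. m i + y" borel borel "B i"] insert.prems(7)[OF that] by (simp add: vimage_def)
  \<comment> \<open>The shifts \<open>m\<close> are moved into the sets, so that the splitting lemma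
    applies to the centred family.\<close>
  have eq: "ennreal (measure M {\<omega>\<in>space M. \<forall>i\<in>insert a J. m i + Z i \<omega> \<in> B i}) = (\<integral>\<^sup>+z. indicator A z * ennreal (?p z) \<partial>N)"
    using emeasure_gaussian_split[OF M insert.prems(1) insert.hyps, of "\<lambda>i. {y. m i + y \<in> B i}"] insert.prems(2) v0 shift
    by (simp add: N_def v_def \<alpha>_def Z'_def A_def add.assoc del: ball_simps)
  have A: "A \<in> sets N" using shift[of a] by (simp add: A_def N_def)
  have NA: "measure N A \<le> exp (4 * \<eta> * b\<^sup>2) * measure std_normal_distribution (B a)"
    "exp (- (4 * \<eta> * b\<^sup>2)) * measure std_normal_distribution (B a) \<le> measure N A"
    unfolding N_def A_def
    by (rule normal_measure_ratio[OF \<eta>0 _ b v]; use insert.prems \<eta>3 in auto)+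
  have U0: "0 \<le> ?U" by (simp add: prod_nonneg)
  \<comment> \<open>The induction hypothesis at \<open>3 * \<eta>\<close> uses three quarters of the
    new exponent; the quarter left over is \<open>4 ^ card J\<close> times the cost
    \<open>4 * \<eta> * b\<^sup>2\<close> of the new coordinate. This is the origin of the base
    4.\<close>
  have E: "4 * \<eta> * b\<^sup>2 + ?E \<le> 4 * 4 ^ card (insert a J) * \<eta> * b\<^sup>2"
  proof -
    have "4 * \<eta> * b\<^sup>2 \<le> 4 ^ card J * (4 * \<eta> * b\<^sup>2)"
      using mult_right_mono[of 1 "4 ^ card J" "4 * \<eta> * b\<^sup>2"] \<eta>0 by simp
    then show ?thesis unfolding card by (simp add: algebra_simps)
  qed
  have prod_eq: "(\<Prod>i\<in>insert a J. measure std_normal_distribution (B i)) = measure std_normal_distribution (B a) * ?U"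
    using insert.hyps by simp
  have P0: "0 \<le> measure std_normal_distribution (B a) * ?U" using U0 by simp
  have "(\<integral>\<^sup>+z. indicator A z * ennreal (?p z) \<partial>N) \<le> (\<integral>\<^sup>+z. ennreal (exp ?E * ?U) * indicator A z \<partial>N)"
    using bnd by (intro nn_integral_mono) (auto simp: indicator_def intro: ennreal_leI)
  also have "\<dots> = ennreal (exp ?E * ?U) * ennreal (measure N A)"
    using A by (simp add: nn_integral_cmult_indicator N.emeasure_eq_measure)
  also have "\<dots> = ennreal (exp ?E * ?U * measure N A)" using U0 by (intro ennreal_mult[symmetric]) auto
  finally have "measure M {\<omega>\<in>space M. \<forall>i\<in>insert a J. m i + Z i \<omega> \<in> B i} \<le> exp ?E * ?U * measure N A"
    unfolding eq[symmetric] using U0 by (subst (asm) ennreal_le_iff) auto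
  also have "\<dots> \<le> exp ?E * ?U * (exp (4 * \<eta> * b\<^sup>2) * measure std_normal_distribution (B a))"
    using NA U0 by (intro mult_left_mono) auto
  also have "\<dots> = exp (4 * \<eta> * b\<^sup>2 + ?E) * (measure std_normal_distribution (B a) * ?U)"
    unfolding exp_add by (simp only: mult_ac)
  also have "\<dots> \<le> exp (4 * 4 ^ card (insert a J) * \<eta> * b\<^sup>2) * (measure std_normal_distribution (B a) * ?U)"
    using E P0 by (intro mult_right_mono) (simp_all only: exp_le_cancel_iff)
  finally have 1: "measure M {\<omega>\<in>space M. \<forall>i\<in>insert a J. m i + Z i \<omega> \<in> B i} \<le>
    exp (4 * 4 ^ card (insert a J) * \<eta> * b\<^sup>2) * (measure std_normal_distribution (B a) * ?U)" .
  have "exp (- (4 * 4 ^ card (insert a J) * \<eta> * b\<^sup>2)) * (measure std_normal_distribution (B a) * ?U)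
    \<le> exp (- (4 * \<eta> * b\<^sup>2) + - ?E) * (measure std_normal_distribution (B a) * ?U)"
  proof (rule mult_right_mono[OF _ P0])
    have "- (4 * 4 ^ card (insert a J) * \<eta> * b\<^sup>2) \<le> - (4 * \<eta> * b\<^sup>2) + - ?E" using E by linarith
    then show "exp (- (4 * 4 ^ card (insert a J) * \<eta> * b\<^sup>2)) \<le> exp (- (4 * \<eta> * b\<^sup>2) + - ?E)"
      by (simp only: exp_le_cancel_iff)
  qed
  also have "\<dots> = exp (- ?E) * ?U * (exp (- (4 * \<eta> * b\<^sup>2)) * measure std_normal_distribution (B a))"
    unfolding exp_add by (simp only: mult_ac)
  also have "\<dots> \<le> exp (- ?E) * ?U * measure N A"
    using NA U0 by (intro mult_left_mono) auto
  also have "\<dots> \<le> measure M {\<omega>\<in>space M. \<forall>i\<in>insert a J. m i + Z i \<omega> \<in> B i}"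
  proof -
    have "ennreal (exp (- ?E) * ?U * measure N A) = ennreal (exp (- ?E) * ?U) * ennreal (measure N A)"
      using U0 by (intro ennreal_mult) auto
    also have "\<dots> = (\<integral>\<^sup>+z. ennreal (exp (- ?E) * ?U) * indicator A z \<partial>N)"
      using A by (simp add: nn_integral_cmult_indicator N.emeasure_eq_measure)
    also have "\<dots> \<le> (\<integral>\<^sup>+z. indicator A z * ennreal (?p z) \<partial>N)"
      using bnd by (intro nn_integral_mono) (auto simp: indicator_def intro: ennreal_leI)
    finally show ?thesis unfolding eq[symmetric] by (subst (asm) ennreal_le_iff) auto
  qed
  finally show ?case unfolding prod_eq using 1 by blast
qed

section \<open>Finite point configurations in the vague topology\<close>

text \<open>A pushforward of counting measure: indices sent to the same point add up, so
  multiplicities are kept.\<close>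

definition point_sum :: "'e::topological_space set \<Rightarrow> 'i set \<Rightarrow> ('i \<Rightarrow> 'e) \<Rightarrow> 'e measure" where
  "point_sum E A v = distr (count_space A) (restrict_space borel E) v"

lemma sets_point_sum[simp]: "sets (point_sum E A v) = sets (restrict_space borel E)"
  by (simp add: point_sum_def)

lemma point_sum_measurable:
  assumes "v \<in> A \<rightarrow> E"
  shows "v \<in> count_space A \<rightarrow>\<^sub>M restrict_space borel E"
  using assms by (auto simp: measurable_restrict_space2_iff)

lemma emeasure_point_sum:
  assumes A: "finite A" "v \<in> A \<rightarrow> E" and B: "B \<in> sets (restrict_space borel E)"
  shows "emeasure (point_sum E A v) B = of_nat (card {i\<in>A. v i \<in> B})"
proof -
  have "v -` B \<inter> A = {i\<in>A. v i \<in> B}" by auto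
  then show ?thesis
    using A B point_sum_measurable[OF A(2)] unfolding point_sum_def
    by (subst emeasure_distr) (auto simp: emeasure_count_space_finite)
qed

lemma integral_point_sum:
  fixes f :: "'e::topological_space \<Rightarrow> real"
  assumes A: "finite A" "v \<in> A \<rightarrow> E" and f: "f \<in> borel_measurable (restrict_space borel E)"
  shows "(LINT x|point_sum E A v. f x) = (\<Sum>i\<in>A. f (v i))"
  unfolding point_sum_def using A f point_sum_measurable[OF A(2)]
  by (subst integral_distr) (auto simp: lebesgue_integral_count_space_finite)

lemma point_sum_in_point_measures:
  assumes A: "finite A" "v \<in> A \<rightarrow> E"
  shows "point_sum E A v \<in> point_measures E"
proof -
  have e: "\<exists>k::nat. emeasure (point_sum E A v) B = of_nat k" for B
    using emeasure_point_sum[OF A] emeasure_notin_sets[of B "point_sum E A v"]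
    by (cases "B \<in> sets (restrict_space borel E)") (auto intro: exI[of _ 0])
  have "\<exists>k::enat. emeasure (point_sum E A v) B = ennreal_of_enat k" for B
    using e[of B] by (metis ennreal_of_enat_enat)
  moreover have "emeasure (point_sum E A v) B < \<infinity>" for B
    using e[of B] by (auto simp: of_nat_less_top)
  ultimately show ?thesis by (simp add: point_measures_def)
qed

lemma point_sum_cong:
  assumes "\<And>i. i \<in> A \<Longrightarrow> v i = w i"
  shows "point_sum E A v = point_sum E A w"
  unfolding point_sum_def using assms by (intro distr_cong) auto

lemma point_sum_reindex:
  assumes A: "finite A" "inj_on f A" and v: "v \<in> f ` A \<rightarrow> E"
  shows "point_sum E (f ` A) v = point_sum E A (v \<circ> f)"
proof (rule measure_eqI)
  fix B assume "B \<in> sets (point_sum E (f ` A) v)"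
  then have B: "B \<in> sets (restrict_space borel E)" by simp
  have "{i\<in>f ` A. v i \<in> B} = f ` {i\<in>A. (v \<circ> f) i \<in> B}" by auto
  then have "card {i\<in>f ` A. v i \<in> B} = card {i\<in>A. (v \<circ> f) i \<in> B}"
    using A by (auto intro!: card_image inj_on_subset[OF A(2)])
  then show "emeasure (point_sum E (f ` A) v) B = emeasure (point_sum E A (v \<circ> f)) B"
    using A v B by (subst (1 2) emeasure_point_sum) auto
qed simp

lemma compactly_supported_measurable:
  "f \<in> compactly_supported_on E \<Longrightarrow> f \<in> borel_measurable (restrict_space borel E)"
  by (auto simp: compactly_supported_on_def intro: borel_measurable_continuous_on_restrict)

text \<open>Passing from membership of the limit to eventual membership of the sequence is
  compatible with finite intersections and arbitrary unions. It is therefore checked only on the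
  generating sets, where the integral is a finite sum of values of a function continuous on
  \<open>E\<close>; no metric for the vague topology is involved.\<close>

lemma vague_sequential_continuity:
  assumes A: "finite A" "\<And>n. v n \<in> A \<rightarrow> E" "w \<in> A \<rightarrow> E"
    and lim: "\<And>i. i \<in> A \<Longrightarrow> (\<lambda>n. v n i) \<longlonglongrightarrow> w i"
    and h: "continuous_map (vague_topology E) euclideanreal h"
  shows "(\<lambda>n. h (point_sum E A (v n))) \<longlonglongrightarrow> h (point_sum E A w)"
proof -
  have ev: "point_sum E A w \<in> U \<longrightarrow> (\<forall>\<^sub>F n in sequentially. point_sum E A (v n) \<in> U)"
    if "openin (vague_topology E) U" for U
    using that unfolding vague_topology_def openin_topology_generated_by_iff
  proof induction
    case Empty then show ?case by simp
  next
    case (Int a b) then show ?case by (auto simp: eventually_conj_iff)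
  next
    case (UN K)
    show ?case
    proof
      assume "point_sum E A w \<in> \<Union>K"
      then obtain X where X: "X \<in> K" "point_sum E A w \<in> X" by auto
      from UN.IH[OF X(1)] X(2) have "\<forall>\<^sub>F n in sequentially. point_sum E A (v n) \<in> X" by simp
      then show "\<forall>\<^sub>F n in sequentially. point_sum E A (v n) \<in> \<Union>K"
        by (rule eventually_mono) (use X in auto)
    qed
  next
    case (Basis s)
    then obtain f U where s: "s = {\<nu> \<in> point_measures E. (LINT x|\<nu>. f x) \<in> U}"
      and f: "f \<in> compactly_supported_on E" and U: "open U" by auto
    have fm: "f \<in> borel_measurable (restrict_space borel E)" by (rule compactly_supported_measurable) fact
    have fc: "continuous_on E f" using f by (simp add: compactly_supported_on_def)
    have "(\<lambda>n. \<Sum>i\<in>A. f (v n i)) \<longlonglongrightarrow> (\<Sum>i\<in>A. f (w i))"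
    proof (rule tendsto_sum)
      fix i assume "i \<in> A"
      then show "(\<lambda>n. f (v n i)) \<longlonglongrightarrow> f (w i)"
        using A by (intro continuous_on_tendsto_compose[OF fc lim]) (auto simp: Pi_iff)
    qed
    then have "(\<Sum>i\<in>A. f (w i)) \<in> U \<longrightarrow> (\<forall>\<^sub>F n in sequentially. (\<Sum>i\<in>A. f (v n i)) \<in> U)"
      using U by (auto dest: topological_tendstoD)
    then show ?case
      using A by (simp add: s integral_point_sum[OF _ _ fm] point_sum_in_point_measures)
  qed
  show ?thesis
  proof (rule topological_tendstoI)
    fix S :: "real set" assume S: "open S" "h (point_sum E A w) \<in> S"
    have "openin (vague_topology E) {x \<in> topspace (vague_topology E). h x \<in> S}"
      using h S by (auto simp: continuous_map_def)
    from ev[OF this] show "\<forall>\<^sub>F n in sequentially. h (point_sum E A (v n)) \<in> S"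
      using S A by (auto simp: topspace_vague point_sum_in_point_measures elim: eventually_mono)
  qed
qed

lemma vague_open_preimage:
  fixes E :: "'e::topological_space set"
  assumes A: "finite A" and U: "openin (vague_topology E) U"
  shows "openin (top_of_set {v. \<forall>i. v i \<in> E}) {v. (\<forall>i. v i \<in> E) \<and> point_sum E A v \<in> U}"
  using U unfolding vague_topology_def openin_topology_generated_by_iff
proof induction
  case Empty then show ?case by simp
next
  case (Int a b)
  have "{v. (\<forall>i. v i \<in> E) \<and> point_sum E A v \<in> a \<inter> b} =
    {v. (\<forall>i. v i \<in> E) \<and> point_sum E A v \<in> a} \<inter> {v. (\<forall>i. v i \<in> E) \<and> point_sum E A v \<in> b}" by auto
  then show ?case using Int by (simp add: openin_Int)
next
  case (UN K)
  have "{v. (\<forall>i. v i \<in> E) \<and> point_sum E A v \<in> \<Union>K} = (\<Union>k\<in>K. {v. (\<forall>i. v i \<in> E) \<and> point_sum E A v \<in> k})" by auto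
  then show ?case using UN by (auto intro!: openin_Union simp del: Union_iff)
next
  case (Basis s)
  then obtain f U where s: "s = {\<nu> \<in> point_measures E. (LINT x|\<nu>. f x) \<in> U}"
    and f: "f \<in> compactly_supported_on E" and U: "open U" by auto
  let ?S = "{v :: 'a \<Rightarrow> 'e. \<forall>i. v i \<in> E}"
  have fm: "f \<in> borel_measurable (restrict_space borel E)" by (rule compactly_supported_measurable) fact
  have fc: "continuous_on E f" using f by (simp add: compactly_supported_on_def)
  have "continuous_on ?S (\<lambda>v. \<Sum>i\<in>A. f (v i))"
    by (intro continuous_on_sum continuous_on_compose2[OF fc] continuous_on_subset[OF continuous_on_product_coordinates]) auto
  from continuous_openin_preimage_gen[OF this U]
  have "openin (top_of_set ?S) (?S \<inter> (\<lambda>v. \<Sum>i\<in>A. f (v i)) -` U)" .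
  also have "?S \<inter> (\<lambda>v. \<Sum>i\<in>A. f (v i)) -` U = {v. (\<forall>i. v i \<in> E) \<and> point_sum E A v \<in> s}"
    using A by (auto simp: s integral_point_sum[OF _ _ fm] point_sum_in_point_measures)
  finally show ?case .
qed

text \<open>Openness in the product topology suffices: the space is second countable and the index
  set countable, so the product sigma-algebra is the Borel algebra of the product.\<close>

lemma point_sum_vague_measurable:
  fixes V :: "'e::second_countable_topology measure"
  assumes A: "finite A" and V: "sets V = sets (restrict_space borel E)" and U: "openin (vague_topology E) U"
  shows "{v \<in> space (PiM (UNIV :: 'i::countable set) (\<lambda>_. V)). point_sum E A v \<in> U} \<in> sets (PiM UNIV (\<lambda>_. V))"
proof -
  have sp: "space (PiM UNIV (\<lambda>_. V)) = {v :: 'i \<Rightarrow> 'e. \<forall>i. v i \<in> E}"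
    using sets_eq_imp_space_eq[OF V] by (auto simp: space_PiM space_restrict_space PiE_def Pi_iff)
  obtain T where T: "open T" "{v. (\<forall>i. v i \<in> E) \<and> point_sum E A v \<in> U} = T \<inter> {v. \<forall>i. v i \<in> E}"
    using vague_open_preimage[OF A U] by (auto simp: openin_open)
  have "(\<lambda>v i. v i) \<in> PiM UNIV (\<lambda>_. V) \<rightarrow>\<^sub>M PiM (UNIV :: 'i set) (\<lambda>_. borel)"
  proof (rule measurable_PiM_single')
    show "(\<lambda>v. v i) \<in> PiM UNIV (\<lambda>_. V) \<rightarrow>\<^sub>M borel" for i :: 'i
    proof -
      have "(\<lambda>x. x) \<in> V \<rightarrow>\<^sub>M borel"
        using measurable_restrict_space1[OF measurable_ident, of borel E] V by (simp add: id_def measurable_cong_sets[OF V refl])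
      then show ?thesis by (rule measurable_compose[rotated]) (rule measurable_component_singleton, simp)
    qed
  qed auto
  moreover have "T \<in> sets (PiM (UNIV :: 'i set) (\<lambda>_. borel))"
    using T by (simp add: sets_PiM_equal_borel)
  ultimately have "(\<lambda>v i. v i) -` T \<inter> space (PiM UNIV (\<lambda>_. V)) \<in> sets (PiM (UNIV :: 'i set) (\<lambda>_. V))"
    by (rule measurable_sets)
  also have "(\<lambda>v i. v i) -` T \<inter> space (PiM UNIV (\<lambda>_. V)) = {v \<in> space (PiM UNIV (\<lambda>_. V)). point_sum E A v \<in> U}"
    using T(2) by (auto simp: sp)
  finally show ?thesis .
qed

lemma exceedances_eq_point_sum:
  "exceedances u x y n = point_sum bivariate_space {(i, d) \<in> {1..n} \<times> {1, 2}. xi d (y i) > u n (x d)} (\<lambda>(i, d). (real i / real n, d))"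
proof (rule measure_eqI)
  have s: "sets (exceedances u x y n) = sets (restrict_space borel bivariate_space)"
    using exceedances_point_measure[of u x y n] by (simp add: point_measures_def)
  then show "sets (exceedances u x y n) = sets (point_sum bivariate_space {(i, d) \<in> {1..n} \<times> {1, 2}. xi d (y i) > u n (x d)} (\<lambda>(i, d). (real i / real n, d)))"
    by simp
  fix B assume "B \<in> sets (exceedances u x y n)"
  then have B: "B \<in> sets (restrict_space borel bivariate_space)" using s by simp
  let ?A = "{(i, d) \<in> {1..n} \<times> {1, 2}. xi d (y i) > u n (x d)}"
  let ?P = "\<lambda>i d. xi d (y i) > u n (x d) \<and> (real i / real n, d) \<in> B"
  have fin: "finite ?A" by (rule finite_subset[of _ "{1..n} \<times> {1, 2}"]) auto
  have "(\<lambda>(i, d). (real i / real n, d)) \<in> ?A \<rightarrow> bivariate_space"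
    by (auto simp: bivariate_space_def)
  from emeasure_point_sum[OF fin this B]
  have "emeasure (point_sum bivariate_space ?A (\<lambda>(i, d). (real i / real n, d))) B = of_nat (card {p\<in>?A. (case p of (i, d) \<Rightarrow> (real i / real n, d)) \<in> B})" .
  also have "{p\<in>?A. (case p of (i, d) \<Rightarrow> (real i / real n, d)) \<in> B} = {p \<in> {1..n} \<times> {1, 2}. ?P (fst p) (snd p)}"
    by auto
  also have "of_nat (card \<dots>) = (\<Sum>p\<in>{1..n} \<times> {1, 2}. if ?P (fst p) (snd p) then 1 else 0 :: ennreal)"
    by (simp add: sum.If_cases Int_def)
  also have "\<dots> = (\<Sum>i\<in>{1..n}. \<Sum>d\<in>{1, 2}. if ?P i d then 1 else 0)"
    by (simp only: sum.cartesian_product split_def)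
  also have "\<dots> = emeasure (exceedances u x y n) B"
    unfolding emeasure_exceedances[OF B] by (rule sum.swap)
  finally show "emeasure (exceedances u x y n) B = emeasure (point_sum bivariate_space ?A (\<lambda>(i, d). (real i / real n, d))) B"
    by simp
qed

section \<open>The Poisson process as a sample of Poisson size\<close>

lemma poisson_expectation:
  fixes f :: "nat \<Rightarrow> 'b::{banach, second_countable_topology}"
  assumes lam: "0 < lam" and f: "\<And>k. norm (f k) \<le> C"
  shows "(\<lambda>k. (lam ^ k / fact k * exp (- lam)) *\<^sub>R f k) sums (LINT k|measure_pmf (poisson_pmf lam). f k)"
proof -
  have i: "integrable (measure_pmf (poisson_pmf lam)) f"
    by (rule measure_pmf.integrable_const_bound[of _ C]) (use f in auto)
  then have i': "integrable (count_space UNIV) (\<lambda>k. pmf (poisson_pmf lam) k *\<^sub>R f k)"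
    unfolding measure_pmf_eq_density by (subst (asm) integrable_density) auto
  have "(LINT k|measure_pmf (poisson_pmf lam). f k) = (LINT k|count_space UNIV. pmf (poisson_pmf lam) k *\<^sub>R f k)"
    unfolding measure_pmf_eq_density by (rule integral_density) auto
  then show ?thesis
    using sums_integral_count_space_nat[OF i'] pmf_poisson[OF lam] by simp
qed

lemma poisson_pgf:
  fixes z :: complex
  assumes lam: "0 < lam" and z: "cmod z \<le> 1"
  shows "(LINT k|measure_pmf (poisson_pmf lam). z ^ k) = exp (lam * (z - 1))"
proof (rule sums_unique2[OF poisson_expectation[OF lam, of _ 1]])
  show "norm (z ^ k) \<le> 1" for k using z by (simp add: norm_power power_le_one)
  have "(\<lambda>k. (lam * z) ^ k /\<^sub>R fact k) sums exp (lam * z)" by (rule exp_converges)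
  from sums_mult[OF this, of "exp (- lam)"]
  have "(\<lambda>k. exp (- lam) * ((lam * z) ^ k /\<^sub>R fact k)) sums (exp (- lam) * exp (lam * z))"
    by (simp add: of_real_exp exp_minus)
  also have "complex_of_real (exp (- lam)) * exp (lam * z) = exp (lam * (z - 1))"
    by (simp add: exp_of_real[symmetric] exp_add[symmetric] algebra_simps)
  also have "(\<lambda>k. complex_of_real (exp (- lam)) * ((lam * z) ^ k /\<^sub>R fact k)) = (\<lambda>k. (lam ^ k / fact k * exp (- lam)) *\<^sub>R z ^ k)"
    by (auto simp: scaleR_conv_of_real power_mult_distrib field_simps)
  finally show "(\<lambda>k. (lam ^ k / fact k * exp (- lam)) *\<^sub>R z ^ k) sums exp (lam * (z - 1))" .
qed

lemma indep_vars_PiM_coordinates: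
  assumes V: "prob_space V"
  shows "prob_space.indep_vars (PiM (UNIV :: 'i set) (\<lambda>_. V)) (\<lambda>_. V) (\<lambda>i v. v i) UNIV"
proof -
  interpret P: prob_space "PiM (UNIV :: 'i set) (\<lambda>_. V)" using V by (intro prob_space_PiM) auto
  have "distr (PiM (UNIV :: 'i set) (\<lambda>_. V)) (PiM UNIV (\<lambda>_. V)) (\<lambda>v. \<lambda>i\<in>UNIV. v i) = PiM UNIV (\<lambda>_. V)"
    using distr_PiM_reindex[of UNIV "\<lambda>_. V" "\<lambda>i. i" UNIV] V by simp
  also have "\<dots> = PiM UNIV (\<lambda>i. distr (PiM UNIV (\<lambda>_. V)) V (\<lambda>v. v i))"
    using V by (subst distr_PiM_component) auto
  finally show ?thesis
    by (subst P.indep_vars_iff_distr_eq_PiM) auto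
qed

lemma iid_char:
  assumes V: "prob_space V" and \<theta>[measurable]: "\<theta> \<in> borel_measurable V"
  shows "(CLINT v|PiM (UNIV :: nat set) (\<lambda>_. V). iexp (\<Sum>l<k. \<theta> (v l))) = (CLINT y|V. iexp (\<theta> y)) ^ k"
proof -
  interpret P: prob_space "PiM (UNIV :: nat set) (\<lambda>_. V)" using V by (intro prob_space_PiM) auto
  have ind: "P.indep_vars (\<lambda>_. borel) (\<lambda>l v. iexp (\<theta> (v l))) {..<k}"
    by (rule P.indep_vars_compose2[OF P.indep_vars_subset[OF indep_vars_PiM_coordinates[OF V]]])
      (auto intro!: measurable_compose[OF \<theta>])
  have "(CLINT v|PiM (UNIV :: nat set) (\<lambda>_. V). iexp (\<Sum>l<k. \<theta> (v l))) = (CLINT v|PiM (UNIV :: nat set) (\<lambda>_. V). \<Prod>l<k. iexp (\<theta> (v l)))"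
    by (simp add: exp_sum sum_distrib_left)
  also have "\<dots> = (\<Prod>l<k. CLINT v|PiM (UNIV :: nat set) (\<lambda>_. V). iexp (\<theta> (v l)))"
  proof (rule P.indep_vars_lebesgue_integral[OF _ ind])
    show "complex_integrable (PiM UNIV (\<lambda>_. V)) (\<lambda>v. iexp (\<theta> (v i)))" for i :: nat
      by (rule bounded_integrable[OF P.prob_space_axioms, where C = 1]) (simp_all only: norm_exp_i_times order_refl, measurable)
  qed simp
  also have "\<dots> = (\<Prod>l<k. CLINT y|V. iexp (\<theta> y))"
  proof (rule prod.cong[OF refl])
    fix l :: nat
    have "distr (PiM UNIV (\<lambda>_. V)) V (\<lambda>v. v l) = V"
      using V by (intro distr_PiM_component) auto
    then have "(CLINT y|V. iexp (\<theta> y)) = (CLINT y|distr (PiM UNIV (\<lambda>_. V)) V (\<lambda>v. v l). iexp (\<theta> y))" by simp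
    also have "\<dots> = (CLINT v|PiM (UNIV :: nat set) (\<lambda>_. V). iexp (\<theta> (v l)))"
      by (rule integral_distr) measurable
    finally show "(CLINT v|PiM (UNIV :: nat set) (\<lambda>_. V). iexp (\<theta> (v l))) = (CLINT y|V. iexp (\<theta> y))" by simp
  qed
  finally show ?thesis by simp
qed

text \<open>A Poisson number together with an infinite supply of points, of which only the first
  \<open>fst x\<close> will be used: number and points then sit in a product space and are
  independent by construction.\<close>

definition mixed_space :: "real \<Rightarrow> 'e measure \<Rightarrow> (nat \<times> (nat \<Rightarrow> 'e)) measure" where
  "mixed_space lam V = measure_pmf (poisson_pmf lam) \<Otimes>\<^sub>M PiM UNIV (\<lambda>_. V)"

lemma prob_mixed_space: "prob_space V \<Longrightarrow> prob_space (mixed_space lam V)"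
  unfolding mixed_space_def
  by (intro prob_space_pair prob_space_measure_pmf prob_space_PiM)

lemma sets_mixed_space:
  "sets (mixed_space lam V) = sets (count_space UNIV \<Otimes>\<^sub>M PiM UNIV (\<lambda>_. V))"
  unfolding mixed_space_def by (intro sets_pair_measure_cong) auto

lemma measurable_mixed_space:
  assumes "\<And>k. (\<lambda>v. f (k, v)) \<in> PiM UNIV (\<lambda>_. V) \<rightarrow>\<^sub>M N"
  shows "f \<in> mixed_space lam V \<rightarrow>\<^sub>M N"
  unfolding measurable_cong_sets[OF sets_mixed_space refl]
  using assms by (intro measurable_pair_measure_countable1) auto

lemma integral_mixed_space:
  fixes f :: "nat \<times> (nat \<Rightarrow> 'e) \<Rightarrow> 'b::{banach, second_countable_topology}"
  assumes V: "prob_space V" and f: "f \<in> borel_measurable (mixed_space lam V)" "\<And>x. norm (f x) \<le> C"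
  shows "(LINT x|mixed_space lam V. f x) = (LINT k|measure_pmf (poisson_pmf lam). LINT v|PiM UNIV (\<lambda>_. V). f (k, v))"
proof -
  interpret W: prob_space "PiM (UNIV :: nat set) (\<lambda>_. V)" using V by (intro prob_space_PiM) auto
  interpret P: pair_prob_space "measure_pmf (poisson_pmf lam)" "PiM (UNIV :: nat set) (\<lambda>_. V)" ..
  have "integrable (mixed_space lam V) f"
    by (rule bounded_integrable[OF prob_mixed_space[OF V] f])
  then show ?thesis
    unfolding mixed_space_def by (rule P.integral_fst'[symmetric])
qed

section \<open>Counts of the sample points in disjoint sets\<close>

definition hits :: "'e set \<Rightarrow> nat \<times> (nat \<Rightarrow> 'e) \<Rightarrow> real" where
  "hits B x = (\<Sum>l<fst x. indicator B (snd x l))"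

lemma hits_measurable:
  assumes [measurable]: "B \<in> sets V"
  shows "hits B \<in> borel_measurable (mixed_space lam V)"
  by (rule measurable_mixed_space) (simp add: hits_def)

text \<open>At most one of the disjoint sets contains a given point, so
  \<open>iexp (\<theta> y)\<close> is affine in the indicators and its mean is explicit. The
  generating function of the Poisson number puts this mean into an exponent, where the sum over
  \<open>J\<close> becomes a product: independence and the Poisson marginals follow from the same
  formula.\<close>

lemma hits_char:
  assumes V: "prob_space V" and lam: "0 < lam" and J: "finite J" "disjoint_family_on B J"
    and B: "\<And>i. i \<in> J \<Longrightarrow> B i \<in> sets V"
  shows "(CLINT x|mixed_space lam V. iexp (\<Sum>i\<in>J. t i * hits (B i) x)) =
    exp (\<Sum>i\<in>J. lam * measure V (B i) * (iexp (t i) - 1))"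
proof -
  interpret V: prob_space V by fact
  interpret W: prob_space "PiM (UNIV :: nat set) (\<lambda>_. V)" using V by (intro prob_space_PiM) auto
  define \<theta> where "\<theta> y = (\<Sum>i\<in>J. t i * indicator (B i) y)" for y
  have \<theta>[measurable]: "\<theta> \<in> borel_measurable V" unfolding \<theta>_def[abs_def] using B by measurable
  have s: "(\<Sum>i\<in>J. t i * hits (B i) x) = (\<Sum>l<fst x. \<theta> (snd x l))" for x
    unfolding hits_def \<theta>_def sum_distrib_left by (rule sum.swap)
  have \<theta>': "iexp (\<theta> y) = 1 + (\<Sum>i\<in>J. indicator (B i) y * (iexp (t i) - 1))" for y
  proof (cases "\<exists>i\<in>J. y \<in> B i")
    case True
    then obtain i where i: "i \<in> J" "y \<in> B i" by auto
    have out: "y \<notin> B j" if "j \<in> J" "j \<noteq> i" for j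
      using J(2) i that by (auto simp: disjoint_family_on_def)
    have "\<theta> y = (\<Sum>j\<in>J. if j = i then t j else 0)"
      unfolding \<theta>_def using out i by (intro sum.cong) auto
    then have "\<theta> y = t i" using i J(1) by simp
    moreover have "(\<Sum>i\<in>J. indicator (B i) y * (iexp (t i) - 1)) = iexp (t i) - 1"
    proof -
      have "(\<Sum>j\<in>J. indicator (B j) y * (iexp (t j) - 1)) = (\<Sum>j\<in>J. if j = i then iexp (t j) - 1 else 0)"
        using out i by (intro sum.cong) auto
      then show ?thesis using i J(1) by simp
    qed
    ultimately show ?thesis by simp
  next
    case False
    then show ?thesis by (simp add: \<theta>_def indicator_def)
  qed
  have i: "complex_integrable V (\<lambda>y. indicator (B i) y * (iexp (t i) - 1))" if "i \<in> J" for i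
    using B[OF that]
    by (intro integrable_mult_left bounded_integrable[OF V, where C = 1]) (auto simp: indicator_def)
  have "(CLINT y|V. indicator (B i) y) = complex_of_real (measure V (B i))" if "i \<in> J" for i
  proof -
    have "(CLINT y|V. indicator (B i) y) = (CLINT y|V. complex_of_real (indicator (B i) y))"
      by (intro Bochner_Integration.integral_cong) (auto simp: indicator_def)
    then show ?thesis using B[OF that] by (simp add: integral_complex_of_real)
  qed
  then have 1: "(CLINT y|V. iexp (\<theta> y)) = 1 + (\<Sum>i\<in>J. measure V (B i) * (iexp (t i) - 1))"
    unfolding \<theta>' using i by (subst Bochner_Integration.integral_add) (auto simp: V.prob_space)
  have z: "cmod (CLINT y|V. iexp (\<theta> y)) \<le> 1"
  proof -
    have "cmod (CLINT y|V. iexp (\<theta> y)) \<le> (LINT y|V. cmod (iexp (\<theta> y)))" by (rule integral_norm_bound)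
    also have "\<dots> = 1" by (simp only: norm_exp_i_times) (simp add: V.prob_space)
    finally show ?thesis .
  qed
  have "(CLINT x|mixed_space lam V. iexp (\<Sum>i\<in>J. t i * hits (B i) x)) =
    (CLINT k|measure_pmf (poisson_pmf lam). CLINT v|PiM UNIV (\<lambda>_. V). iexp (\<Sum>i\<in>J. t i * hits (B i) (k, v)))"
  proof (rule integral_mixed_space[OF V, where C = 1])
    have "(\<lambda>x. \<Sum>i\<in>J. t i * hits (B i) x) \<in> borel_measurable (mixed_space lam V)"
      using B by (intro borel_measurable_sum borel_measurable_times borel_measurable_const hits_measurable)
    then show "(\<lambda>x. iexp (\<Sum>i\<in>J. t i * hits (B i) x)) \<in> borel_measurable (mixed_space lam V)"
      by (rule measurable_compose) simp
  qed (simp only: norm_exp_i_times order_refl)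
  also have "\<dots> = (CLINT k|measure_pmf (poisson_pmf lam). (CLINT y|V. iexp (\<theta> y)) ^ k)"
    unfolding s fst_conv snd_conv iid_char[OF V \<theta>] ..
  also have "\<dots> = exp (lam * ((CLINT y|V. iexp (\<theta> y)) - 1))"
    by (rule poisson_pgf[OF lam z])
  also have "\<dots> = exp (\<Sum>i\<in>J. lam * measure V (B i) * (iexp (t i) - 1))"
    unfolding 1 by (simp add: sum_distrib_left mult.assoc)
  finally show ?thesis .
qed

lemma hits_rectangle:
  assumes V: "prob_space V" and lam: "0 < lam" and J: "finite J" "disjoint_family_on B J"
    and B: "\<And>i. i \<in> J \<Longrightarrow> B i \<in> sets V" and D: "\<And>i. i \<in> J \<Longrightarrow> D i \<in> sets borel"
  shows "measure (mixed_space lam V) {x\<in>space (mixed_space lam V). \<forall>i\<in>J. hits (B i) x \<in> D i} =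
    (\<Prod>i\<in>J. measure (mixed_space lam V) {x\<in>space (mixed_space lam V). hits (B i) x \<in> D i})"
proof (rule rectangle_of_char_product[OF J(1) prob_mixed_space[OF V] hits_measurable[OF B] _ D])
  fix t
  have "(CLINT x|mixed_space lam V. iexp (t i * hits (B i) x)) = exp (lam * measure V (B i) * (iexp (t i) - 1))" if "i \<in> J" for i
    using hits_char[OF V lam, of "{i}" B t] B[OF that] by (simp add: disjoint_family_on_def)
  then have "(\<Prod>i\<in>J. CLINT x|mixed_space lam V. iexp (t i * hits (B i) x)) = (\<Prod>i\<in>J. exp (lam * measure V (B i) * (iexp (t i) - 1)))"
    by (intro prod.cong) auto
  also have "\<dots> = exp (\<Sum>i\<in>J. lam * measure V (B i) * (iexp (t i) - 1))"
    using J(1) by (rule exp_sum[symmetric])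
  also have "\<dots> = (CLINT x|mixed_space lam V. iexp (\<Sum>i\<in>J. t i * hits (B i) x))"
    by (rule hits_char[OF V lam J B, symmetric])
  finally show "(CLINT x|mixed_space lam V. iexp (\<Sum>i\<in>J. t i * hits (B i) x)) =
      (\<Prod>i\<in>J. CLINT x|mixed_space lam V. iexp (t i * hits (B i) x))" by (rule sym)
qed

lemma hits_poisson:
  assumes V: "prob_space V" and lam: "0 < lam" and B: "B \<in> sets V"
  shows "measure (mixed_space lam V) {x\<in>space (mixed_space lam V). hits B x = real k} =
    exp (- (lam * measure V B)) * (lam * measure V B) ^ k / fact k"
proof -
  let ?m = "lam * measure V B"
  \<comment> \<open>For a null set the count is almost surely 0, so rate zero is represented by the
    point mass.\<close>
  define p where "p = (if ?m = 0 then return_pmf 0 else poisson_pmf ?m)"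
  have m: "?m = 0 \<or> 0 < ?m" using lam by (auto simp: less_le)
  have pgf: "(LINT k|measure_pmf p. z ^ k) = exp (?m * (z - 1))" if "cmod z \<le> 1" for z :: complex
  proof (cases "?m = 0")
    case True
    have "(LINT k|measure_pmf p. z ^ k) = 1" using True by (simp add: p_def)
    moreover have "complex_of_real ?m * (z - 1) = 0" unfolding True by simp
    ultimately show ?thesis by (simp only: exp_zero)
  next
    case False
    then show ?thesis using m poisson_pgf[OF _ that, of ?m] by (simp add: p_def)
  qed
  have "measure (mixed_space lam V) {x\<in>space (mixed_space lam V). \<forall>i\<in>{()}. hits B x \<in> {real k}} =
    measure (measure_pmf p) {n \<in> space (measure_pmf p). \<forall>i\<in>{()}. real n \<in> {real k}}"
  proof (rule family_char_unique[OF _ prob_mixed_space[OF V] _ prob_space_measure_pmf])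
    fix t :: "unit \<Rightarrow> real"
    have "(CLINT n|measure_pmf p. iexp (t () * real n)) = (CLINT n|measure_pmf p. iexp (t ()) ^ n)"
      by (simp add: exp_of_nat_mult[symmetric] mult_ac)
    also have "\<dots> = exp (?m * (iexp (t ()) - 1))"
      using pgf[of "iexp (t ())"] by (simp only: norm_exp_i_times order_refl)
    also have "\<dots> = (CLINT x|mixed_space lam V. iexp (t () * hits B x))"
      using hits_char[OF V lam, of "{()}" "\<lambda>_. B" t] B by (simp add: disjoint_family_on_def)
    finally show "(CLINT x|mixed_space lam V. iexp (\<Sum>i\<in>{()}. t i * hits B x)) =
      (CLINT n|measure_pmf p. iexp (\<Sum>i\<in>{()}. t i * real n))" by simp
  qed (use B in \<open>auto intro: hits_measurable\<close>)
  then show ?thesis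
    using pmf_poisson[of ?m k] m by (auto simp: measure_pmf_single p_def indicator_def power_0_left)
qed

lemma (in prob_space) indep_varsI_rectangle:
  fixes X :: "'i \<Rightarrow> 'a \<Rightarrow> 'b::topological_space"
  assumes J: "finite J" "J \<noteq> {}" and X: "\<And>i. i \<in> J \<Longrightarrow> X i \<in> borel_measurable M"
    and eq: "\<And>D. (\<And>i. i \<in> J \<Longrightarrow> D i \<in> sets borel) \<Longrightarrow>
      prob {\<omega>\<in>space M. \<forall>i\<in>J. X i \<omega> \<in> D i} = (\<Prod>i\<in>J. prob {\<omega>\<in>space M. X i \<omega> \<in> D i})"
  shows "indep_vars (\<lambda>_. borel) X J"
proof (subst indep_vars_finite[OF J(2,1), where E = "\<lambda>_. sets borel"])
  show "\<forall>A\<in>J \<rightarrow> sets borel. prob (\<Inter>j\<in>J. X j -` A j \<inter> space M) = (\<Prod>j\<in>J. prob (X j -` A j \<inter> space M))"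
  proof
    fix A :: "'i \<Rightarrow> 'b set" assume A: "A \<in> J \<rightarrow> sets borel"
    have "(\<Inter>j\<in>J. X j -` A j \<inter> space M) = {\<omega>\<in>space M. \<forall>i\<in>J. X i \<omega> \<in> A i}" using J(2) by auto
    moreover have "X j -` A j \<inter> space M = {\<omega>\<in>space M. X j \<omega> \<in> A j}" for j by auto
    ultimately show "prob (\<Inter>j\<in>J. X j -` A j \<inter> space M) = (\<Prod>j\<in>J. prob (X j -` A j \<inter> space M))"
      using eq[OF Pi_mem[OF A]] by simp
  qed
qed (use X in \<open>auto simp: sets.sigma_sets_eq[of borel, simplified] sets.Int_stable\<close>)

text \<open>Used to pass from the sample space to the law of the process, on which the limit process
  is the identity map.\<close>

lemma (in prob_space) indep_vars_distrI:
  assumes f: "f \<in> M \<rightarrow>\<^sub>M N" and X: "\<And>i. i \<in> I \<Longrightarrow> X i \<in> N \<rightarrow>\<^sub>M M' i"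
    and ind: "indep_vars M' (\<lambda>i. X i \<circ> f) I" and I: "I \<noteq> {}"
  shows "prob_space.indep_vars (distr M N f) M' X I"
proof -
  interpret N: prob_space "distr M N f" by (rule prob_space_distr) fact
  have m: "(\<lambda>x. \<lambda>i\<in>I. X i x) \<in> N \<rightarrow>\<^sub>M PiM I M'" using X by (intro measurable_restrict)
  have Xf: "X i \<circ> f \<in> M \<rightarrow>\<^sub>M M' i" if "i \<in> I" for i using measurable_comp[OF f X[OF that]] .
  have "distr (distr M N f) (PiM I M') (\<lambda>x. \<lambda>i\<in>I. X i x) = distr M (PiM I M') (\<lambda>x. \<lambda>i\<in>I. (X i \<circ> f) x)"
    using f m by (subst distr_distr) (auto simp: comp_def)
  also have "\<dots> = PiM I (\<lambda>i. distr M (M' i) (X i \<circ> f))"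
    using ind indep_vars_iff_distr_eq_PiM'[OF I Xf] by simp
  also have "\<dots> = PiM I (\<lambda>i. distr (distr M N f) (M' i) (X i))"
    using f X by (intro PiM_cong refl) (simp add: distr_distr)
  finally show ?thesis
    using X by (subst N.indep_vars_iff_distr_eq_PiM'[OF I]) auto
qed

definition mixed_process :: "'e::topological_space set \<Rightarrow> nat \<times> (nat \<Rightarrow> 'e) \<Rightarrow> 'e measure" where
  "mixed_process E x = point_sum E {..<fst x} (snd x)"

text \<open>The law is defined on the largest sigma-algebra making the process measurable, so that the
  evaluations on arbitrary Borel sets need not be shown to be vaguely Borel.\<close>

definition mixed_law :: "'e::topological_space set \<Rightarrow> real \<Rightarrow> 'e measure \<Rightarrow> 'e measure measure" where
  "mixed_law E lam V = distr (mixed_space lam V)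
     (sigma (point_measures E) {S. S \<subseteq> point_measures E \<and>
        mixed_process E -` S \<inter> space (mixed_space lam V) \<in> sets (mixed_space lam V)}) (mixed_process E)"

section \<open>The law of the sampled process is that of a Poisson process\<close>

context
  fixes E :: "'e::second_countable_topology set" and V :: "'e measure" and lam :: real
  assumes V: "prob_space V" and setsV: "sets V = sets (restrict_space borel E)" and lam: "0 < lam"
begin

lemma space_mixed: "x \<in> space (mixed_space lam V) \<Longrightarrow> snd x i \<in> E"
proof -
  have "space V = E" using sets_eq_imp_space_eq[OF setsV] by (simp add: space_restrict_space)
  then show "x \<in> space (mixed_space lam V) \<Longrightarrow> snd x i \<in> E"
    by (auto simp: mixed_space_def space_pair_measure space_PiM PiE_def Pi_iff)
qed

lemma mixed_process_measurable:
  "mixed_process E \<in> mixed_space lam V \<rightarrow>\<^sub>M sigma (point_measures E) {S. S \<subseteq> point_measures E \<and>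
        mixed_process E -` S \<inter> space (mixed_space lam V) \<in> sets (mixed_space lam V)}"
proof (rule measurable_measure_of)
  show "mixed_process E \<in> space (mixed_space lam V) \<rightarrow> point_measures E"
    by (auto simp: mixed_process_def Pi_iff intro!: point_sum_in_point_measures space_mixed)
qed auto

lemma space_mixed_law: "space (mixed_law E lam V) = point_measures E"
  by (auto simp: mixed_law_def space_measure_of_conv)

lemma sets_mixed_lawI:
  assumes "S \<subseteq> point_measures E" "mixed_process E -` S \<inter> space (mixed_space lam V) \<in> sets (mixed_space lam V)"
  shows "S \<in> sets (mixed_law E lam V)"
  using assms unfolding mixed_law_def sets_distr by (intro in_measure_of) auto

lemma prob_mixed_law: "prob_space (mixed_law E lam V)"
proof -
  interpret prob_space "mixed_space lam V" by (rule prob_mixed_space[OF V])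
  show ?thesis unfolding mixed_law_def by (rule prob_space_distr[OF mixed_process_measurable])
qed

lemma vague_open_mixed_law:
  assumes U: "openin (vague_topology E) U"
  shows "U \<in> sets (mixed_law E lam V)"
proof (rule sets_mixed_lawI)
  show "U \<subseteq> point_measures E" using openin_subset[OF U] by (simp add: topspace_vague)
  have "Measurable.pred (mixed_space lam V) (\<lambda>x. mixed_process E x \<in> U)"
    unfolding mixed_process_def
    by (rule measurable_mixed_space)
      (simp add: pred_def point_sum_vague_measurable[OF _ setsV U])
  then show "mixed_process E -` U \<inter> space (mixed_space lam V) \<in> sets (mixed_space lam V)"
    by (simp add: pred_def vimage_def Int_def conj_commute)
qed

lemma continuous_measurable_mixed_law:
  assumes h: "continuous_map (vague_topology E) euclideanreal h"
  shows "h \<in> borel_measurable (mixed_law E lam V)"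
proof (rule borel_measurableI)
  fix S :: "real set" assume "open S"
  then have "openin (vague_topology E) {x \<in> topspace (vague_topology E). h x \<in> S}"
    using h by (auto simp: continuous_map_def)
  moreover have "{x \<in> topspace (vague_topology E). h x \<in> S} = h -` S \<inter> space (mixed_law E lam V)"
    by (auto simp: topspace_vague space_mixed_law)
  ultimately show "h -` S \<inter> space (mixed_law E lam V) \<in> sets (mixed_law E lam V)"
    using vague_open_mixed_law by metis
qed

lemma integral_mixed_law:
  assumes h: "continuous_map (vague_topology E) euclideanreal h" and c: "\<And>\<nu>. \<nu> \<in> point_measures E \<Longrightarrow> \<bar>h \<nu>\<bar> \<le> c"
  shows "(LINT \<nu>|mixed_law E lam V. h \<nu>) =
      (LINT k|measure_pmf (poisson_pmf lam). LINT v|PiM UNIV (\<lambda>_. V). h (point_sum E {..<k} v))"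
proof -
  have hm: "h \<in> borel_measurable (sigma (point_measures E) {S. S \<subseteq> point_measures E \<and>
        mixed_process E -` S \<inter> space (mixed_space lam V) \<in> sets (mixed_space lam V)})"
    using continuous_measurable_mixed_law[OF h] by (simp add: mixed_law_def)
  have "point_sum E {} undefined \<in> point_measures E" by (rule point_sum_in_point_measures) auto
  from c[OF this] have c0: "0 \<le> c" by linarith
  \<comment> \<open>\<open>h\<close> is bounded on \<open>point_measures E\<close> only, whereas
    \<open>integral_mixed_space\<close> asks for a bound everywhere; truncating at \<open>c\<close>
    changes nothing on the space.\<close>
  define h' where "h' x = max (- c) (min c (h (mixed_process E x)))" for x
  have hc: "h' x = h (mixed_process E x)" if "x \<in> space (mixed_space lam V)" for x
    using c[of "mixed_process E x"] that measurable_space[OF mixed_process_measurable that]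
    by (auto simp: h'_def space_measure_of_conv abs_le_iff)
  have "(LINT \<nu>|mixed_law E lam V. h \<nu>) = (LINT x|mixed_space lam V. h (mixed_process E x))"
    unfolding mixed_law_def by (rule integral_distr[OF mixed_process_measurable hm])
  also have "\<dots> = (LINT x|mixed_space lam V. h' x)"
    by (intro Bochner_Integration.integral_cong) (auto simp: hc)
  also have "\<dots> = (LINT k|measure_pmf (poisson_pmf lam). LINT v|PiM UNIV (\<lambda>_. V). h' (k, v))"
  proof (rule integral_mixed_space[OF V])
    show "h' \<in> borel_measurable (mixed_space lam V)"
      unfolding h'_def[abs_def] by (intro borel_measurable_max borel_measurable_min borel_measurable_const measurable_compose[OF mixed_process_measurable hm])
    show "norm (h' x) \<le> c" for x using c0 by (auto simp: h'_def)
  qed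
  also have "\<dots> = (LINT k|measure_pmf (poisson_pmf lam). LINT v|PiM UNIV (\<lambda>_. V). h (point_sum E {..<k} v))"
    by (intro Bochner_Integration.integral_cong refl)
      (auto simp: hc mixed_space_def space_pair_measure mixed_process_def)
  finally show ?thesis .
qed

lemma emeasure_mixed_process:
  assumes "x \<in> space (mixed_space lam V)" "B \<in> sets V"
  shows "emeasure (mixed_process E x) B = ennreal (hits B x)"
proof -
  have "hits B x = real (card {l\<in>{..<fst x}. snd x l \<in> B})"
    by (simp add: hits_def indicator_def sum.If_cases Int_def of_bool_def)
  moreover have "emeasure (mixed_process E x) B = of_nat (card {l\<in>{..<fst x}. snd x l \<in> B})"
    unfolding mixed_process_def using assms setsV by (intro emeasure_point_sum) (auto intro: space_mixed)
  ultimately show ?thesis by (simp add: ennreal_of_nat_eq_real_of_nat)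
qed

lemma evaluation_measurable:
  assumes B: "B \<in> sets V"
  shows "(\<lambda>\<nu>. emeasure \<nu> B) \<in> borel_measurable (mixed_law E lam V)"
proof (rule measurableI)
  fix A :: "ennreal set" assume A: "A \<in> sets borel"
  show "(\<lambda>\<nu>. emeasure \<nu> B) -` A \<inter> space (mixed_law E lam V) \<in> sets (mixed_law E lam V)"
  proof (rule sets_mixed_lawI)
    have "mixed_process E -` ((\<lambda>\<nu>. emeasure \<nu> B) -` A \<inter> space (mixed_law E lam V)) \<inter> space (mixed_space lam V) =
      (\<lambda>x. ennreal (hits B x)) -` A \<inter> space (mixed_space lam V)"
      using measurable_space[OF mixed_process_measurable] B
      by (auto simp: space_mixed_law emeasure_mixed_process space_measure_of_conv)
    then show "mixed_process E -` ((\<lambda>\<nu>. emeasure \<nu> B) -` A \<inter> space (mixed_law E lam V)) \<inter> space (mixed_space lam V) \<in> sets (mixed_space lam V)"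
      using measurable_sets[OF measurable_compose[OF hits_measurable[OF B] measurable_ennreal] A] by simp
  qed (simp add: space_mixed_law)
qed simp

text \<open>For the identity process both defining properties concern evaluations under the law;
  pulled back to the sample space they become the statements about \<open>hits\<close>.\<close>

lemma poisson_process_mixed_law:
  assumes \<mu>: "\<And>B. B \<in> sets (restrict_space borel E) \<Longrightarrow> measure \<mu> B = lam * measure V B"
  shows "poisson_process (mixed_law E lam V) E \<mu> (\<lambda>\<nu>. \<nu>)"
  unfolding poisson_process_def
proof (intro conjI ballI allI impI)
  interpret P: prob_space "mixed_space lam V" by (rule prob_mixed_space[OF V])
  interpret Q: prob_space "mixed_law E lam V" by (rule prob_mixed_law)
  show "(\<lambda>\<nu>. \<nu>) \<in> mixed_law E lam V \<rightarrow>\<^sub>M borel_algebra_of (vague_topology E)"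
    unfolding borel_algebra_of_def
  proof (rule measurable_measure_of)
    fix U assume "U \<in> {U. openin (vague_topology E) U}"
    then have U: "openin (vague_topology E) U" by simp
    have "(\<lambda>\<nu>. \<nu>) -` U \<inter> space (mixed_law E lam V) = U"
      using openin_subset[OF U] by (auto simp: topspace_vague space_mixed_law)
    then show "(\<lambda>\<nu>. \<nu>) -` U \<inter> space (mixed_law E lam V) \<in> sets (mixed_law E lam V)"
      using vague_open_mixed_law[OF U] by simp
  qed (auto simp: topspace_vague space_mixed_law dest: subsetD[OF openin_subset])
  \<comment> \<open>A pushforward carries the sigma-algebra of its target, so the law may serve as
    its own target. In this form \<open>measure_distr\<close> and \<open>indep_vars_distrI\<close>
    apply to evaluations.\<close>
  have distr_eq: "mixed_law E lam V = distr (mixed_space lam V) (mixed_law E lam V) (mixed_process E)"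
    unfolding mixed_law_def by (rule distr_cong) auto
  have mp: "mixed_process E \<in> mixed_space lam V \<rightarrow>\<^sub>M mixed_law E lam V"
    using mixed_process_measurable by (simp add: mixed_law_def)
  {
    fix B and k :: nat assume B: "B \<in> sets (restrict_space borel E)"
    then have B': "B \<in> sets V" using setsV by simp
    have "{\<nu>\<in>space (mixed_law E lam V). emeasure \<nu> B = of_nat k} \<in> sets (mixed_law E lam V)"
      using evaluation_measurable[OF B'] by measurable
    then have "measure (mixed_law E lam V) {\<nu>\<in>space (mixed_law E lam V). emeasure \<nu> B = of_nat k} =
      measure (mixed_space lam V) (mixed_process E -` {\<nu>\<in>space (mixed_law E lam V). emeasure \<nu> B = of_nat k} \<inter> space (mixed_space lam V))"
      by (subst distr_eq, subst measure_distr[OF mp]) (auto simp: distr_eq[symmetric])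
    also have "mixed_process E -` {\<nu>\<in>space (mixed_law E lam V). emeasure \<nu> B = of_nat k} \<inter> space (mixed_space lam V) =
      {x\<in>space (mixed_space lam V). hits B x = real k}"
    proof -
      have "ennreal (hits B x) = of_nat k \<longleftrightarrow> hits B x = real k" for x
        by (auto simp: ennreal_of_nat_eq_real_of_nat hits_def sum_nonneg)
      then show ?thesis
        using measurable_space[OF mp] by (auto simp: emeasure_mixed_process[OF _ B'] ennreal_of_nat_eq_real_of_nat)
    qed
    finally show "measure (mixed_law E lam V) {\<nu>\<in>space (mixed_law E lam V). emeasure \<nu> B = of_nat k} =
      exp (- measure \<mu> B) * measure \<mu> B ^ k / fact k"
      using hits_poisson[OF V lam B'] \<mu>[OF B] by simp
  }
  fix n :: nat and B assume B: "(\<forall>i<n. B i \<in> sets (restrict_space borel E)) \<and> disjoint_family_on B {..<n}"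
  then have B': "B i \<in> sets V" if "i < n" for i using setsV that by simp
  show "Q.indep_vars (\<lambda>_. borel) (\<lambda>i \<nu>. emeasure \<nu> (B i)) {..<n}"
  proof (cases "n = 0")
    case True
    then show ?thesis by (simp add: Q.indep_vars_def Q.indep_sets_def)
  next
    case False
    have m: "(\<lambda>\<nu>. emeasure \<nu> (B i)) \<circ> mixed_process E \<in> borel_measurable (mixed_space lam V)" if "i < n" for i
      using measurable_comp[OF mp evaluation_measurable[OF B'[OF that]]] .
    have "P.indep_vars (\<lambda>_. borel) (\<lambda>i. (\<lambda>\<nu>. emeasure \<nu> (B i)) \<circ> mixed_process E) {..<n}"
    proof (rule P.indep_varsI_rectangle)
      fix D :: "nat \<Rightarrow> ennreal set" assume D: "\<And>i. i \<in> {..<n} \<Longrightarrow> D i \<in> sets borel"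
      have D': "ennreal -` D i \<in> sets borel" if "i < n" for i
        using measurable_sets[OF measurable_ennreal D] that by simp
      have "P.prob {x\<in>space (mixed_space lam V). \<forall>i\<in>{..<n}. hits (B i) x \<in> ennreal -` D i} =
        (\<Prod>i\<in>{..<n}. P.prob {x\<in>space (mixed_space lam V). hits (B i) x \<in> ennreal -` D i})"
        using B B' D' by (intro hits_rectangle[OF V lam]) auto
      moreover have "{x\<in>space (mixed_space lam V). \<forall>i\<in>{..<n}. hits (B i) x \<in> ennreal -` D i} =
        {x\<in>space (mixed_space lam V). \<forall>i\<in>{..<n}. ((\<lambda>\<nu>. emeasure \<nu> (B i)) \<circ> mixed_process E) x \<in> D i}"
        using emeasure_mixed_process[OF _ B'] by auto
      moreover have "{x\<in>space (mixed_space lam V). hits (B i) x \<in> ennreal -` D i} =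
        {x\<in>space (mixed_space lam V). ((\<lambda>\<nu>. emeasure \<nu> (B i)) \<circ> mixed_process E) x \<in> D i}" if "i < n" for i
        using emeasure_mixed_process[OF _ B'[OF that]] by auto
      ultimately show "P.prob {x\<in>space (mixed_space lam V). \<forall>i\<in>{..<n}. ((\<lambda>\<nu>. emeasure \<nu> (B i)) \<circ> mixed_process E) x \<in> D i} =
        (\<Prod>i\<in>{..<n}. P.prob {x\<in>space (mixed_space lam V). ((\<lambda>\<nu>. emeasure \<nu> (B i)) \<circ> mixed_process E) x \<in> D i})"
        by simp
    qed (use False m in auto)
    from P.indep_vars_distrI[OF mp _ this] False evaluation_measurable[OF B']
    have "prob_space.indep_vars (distr (mixed_space lam V) (mixed_law E lam V) (mixed_process E)) (\<lambda>_. borel) (\<lambda>i \<nu>. emeasure \<nu> (B i)) {..<n}"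
      by auto
    then show ?thesis by (simp add: distr_eq[symmetric])
  qed
qed

end

section \<open>Moebius expansion of set functions\<close>

definition moebius :: "('a set \<Rightarrow> real) \<Rightarrow> 'a set \<Rightarrow> real" where
  "moebius \<phi> J = (\<Sum>I\<in>Pow J. (- 1) ^ (card J - card I) * \<phi> I)"

lemma sum_Pow_insert:
  assumes "finite R" "a \<notin> R"
  shows "(\<Sum>J\<in>Pow (insert a R). g J) = (\<Sum>J\<in>Pow R. g J) + (\<Sum>J\<in>Pow R. g (insert a J) :: real)"
proof -
  have "inj_on (insert a) (Pow R)" using assms(2) by (auto simp: inj_on_def)
  then show ?thesis
    unfolding Pow_insert using assms by (subst sum.union_disjoint) (auto simp: sum.reindex)
qed

text \<open>\<open>moebius \<phi> J\<close> is the iterated finite difference of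
  \<open>\<phi>\<close> at the empty set in the directions of \<open>J\<close>; adding
  \<open>a\<close> takes one more difference.\<close>

lemma moebius_insert:
  assumes J: "finite J" "a \<notin> J"
  shows "moebius \<phi> (insert a J) = moebius (\<lambda>I. \<phi> (insert a I)) J - moebius \<phi> J"
proof -
  have "(\<Sum>I\<in>Pow J. (- 1) ^ (card (insert a J) - card I) * \<phi> I) = - (\<Sum>I\<in>Pow J. (- 1) ^ (card J - card I) * \<phi> I)"
    unfolding sum_negf[symmetric]
  proof (intro sum.cong refl)
    fix I assume "I \<in> Pow J"
    then have "card I \<le> card J" using J by (auto intro: card_mono)
    then show "(- 1) ^ (card (insert a J) - card I) * \<phi> I = - ((- 1) ^ (card J - card I) * \<phi> I)"
      using J by (simp add: Suc_diff_le)
  qed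
  moreover have "(\<Sum>I\<in>Pow J. (- 1) ^ (card (insert a J) - card (insert a I)) * \<phi> (insert a I)) =
      (\<Sum>I\<in>Pow J. (- 1) ^ (card J - card I) * \<phi> (insert a I))"
  proof (intro sum.cong refl)
    fix I assume I: "I \<in> Pow J"
    then have "finite I" "a \<notin> I" using J finite_subset by auto
    then show "(- 1) ^ (card (insert a J) - card (insert a I)) * \<phi> (insert a I) = (- 1) ^ (card J - card I) * \<phi> (insert a I)"
      using J by simp
  qed
  ultimately show ?thesis unfolding moebius_def sum_Pow_insert[OF J] by simp
qed

text \<open>By \<open>moebius_insert\<close> the subsets containing \<open>a\<close> contribute a
  difference, whose negative part cancels the subsets avoiding \<open>a\<close>.\<close>

lemma moebius_inversion:
  assumes "finite R"
  shows "(\<Sum>J\<in>Pow R. moebius \<phi> J) = \<phi> R"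
  using assms
proof (induction R arbitrary: \<phi> rule: finite_induct)
  case empty then show ?case by (simp add: moebius_def)
next
  case (insert a R)
  have "(\<Sum>J\<in>Pow R. moebius \<phi> (insert a J)) = (\<Sum>J\<in>Pow R. moebius (\<lambda>I. \<phi> (insert a I)) J - moebius \<phi> J)"
    using insert by (intro sum.cong refl moebius_insert) (auto intro: finite_subset)
  then show ?case
    using insert.IH[of \<phi>] insert.IH[of "\<lambda>I. \<phi> (insert a I)"] insert.hyps by (simp add: sum_Pow_insert sum_subtractf)
qed

lemma moebius_bound:
  assumes "finite J" "\<And>I. I \<subseteq> J \<Longrightarrow> \<bar>\<phi> I\<bar> \<le> c"
  shows "\<bar>moebius \<phi> J\<bar> \<le> 2 ^ card J * c"
proof -
  have "\<bar>moebius \<phi> J\<bar> \<le> (\<Sum>I\<in>Pow J. \<bar>(- 1) ^ (card J - card I) * \<phi> I\<bar>)"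
    unfolding moebius_def by (rule sum_abs)
  also have "\<dots> \<le> (\<Sum>I\<in>Pow J. c)" using assms by (intro sum_mono) (auto simp: abs_mult power_abs)
  finally show ?thesis using assms by (simp add: card_Pow)
qed

text \<open>Every \<open>j\<close>-subset of a \<open>K\<close>-set extends to an
  \<open>m\<close>-subset, and each \<open>m\<close>-subset contains \<open>m choose j\<close> of
  them. In the truncation this charges every term of lower order to the single count
  \<open>card R choose Suc m\<close>.\<close>

lemma binomial_le_mult:
  assumes "j \<le> m" "m \<le> K"
  shows "K choose j \<le> (m choose j) * (K choose m)"
proof -
  have "(K choose j) * 1 \<le> (K choose j) * ((K - j) choose (m - j))"
    using assms by (intro mult_le_mono2) (simp add: Suc_le_eq)
  also have "\<dots> = (K choose m) * (m choose j)" using assms by (simp add: choose_mult)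
  finally show ?thesis by (simp add: mult.commute)
qed

text \<open>When \<open>R\<close> is the set of exceedances, \<open>card R choose Suc m\<close> has expectation of order \<open>C ^ m / fact m\<close>, so the
  truncation error tends to zero uniformly in the sample size.\<close>

lemma moebius_truncation:
  assumes R: "finite R" and \<phi>: "\<And>I. I \<subseteq> R \<Longrightarrow> \<bar>\<phi> I\<bar> \<le> c"
  shows "\<bar>\<phi> R - (\<Sum>j\<le>m. \<Sum>J | J \<subseteq> R \<and> card J = j. moebius \<phi> J)\<bar> \<le> c * (1 + 3 ^ Suc m) * real (card R choose Suc m)"
proof (cases "card R \<le> m")
  case True
  have "(\<Sum>j\<le>m. \<Sum>J | J \<subseteq> R \<and> card J = j. moebius \<phi> J) = (\<Sum>j\<in>{..m}. \<Sum>J | J \<in> Pow R \<and> card J = j. moebius \<phi> J)"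
    by simp
  also have "\<dots> = (\<Sum>J\<in>Pow R. moebius \<phi> J)"
    using R True card_mono[OF R] by (intro sum.group) (auto intro: order_trans)
  finally have "\<phi> R - (\<Sum>j\<le>m. \<Sum>J | J \<subseteq> R \<and> card J = j. moebius \<phi> J) = 0"
    using moebius_inversion[OF R] by simp
  moreover have "0 \<le> c" using \<phi>[of R] by simp
  ultimately show ?thesis by simp
next
  case False
  \<comment> \<open>With more than \<open>m\<close> points the terms are estimated separately; the
    binomial coefficient is now at least 1, so it absorbs \<open>\<phi> R\<close> as well.\<close>
  then have m: "Suc m \<le> card R" by simp
  have c: "0 \<le> c" using \<phi>[of R] by simp
  have "\<bar>\<Sum>J | J \<subseteq> R \<and> card J = j. moebius \<phi> J\<bar> \<le> c * (real (Suc m choose j) * 2 ^ j) * real (card R choose Suc m)" if "j \<le> m" for j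
  proof -
    have "\<bar>\<Sum>J | J \<subseteq> R \<and> card J = j. moebius \<phi> J\<bar> \<le> (\<Sum>J | J \<subseteq> R \<and> card J = j. 2 ^ j * c)"
    proof (rule order_trans[OF sum_abs sum_mono])
      fix J assume "J \<in> {J. J \<subseteq> R \<and> card J = j}"
      then show "\<bar>moebius \<phi> J\<bar> \<le> 2 ^ j * c"
        using moebius_bound[of J \<phi> c] \<phi> R by (auto intro: finite_subset)
    qed
    also have "\<dots> = real (card R choose j) * (2 ^ j * c)" using n_subsets[OF R, of j] by simp
    also have "\<dots> \<le> real ((Suc m choose j) * (card R choose Suc m)) * (2 ^ j * c)"
      using binomial_le_mult[of j "Suc m" "card R"] that m c by (intro mult_right_mono) (auto simp del: of_nat_mult)
    finally show ?thesis by (simp add: mult_ac)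
  qed
  then have "\<bar>\<Sum>j\<le>m. \<Sum>J | J \<subseteq> R \<and> card J = j. moebius \<phi> J\<bar> \<le> (\<Sum>j\<le>m. c * (real (Suc m choose j) * 2 ^ j) * real (card R choose Suc m))"
    by (intro order_trans[OF sum_abs sum_mono]) auto
  also have "\<dots> = c * (\<Sum>j\<le>m. real (Suc m choose j) * 2 ^ j) * real (card R choose Suc m)"
    by (simp add: sum_distrib_left sum_distrib_right)
  also have "\<dots> \<le> c * 3 ^ Suc m * real (card R choose Suc m)"
  proof (intro mult_right_mono mult_left_mono c)
    have "(\<Sum>j\<le>m. real (Suc m choose j) * 2 ^ j) \<le> (\<Sum>j\<le>Suc m. real (Suc m choose j) * 2 ^ j)" by simp
    also have "\<dots> = (2 + 1) ^ Suc m" by (subst binomial_ring) (simp add: mult_ac)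
    finally show "(\<Sum>j\<le>m. real (Suc m choose j) * 2 ^ j) \<le> 3 ^ Suc m" by simp
  qed simp
  finally have 1: "\<bar>\<Sum>j\<le>m. \<Sum>J | J \<subseteq> R \<and> card J = j. moebius \<phi> J\<bar> \<le> c * 3 ^ Suc m * real (card R choose Suc m)" .
  have "1 \<le> card R choose Suc m" using m by (simp add: Suc_le_eq)
  then have "c * 1 \<le> c * real (card R choose Suc m)" using c by (intro mult_left_mono) auto
  then have "\<bar>\<phi> R\<bar> \<le> c * real (card R choose Suc m)" using \<phi>[of R] by simp
  with 1 show ?thesis by (simp add: algebra_simps)
qed

definition injections :: "nat \<Rightarrow> 'a set \<Rightarrow> (nat \<Rightarrow> 'a) set" where
  "injections j I = {f \<in> {..<j} \<rightarrow>\<^sub>E I. inj_on f {..<j}}"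

lemma card_bijections:
  assumes J: "finite J" "card J = j"
  shows "card {f \<in> {..<j} \<rightarrow>\<^sub>E J. inj_on f {..<j}} = fact j"
proof -
  have "card {f \<in> {..<j} \<rightarrow>\<^sub>E J. inj_on f {..<j}} = prod ((-) (card J)) {0..<card {..<j}}"
    using card_inj_on_subset_funcset[of "{..<j}" J "{..<j}"] J by simp
  also have "\<dots> = (\<Prod>i = 0..<j. j - i)" using J by simp
  finally show ?thesis by (simp add: fact_prod_rev)
qed

text \<open>A \<open>j\<close>-subset is the range of exactly \<open>fact j\<close> injections.
  Ordered tuples are preferred because the limiting weights are products over positions.\<close>

lemma sum_subsets_eq_sum_injections:
  fixes G :: "'a set \<Rightarrow> real"
  assumes I: "finite I"
  shows "fact j * (\<Sum>J | J \<subseteq> I \<and> card J = j. G J) = (\<Sum>f\<in>injections j I. G (f ` {..<j}))"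
proof -
  let ?T = "{J. J \<subseteq> I \<and> card J = j}"
  have fin: "finite (injections j I)" unfolding injections_def
    by (rule finite_subset[of _ "{..<j} \<rightarrow>\<^sub>E I"]) (use I in \<open>auto intro: finite_PiE\<close>)
  have im: "(\<lambda>f. f ` {..<j}) ` injections j I \<subseteq> ?T"
  proof (rule image_subsetI)
    fix f assume "f \<in> injections j I"
    then have f: "f \<in> {..<j} \<rightarrow> I" "inj_on f {..<j}" by (simp_all add: injections_def PiE_def)
    then show "f ` {..<j} \<in> ?T" using card_image[OF f(2)] by (simp add: image_subset_iff_funcset)
  qed
  have "(\<Sum>f\<in>injections j I. G (f ` {..<j})) = (\<Sum>J\<in>?T. \<Sum>f | f \<in> injections j I \<and> f ` {..<j} = J. G (f ` {..<j}))"
    using I fin im by (intro sum.group[symmetric]) auto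
  also have "\<dots> = (\<Sum>J\<in>?T. fact j * G J)"
  proof (intro sum.cong refl)
    fix J assume J: "J \<in> ?T"
    then have fJ: "finite J" using I finite_subset by auto
    have "{f. f \<in> injections j I \<and> f ` {..<j} = J} = {f \<in> {..<j} \<rightarrow>\<^sub>E J. inj_on f {..<j}}"
    proof (intro set_eqI iffI)
      fix f assume "f \<in> {f \<in> {..<j} \<rightarrow>\<^sub>E J. inj_on f {..<j}}"
      then have f: "f \<in> {..<j} \<rightarrow> J" "f \<in> extensional {..<j}" "inj_on f {..<j}" by (simp_all add: PiE_def)
      have "f \<in> {..<j} \<rightarrow> I" using f(1) J by blast
      then have "f \<in> injections j I" using f by (simp add: injections_def PiE_def)
      moreover have "f ` {..<j} = J"
        using f J card_image[OF f(3)] by (intro card_subset_eq[OF fJ]) auto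
      ultimately show "f \<in> {f. f \<in> injections j I \<and> f ` {..<j} = J}" by simp
    next
      fix f assume "f \<in> {f. f \<in> injections j I \<and> f ` {..<j} = J}"
      then show "f \<in> {f \<in> {..<j} \<rightarrow>\<^sub>E J. inj_on f {..<j}}"
        by (auto simp only: injections_def PiE_def mem_Collect_eq Int_iff)
    qed
    then have "card {f. f \<in> injections j I \<and> f ` {..<j} = J} = fact j"
      using card_bijections[OF fJ, of j] J by simp
    then show "(\<Sum>f | f \<in> injections j I \<and> f ` {..<j} = J. G (f ` {..<j})) = fact j * G J"
      by (subst sum.cong[OF refl, of _ _ "\<lambda>_. G J"]) auto
  qed
  finally show ?thesis by (simp add: sum_distrib_left)
qed

section \<open>Discretization of the bivariate space\<close>

definition marked_indices :: "nat \<Rightarrow> (nat \<times> nat) set" where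
  "marked_indices n = {1..n} \<times> {1, 2}"

definition rescale :: "nat \<Rightarrow> nat \<times> nat \<Rightarrow> real \<times> nat" where
  "rescale n p = (real (fst p) / real n, snd p)"

text \<open>Rounding up makes the cell of \<open>i\<close> the interval
  \<open>{(i - 1) / n <.. i / n}\<close>, so that the cells of \<open>1, ..., n\<close> exactly fill
  an interval open at 0 and closed at 1.\<close>

definition discretize :: "nat \<Rightarrow> real \<times> nat \<Rightarrow> nat \<times> nat" where
  "discretize n y = (nat \<lceil>real n * fst y\<rceil>, snd y)"

lemma finite_marked_indices[simp]: "finite (marked_indices n)"
  by (simp add: marked_indices_def)

lemma sum_prod_marked_weights:
  fixes w :: "nat \<Rightarrow> real"
  assumes "n > 0"
  shows "(\<Sum>f\<in>{..<j} \<rightarrow>\<^sub>E marked_indices n. \<Prod>i<j. w (snd (f i)) / real n) = (w 1 + w 2) ^ j"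
proof -
  have "(\<Sum>p\<in>marked_indices n. w (snd p) / real n) = (\<Sum>i\<in>{1..n}. \<Sum>d\<in>{1, 2}. w d / real n)"
    unfolding marked_indices_def by (simp only: sum.cartesian_product split_def)
  also have "\<dots> = w 1 + w 2"
    using assms by (simp add: field_simps)
  finally have "(\<Prod>i<j. \<Sum>p\<in>marked_indices n. w (snd p) / real n) = (w 1 + w 2) ^ j" by simp
  then show ?thesis by (subst (asm) prod_sum_PiE) auto
qed

lemma rescale_in_space: "p \<in> marked_indices n \<Longrightarrow> rescale n p \<in> bivariate_space"
  by (auto simp: marked_indices_def rescale_def bivariate_space_def)

lemma discretize_in_indices:
  assumes "y \<in> bivariate_space" "n \<ge> 1"
  shows "discretize n y \<in> marked_indices n"
proof -
  have t: "0 < fst y" "fst y \<le> 1" "snd y \<in> {1, 2}" using assms(1) by (auto simp: bivariate_space_def)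
  have "0 < real n * fst y" using t assms(2) by simp
  then have "1 \<le> \<lceil>real n * fst y\<rceil>" by (simp add: one_le_ceiling)
  moreover have "real n * fst y \<le> real n" using t assms(2) by (simp add: mult_left_le)
  then have "\<lceil>real n * fst y\<rceil> \<le> int n" by (simp add: ceiling_le_iff)
  ultimately have "1 \<le> nat \<lceil>real n * fst y\<rceil>" "nat \<lceil>real n * fst y\<rceil> \<le> n" by linarith+
  then show ?thesis using t by (auto simp: discretize_def marked_indices_def)
qed

lemma rescale_discretize_tendsto:
  assumes "y \<in> bivariate_space"
  shows "(\<lambda>n. rescale n (discretize n y)) \<longlonglongrightarrow> y"
proof -
  have t: "0 < fst y" using assms by (auto simp: bivariate_space_def)
  have "(\<lambda>n. real (nat \<lceil>real n * fst y\<rceil>) / real n) \<longlonglongrightarrow> fst y"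
  proof (rule real_tendsto_sandwich)
    show "\<forall>\<^sub>F n in sequentially. fst y \<le> real (nat \<lceil>real n * fst y\<rceil>) / real n"
      using eventually_gt_at_top[of 0]
    proof eventually_elim
      case (elim n)
      have "real n * fst y \<le> real (nat \<lceil>real n * fst y\<rceil>)" by linarith
      then show ?case using elim by (simp add: field_simps)
    qed
    show "\<forall>\<^sub>F n in sequentially. real (nat \<lceil>real n * fst y\<rceil>) / real n \<le> fst y + 1 / real n"
      using eventually_gt_at_top[of 0]
    proof eventually_elim
      case (elim n)
      have "0 \<le> real n * fst y" using t by simp
      then have "real (nat \<lceil>real n * fst y\<rceil>) \<le> real n * fst y + 1" by linarith
      then show ?case using elim by (simp add: field_simps)
    qed
    show "(\<lambda>n. fst y + 1 / real n) \<longlonglongrightarrow> fst y"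
      using tendsto_add[OF tendsto_const lim_const_over_n[of 1]] by simp
  qed simp
  then have "(\<lambda>n. (real (nat \<lceil>real n * fst y\<rceil>) / real n, snd y)) \<longlonglongrightarrow> (fst y, snd y)"
    by (intro tendsto_Pair tendsto_const)
  then show ?thesis by (simp add: rescale_def discretize_def)
qed

section \<open>Independent points distributed by the normalised intensity\<close>

definition intensity_mass :: "(nat \<Rightarrow> real) \<Rightarrow> real" where
  "intensity_mass x = exp (- x 1) + exp (- x 2)"

definition point_law :: "(nat \<Rightarrow> real) \<Rightarrow> (real \<times> nat) measure" where
  "point_law x = scale_measure (ennreal (1 / intensity_mass x)) (intensity x)"

lemma intensity_mass_pos: "0 < intensity_mass x"
  by (simp add: intensity_mass_def add_pos_pos)

lemma sets_intensity: "sets (intensity x) = sets (restrict_space borel bivariate_space)"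
  unfolding intensity_def
  using sets.sigma_sets_eq[of "restrict_space borel bivariate_space"]
    sets.space_closed[of "restrict_space borel bivariate_space"]
  by (simp add: space_bivariate)

lemma sets_point_law: "sets (point_law x) = sets (restrict_space borel bivariate_space)"
  by (simp add: point_law_def sets_intensity)

lemma space_point_law: "space (point_law x) = bivariate_space"
  using sets_eq_imp_space_eq[OF sets_point_law] by (simp add: space_bivariate)

lemma emeasure_point_law:
  assumes "B \<in> sets (restrict_space borel bivariate_space)"
  shows "emeasure (point_law x) B = ennreal (1 / intensity_mass x) *
    (ennreal (exp (- x 1)) * emeasure lborel {t. (t, 1) \<in> B} + ennreal (exp (- x 2)) * emeasure lborel {t. (t, 2) \<in> B})"
  unfolding point_law_def emeasure_scale_measure emeasure_intensity[OF assms] by simp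

lemma prob_point_law: "prob_space (point_law x)"
proof
  have "{t. (t, d) \<in> bivariate_space} = {0<..1::real}" if "d \<in> {1, 2}" for d :: nat
    using that by (auto simp: bivariate_space_def)
  then have "emeasure (point_law x) bivariate_space = ennreal (1 / intensity_mass x) * (ennreal (exp (- x 1)) + ennreal (exp (- x 2)))"
    using sets.top[of "restrict_space borel bivariate_space"]
    by (subst emeasure_point_law) (auto simp: space_bivariate)
  also have "\<dots> = ennreal (1 / intensity_mass x * (exp (- x 1) + exp (- x 2)))"
    using intensity_mass_pos[of x] by (simp add: ennreal_mult[symmetric] ennreal_plus[symmetric] del: ennreal_plus)
  also have "\<dots> = 1" using intensity_mass_pos[of x] by (simp add: intensity_mass_def)
  finally show "emeasure (point_law x) (space (point_law x)) = 1" by (simp add: space_point_law)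
qed

lemma measure_intensity:
  assumes B: "B \<in> sets (restrict_space borel bivariate_space)"
  shows "measure (intensity x) B = intensity_mass x * measure (point_law x) B"
proof -
  have "emeasure (point_law x) B = ennreal (1 / intensity_mass x) * emeasure (intensity x) B"
    by (simp add: point_law_def)
  then have "measure (point_law x) B = 1 / intensity_mass x * measure (intensity x) B"
    using intensity_mass_pos[of x] by (simp add: measure_def enn2real_mult)
  then show ?thesis using intensity_mass_pos[of x] by simp
qed

text \<open>All cells have length exactly \<open>1 / n\<close>, so a rounded random point has
  precisely the weights that occur in the tuple sums.\<close>

lemma discretize_cell:
  assumes n: "n \<ge> 1" and p: "p \<in> marked_indices n"
  shows "{y \<in> bivariate_space. discretize n y = p} \<in> sets (point_law x)"
    and "measure (point_law x) {y \<in> bivariate_space. discretize n y = p} = exp (- x (snd p)) / (real n * intensity_mass x)"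
proof -
  obtain i d where pd: "p = (i, d)" by (cases p)
  have i: "1 \<le> i" "i \<le> n" and d: "d \<in> {1, 2}" using p by (auto simp: pd marked_indices_def)
  let ?B = "{y \<in> bivariate_space. discretize n y = p}"
  let ?I = "{(real i - 1) / real n <.. real i / real n}"
  have I: "nat \<lceil>real n * t\<rceil> = i \<and> 0 < t \<and> t \<le> 1 \<longleftrightarrow> t \<in> ?I" for t
  proof
    assume *: "nat \<lceil>real n * t\<rceil> = i \<and> 0 < t \<and> t \<le> 1"
    then have "\<lceil>real n * t\<rceil> = int i" using i by auto
    then have "real i - 1 < real n * t" "real n * t \<le> real i" by linarith+
    then show "t \<in> ?I" using n by (simp add: field_simps)
  next
    assume *: "t \<in> ?I"
    then have 1: "real i - 1 < real n * t" "real n * t \<le> real i" using n by (simp_all add: field_simps)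
    then have "\<lceil>real n * t\<rceil> = int i" by linarith
    moreover have "0 \<le> (real i - 1) / real n" using i n by simp
    then have "0 < t" using * by simp
    moreover have "real i / real n \<le> 1" using i n by simp
    then have "t \<le> 1" using * by simp
    ultimately show "nat \<lceil>real n * t\<rceil> = i \<and> 0 < t \<and> t \<le> 1" by simp
  qed
  have B: "?B = ?I \<times> {d}"
  proof (rule set_eqI)
    fix y :: "real \<times> nat"
    obtain t e where y: "y = (t, e)" by (cases y)
    show "y \<in> ?B \<longleftrightarrow> y \<in> ?I \<times> {d}"
      using I[of t] d by (auto simp: y pd bivariate_space_def discretize_def)
  qed
  have "?I \<times> {d} \<in> sets borel" by (intro borel_Times) auto
  moreover have "?I \<times> {d} \<subseteq> bivariate_space" using B by auto
  ultimately have Bs: "?B \<in> sets (restrict_space borel bivariate_space)"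
    unfolding B by (auto simp: sets_restrict_space image_iff intro!: bexI[of _ "?I \<times> {d}"])
  then show "?B \<in> sets (point_law x)" by (simp add: sets_point_law)
  have sec: "{t. (t, e) \<in> ?B} = (if e = d then ?I else {})" for e
    unfolding B by auto
  have len: "emeasure lborel ?I = ennreal (1 / real n)"
  proof -
    have "(real i - 1) / real n \<le> real i / real n" using n by (simp add: divide_right_mono)
    moreover have "real i / real n - (real i - 1) / real n = 1 / real n" by (simp add: diff_divide_distrib)
    ultimately show ?thesis by simp
  qed
  have "emeasure (point_law x) ?B = ennreal (1 / intensity_mass x) * (ennreal (exp (- x d)) * ennreal (1 / real n))"
    unfolding emeasure_point_law[OF Bs] sec using d len by (auto simp del: emeasure_lborel_Ioc)
  also have "\<dots> = ennreal (exp (- x d) / (real n * intensity_mass x))"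
    using intensity_mass_pos[of x] by (simp add: ennreal_mult[symmetric] field_simps)
  finally show "measure (point_law x) ?B = exp (- x (snd p)) / (real n * intensity_mass x)"
    using intensity_mass_pos[of x] by (simp add: measure_def pd)
qed

lemma point_functional_measurable:
  assumes A: "finite A" and h: "continuous_map (vague_topology bivariate_space) euclideanreal h"
  shows "(\<lambda>v. h (point_sum bivariate_space A v)) \<in> borel_measurable (PiM (UNIV :: nat set) (\<lambda>_. point_law x))"
proof (rule borel_measurableI)
  fix S :: "real set" assume "open S"
  then have U: "openin (vague_topology bivariate_space) {\<nu> \<in> topspace (vague_topology bivariate_space). h \<nu> \<in> S}"
    using h by (auto simp: continuous_map_def)
  have "(\<lambda>v. h (point_sum bivariate_space A v)) -` S \<inter> space (PiM (UNIV :: nat set) (\<lambda>_. point_law x)) =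
    {v \<in> space (PiM UNIV (\<lambda>_. point_law x)). point_sum bivariate_space A v \<in> {\<nu> \<in> topspace (vague_topology bivariate_space). h \<nu> \<in> S}}"
    using A by (auto simp: topspace_vague space_PiM space_point_law intro!: point_sum_in_point_measures)
  then show "(\<lambda>v. h (point_sum bivariate_space A v)) -` S \<inter> space (PiM (UNIV :: nat set) (\<lambda>_. point_law x)) \<in> sets (PiM UNIV (\<lambda>_. point_law x))"
    using point_sum_vague_measurable[OF A sets_point_law U] by simp
qed

text \<open>The weighted tuple sum is, without any error, an expectation over an independent sample
  rounded to the grid. Convergence of Riemann sums thereby becomes dominated convergence on one
  fixed probability space.\<close>

lemma discretized_integral:
  fixes G :: "(nat \<Rightarrow> nat \<times> nat) \<Rightarrow> real" and x :: "nat \<Rightarrow> real"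
  assumes n: "n \<ge> 1"
  defines "W \<equiv> PiM (UNIV :: nat set) (\<lambda>_. point_law x)"
  shows "(\<lambda>v. G (restrict (discretize n \<circ> v) {..<j})) \<in> borel_measurable W"
    and "intensity_mass x ^ j * (LINT v|W. G (restrict (discretize n \<circ> v) {..<j})) =
      (\<Sum>f\<in>{..<j} \<rightarrow>\<^sub>E marked_indices n. (\<Prod>i<j. exp (- x (snd (f i))) / real n) * G f)"
proof -
  let ?r = "\<lambda>v. restrict (discretize n \<circ> v) {..<j}" and ?F = "{..<j} \<rightarrow>\<^sub>E marked_indices n"
  interpret V: prob_space "point_law x" by (rule prob_point_law)
  interpret W: product_prob_space "\<lambda>_ :: nat. point_law x" UNIV ..
  let ?A = "\<lambda>f. {v \<in> space W. \<forall>i\<in>{..<j}. v i \<in> {y \<in> bivariate_space. discretize n y = f i}}"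
  have fin: "finite ?F" by (auto intro: finite_PiE)
  have sp: "v i \<in> bivariate_space" if "v \<in> space W" for v and i :: nat
    using that by (auto simp: W_def space_PiM space_point_law)
  have A: "v \<in> ?A f \<longleftrightarrow> ?r v = f" if "v \<in> space W" "f \<in> ?F" for v f
  proof -
    have "?r v = f \<longleftrightarrow> (\<forall>i<j. discretize n (v i) = f i)"
      using that by (auto simp: fun_eq_iff PiE_def extensional_def restrict_def)
    then show ?thesis using that sp by auto
  qed
  have rF: "?r v \<in> ?F" if "v \<in> space W" for v
    using discretize_in_indices[OF sp[OF that] n] by auto
  have eq: "G (?r v) = (\<Sum>f\<in>?F. G f * indicator (?A f) v)" if "v \<in> space W" for v
  proof -
    have "(\<Sum>f\<in>?F. G f * indicator (?A f) v) = (\<Sum>f\<in>?F. if f = ?r v then G f else 0)"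
      using A[OF that] by (intro sum.cong) (auto simp: indicator_def)
    then show ?thesis using rF[OF that] fin by simp
  qed
  have cell: "{y \<in> bivariate_space. discretize n y = f i} \<in> sets (point_law x)" if "f \<in> ?F" "i < j" for f i
    using that by (intro discretize_cell(1)[OF n]) auto
  have As: "?A f \<in> sets W" if "f \<in> ?F" for f
    unfolding W_def
  proof (rule sets.sets_Collect_finite_All)
    fix i assume "i \<in> {..<j}"
    then show "{v \<in> space (PiM UNIV (\<lambda>_. point_law x)). v i \<in> {y \<in> bivariate_space. discretize n y = f i}} \<in> sets (PiM UNIV (\<lambda>_. point_law x))"
      using measurable_sets[OF measurable_component_singleton[of i UNIV "\<lambda>_. point_law x"] cell[OF that]]
      by (simp add: vimage_def Int_def conj_commute)
  qed simp
  have Am: "measure W (?A f) = (\<Prod>i<j. exp (- x (snd (f i))) / (real n * intensity_mass x))" if "f \<in> ?F" for f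
  proof -
    have "emeasure W (?A f) = (\<Prod>i<j. emeasure (point_law x) {y \<in> bivariate_space. discretize n y = f i})"
      unfolding W_def using cell[OF that] by (intro W.emeasure_PiM_Collect) auto
    also have "\<dots> = (\<Prod>i<j. ennreal (exp (- x (snd (f i))) / (real n * intensity_mass x)))"
    proof (intro prod.cong refl)
      fix i assume "i \<in> {..<j}"
      then have fi: "f i \<in> marked_indices n" by (rule PiE_mem[OF that])
      show "emeasure (point_law x) {y \<in> bivariate_space. discretize n y = f i} =
          ennreal (exp (- x (snd (f i))) / (real n * intensity_mass x))"
        unfolding V.emeasure_eq_measure discretize_cell(2)[OF n fi] ..
    qed
    also have "\<dots> = ennreal (\<Prod>i<j. exp (- x (snd (f i))) / (real n * intensity_mass x))"
      using intensity_mass_pos[of x] by (intro prod_ennreal) simp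
    finally show ?thesis
      using intensity_mass_pos[of x] by (simp add: measure_def prod_nonneg)
  qed
  have pW: "prob_space W" unfolding W_def using prob_point_law by (intro prob_space_PiM) auto
  interpret PW: prob_space W by (rule pW)
  have "(\<lambda>v. \<Sum>f\<in>?F. G f * indicator (?A f) v) \<in> borel_measurable W"
    using As by (intro borel_measurable_sum borel_measurable_times borel_measurable_indicator) auto
  then show "(\<lambda>v. G (?r v)) \<in> borel_measurable W"
    by (rule measurable_cong[THEN iffD1, rotated]) (rule eq[symmetric])
  have "(LINT v|W. G (?r v)) = (LINT v|W. (\<Sum>f\<in>?F. G f * indicator (?A f) v))"
    by (intro Bochner_Integration.integral_cong refl eq)
  also have "\<dots> = (\<Sum>f\<in>?F. (LINT v|W. G f * indicator (?A f) v))"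
    using As by (intro Bochner_Integration.integral_sum) (auto simp: PW.emeasure_eq_measure)
  also have "\<dots> = (\<Sum>f\<in>?F. G f * measure W (?A f))"
    using As by (intro sum.cong refl) (simp add: Int_absorb2 sets.sets_into_space)
  finally have "(LINT v|W. G (?r v)) = (\<Sum>f\<in>?F. G f * (\<Prod>i<j. exp (- x (snd (f i))) / (real n * intensity_mass x)))"
    using Am by simp
  then show "intensity_mass x ^ j * (LINT v|W. G (?r v)) = (\<Sum>f\<in>?F. (\<Prod>i<j. exp (- x (snd (f i))) / real n) * G f)"
    using intensity_mass_pos[of x] by (simp add: sum_distrib_left prod_dividef prod.distrib power_mult_distrib mult_ac)
qed

section \<open>Convergence from factorial moments\<close>

context
  fixes h :: "(real \<times> nat) measure \<Rightarrow> real" and c :: real and x :: "nat \<Rightarrow> real"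
  assumes h: "continuous_map (vague_topology bivariate_space) euclideanreal h"
    and c: "\<And>\<nu>. \<nu> \<in> point_measures bivariate_space \<Longrightarrow> \<bar>h \<nu>\<bar> \<le> c"
begin

text \<open>The Moebius transform over positions instead of points: it makes sense for tuples with
  repetitions, which the product weights also charge.\<close>

definition subset_sum :: "nat \<Rightarrow> (nat \<Rightarrow> real \<times> nat) \<Rightarrow> real" where
  "subset_sum j v = (\<Sum>I\<in>Pow {..<j}. (- 1) ^ (j - card I) * h (point_sum bivariate_space I v))"

definition sample_mean :: "nat \<Rightarrow> real" where
  "sample_mean k = (LINT v|PiM (UNIV :: nat set) (\<lambda>_. point_law x). h (point_sum bivariate_space {..<k} v))"

lemma h_point_sum_bound:
  "finite A \<Longrightarrow> v \<in> A \<rightarrow> bivariate_space \<Longrightarrow> \<bar>h (point_sum bivariate_space A v)\<bar> \<le> c"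
  by (intro c point_sum_in_point_measures)

lemma prob_PiM_point_law: "prob_space (PiM (UNIV :: nat set) (\<lambda>_. point_law x))"
  using prob_point_law by (intro prob_space_PiM) auto

lemma space_PiM_point_law: "v \<in> space (PiM (UNIV :: nat set) (\<lambda>_. point_law x)) \<longleftrightarrow> (\<forall>i. v i \<in> bivariate_space)"
  by (auto simp: space_PiM space_point_law PiE_def Pi_iff)

lemma AE_bounded_integrable:
  fixes f :: "(nat \<Rightarrow> real \<times> nat) \<Rightarrow> real"
  assumes "f \<in> borel_measurable (PiM (UNIV :: nat set) (\<lambda>_. point_law x))"
    and "\<And>v. (\<forall>i. v i \<in> bivariate_space) \<Longrightarrow> \<bar>f v\<bar> \<le> C"
  shows "integrable (PiM (UNIV :: nat set) (\<lambda>_. point_law x)) f"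
proof -
  interpret prob_space "PiM (UNIV :: nat set) (\<lambda>_. point_law x)" by (rule prob_PiM_point_law)
  show ?thesis
    by (rule integrable_const_bound[of _ C]) (use assms in \<open>auto simp: space_PiM_point_law\<close>)
qed

lemma exchangeable:
  assumes I: "finite I"
  shows "(LINT v|PiM (UNIV :: nat set) (\<lambda>_. point_law x). h (point_sum bivariate_space I v)) = sample_mean (card I)"
proof -
  let ?W = "PiM (UNIV :: nat set) (\<lambda>_. point_law x)"
  obtain m where m: "I \<subseteq> {..<m}" using I finite_nat_iff_bounded by auto
  obtain e where e: "bij_betw e {0..<card I} I" using ex_bij_betw_nat_finite[OF I] by blast
  \<comment> \<open>An injection of all naturals that enumerates \<open>I\<close> first and sends
    the rest beyond \<open>m\<close>; the product measure is invariant under such a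
    reindexing.\<close>
  define f where "f i = (if i < card I then e i else m + i)" for i
  have eI: "e i \<in> I" if "i < card I" for i using e that by (auto simp: bij_betw_def)
  have inj: "inj f"
  proof (rule injI)
    fix i k assume "f i = f k"
    moreover have "e i < m" if "i < card I" for i using eI[OF that] m by auto
    ultimately show "i = k"
      using e by (fastforce simp: f_def bij_betw_def inj_on_def split: if_splits)
  qed
  have im: "f ` {..<card I} = I"
    using e by (auto simp: f_def bij_betw_def lessThan_atLeast0)
  have meas: "(\<lambda>v n. v (f n)) \<in> ?W \<rightarrow>\<^sub>M ?W"
    by (rule measurable_PiM_single') (auto simp: space_PiM)
  have "distr ?W ?W (\<lambda>v n. v (f n)) = ?W"
    using distr_PiM_reindex[of UNIV "\<lambda>_. point_law x" f UNIV] inj prob_point_law by (simp add: restrict_def)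
  then have "sample_mean (card I) = (LINT v|distr ?W ?W (\<lambda>v n. v (f n)). h (point_sum bivariate_space {..<card I} v))"
    by (simp add: sample_mean_def)
  also have "\<dots> = (LINT v|?W. h (point_sum bivariate_space {..<card I} (\<lambda>n. v (f n))))"
    by (rule integral_distr[OF meas point_functional_measurable[OF _ h]]) simp
  also have "\<dots> = (LINT v|?W. h (point_sum bivariate_space I v))"
  proof (intro Bochner_Integration.integral_cong refl)
    fix v assume "v \<in> space ?W"
    then show "h (point_sum bivariate_space {..<card I} (\<lambda>n. v (f n))) = h (point_sum bivariate_space I v)"
      using point_sum_reindex[of "{..<card I}" f v bivariate_space] inj im
      by (auto simp: comp_def space_PiM_point_law inj_on_subset)
  qed
  finally show ?thesis by simp
qed

lemma sum_over_subsets_by_card: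
  fixes F :: "nat \<Rightarrow> real"
  assumes "finite A"
  shows "(\<Sum>I\<in>Pow A. F (card I)) = (\<Sum>i\<le>card A. real (card A choose i) * F i)"
proof -
  have "(\<Sum>I\<in>Pow A. F (card I)) = (\<Sum>i\<in>{..card A}. \<Sum>I | I \<in> Pow A \<and> card I = i. F (card I))"
    using assms by (intro sum.group[symmetric]) (auto intro: card_mono)
  also have "\<dots> = (\<Sum>i\<le>card A. real (card A choose i) * F i)"
  proof (intro sum.cong refl)
    fix i
    have "(\<Sum>I | I \<in> Pow A \<and> card I = i. F (card I)) = (\<Sum>I | I \<subseteq> A \<and> card I = i. F i)"
      by (intro sum.cong) auto
    then show "(\<Sum>I | I \<in> Pow A \<and> card I = i. F (card I)) = real (card A choose i) * F i"
      using n_subsets[OF assms, of i] by simp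
  qed
  finally show ?thesis .
qed

lemma sample_mean_bound: "\<bar>sample_mean k\<bar> \<le> c"
proof -
  let ?W = "PiM (UNIV :: nat set) (\<lambda>_. point_law x)"
  interpret prob_space ?W by (rule prob_PiM_point_law)
  have "\<bar>sample_mean k\<bar> \<le> (LINT v|?W. \<bar>h (point_sum bivariate_space {..<k} v)\<bar>)"
    unfolding sample_mean_def by (rule integral_abs_bound)
  also have "\<dots> \<le> (LINT v|?W. c)"
    using h_point_sum_bound
    by (intro integral_mono AE_bounded_integrable[where C = c] integrable_const)
      (auto simp: space_PiM_point_law Pi_iff intro!: borel_measurable_abs point_functional_measurable[OF _ h])
  finally show ?thesis by (simp add: prob_space)
qed

text \<open>The \<open>j\<close>th forward difference of \<open>sample_mean\<close> at 0.\<close>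

definition difference_mean :: "nat \<Rightarrow> real" where
  "difference_mean j = (\<Sum>i\<le>j. real (j choose i) * ((- 1) ^ (j - i) * sample_mean i))"

lemma integral_subset_sum:
  "(LINT v|PiM (UNIV :: nat set) (\<lambda>_. point_law x). subset_sum j v) = difference_mean j"
proof -
  let ?W = "PiM (UNIV :: nat set) (\<lambda>_. point_law x)"
  have "(LINT v|?W. subset_sum j v) = (\<Sum>I\<in>Pow {..<j}. LINT v|?W. (- 1) ^ (j - card I) * h (point_sum bivariate_space I v))"
    unfolding subset_sum_def
  proof (rule Bochner_Integration.integral_sum)
    fix I assume "I \<in> Pow {..<j}"
    then have "finite I" using finite_subset by auto
    then show "integrable ?W (\<lambda>v. (- 1) ^ (j - card I) * h (point_sum bivariate_space I v))"
      using h_point_sum_bound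
      by (intro integrable_mult_right AE_bounded_integrable[where C = c] point_functional_measurable h) auto
  qed
  also have "\<dots> = (\<Sum>I\<in>Pow {..<j}. (- 1) ^ (j - card I) * sample_mean (card I))"
    using exchangeable by (intro sum.cong refl) (auto simp: finite_subset)
  also have "\<dots> = difference_mean j"
    using sum_over_subsets_by_card[of "{..<j}" "\<lambda>i. (- 1) ^ (j - i) * sample_mean i"] by (simp add: difference_mean_def)
  finally show ?thesis .
qed

lemma subset_sum_cong: "(\<And>i. i < j \<Longrightarrow> v i = w i) \<Longrightarrow> subset_sum j v = subset_sum j w"
  unfolding subset_sum_def
  by (intro sum.cong refl arg_cong2[where f = "(*)"] arg_cong[where f = h] point_sum_cong) auto

lemma subset_sum_bound:
  assumes "\<And>i. i < j \<Longrightarrow> v i \<in> bivariate_space"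
  shows "\<bar>subset_sum j v\<bar> \<le> 2 ^ j * c"
proof -
  have "\<bar>subset_sum j v\<bar> \<le> (\<Sum>I\<in>Pow {..<j}. \<bar>(- 1) ^ (j - card I) * h (point_sum bivariate_space I v)\<bar>)"
    unfolding subset_sum_def by (rule sum_abs)
  also have "\<dots> \<le> (\<Sum>I\<in>Pow {..<j}. c)"
    using assms by (intro sum_mono) (auto simp: abs_mult power_abs finite_subset intro!: h_point_sum_bound)
  finally show ?thesis by (simp add: card_Pow)
qed

text \<open>The sum is a mean over the rounded sample, by \<open>discretized_integral\<close>.
  Rounding converges pointwise, and \<open>vague_sequential_continuity\<close> applies to each of
  the finitely many terms of \<open>subset_sum\<close>.\<close>

lemma subset_sum_Riemann:
  "(\<lambda>n. \<Sum>f\<in>{..<j} \<rightarrow>\<^sub>E marked_indices n. (\<Prod>i<j. exp (- x (snd (f i))) / real n) * subset_sum j (rescale n \<circ> f))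
     \<longlonglongrightarrow> intensity_mass x ^ j * difference_mean j"
proof -
  let ?W = "PiM (UNIV :: nat set) (\<lambda>_. point_law x)"
  interpret prob_space ?W by (rule prob_PiM_point_law)
  \<comment> \<open>\<open>Suc n\<close> because rounding needs at least one cell; the shift is
    undone at the end.\<close>
  let ?g = "\<lambda>n v. subset_sum j (rescale (Suc n) \<circ> restrict (discretize (Suc n) \<circ> v) {..<j})"
  have "(\<lambda>n. LINT v|?W. ?g n v) \<longlonglongrightarrow> (LINT v|?W. subset_sum j v)"
  proof (rule integral_dominated_convergence[where w = "\<lambda>_. 2 ^ j * c"])
    show "subset_sum j \<in> borel_measurable ?W"
      unfolding subset_sum_def[abs_def]
      by (intro borel_measurable_sum borel_measurable_times borel_measurable_const point_functional_measurable h)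
        (auto intro: finite_subset)
    show "?g n \<in> borel_measurable ?W" for n
      by (rule discretized_integral(1)[where G = "\<lambda>f. subset_sum j (rescale (Suc n) \<circ> f)"]) simp
    show "AE v in ?W. (\<lambda>n. ?g n v) \<longlonglongrightarrow> subset_sum j v"
    proof (rule AE_I2)
      fix v assume "v \<in> space ?W"
      then have v: "v i \<in> bivariate_space" for i by (simp add: space_PiM_point_law)
      have r: "rescale (Suc n) (discretize (Suc n) (v i)) \<in> bivariate_space" for n i
        by (intro rescale_in_space discretize_in_indices v) simp
      have l: "(\<lambda>n. rescale (Suc n) (discretize (Suc n) (v i))) \<longlonglongrightarrow> v i" for i
        using rescale_discretize_tendsto[OF v] by (rule LIMSEQ_Suc)
      have "(\<lambda>n. subset_sum j (\<lambda>i. rescale (Suc n) (discretize (Suc n) (v i)))) \<longlonglongrightarrow> subset_sum j v"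
        unfolding subset_sum_def
        by (intro tendsto_sum tendsto_mult tendsto_const vague_sequential_continuity[OF _ _ _ _ h])
          (use r l v in \<open>auto intro: finite_subset\<close>)
      moreover have "?g n v = subset_sum j (\<lambda>i. rescale (Suc n) (discretize (Suc n) (v i)))" for n
        by (rule subset_sum_cong) simp
      ultimately show "(\<lambda>n. ?g n v) \<longlonglongrightarrow> subset_sum j v" by simp
    qed
    show "AE v in ?W. norm (?g n v) \<le> 2 ^ j * c" for n
      by (rule AE_I2) (auto simp: space_PiM_point_law intro!: subset_sum_bound rescale_in_space discretize_in_indices)
  qed simp
  then have "(\<lambda>n. intensity_mass x ^ j * (LINT v|?W. ?g n v)) \<longlonglongrightarrow> intensity_mass x ^ j * difference_mean j"
    unfolding integral_subset_sum by (intro tendsto_intros)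
  moreover have "intensity_mass x ^ j * (LINT v|?W. ?g n v) = (\<Sum>f\<in>{..<j} \<rightarrow>\<^sub>E marked_indices (Suc n).
      (\<Prod>i<j. exp (- x (snd (f i))) / real (Suc n)) * subset_sum j (rescale (Suc n) \<circ> f))" for n
    by (rule discretized_integral(2)[where G = "\<lambda>f. subset_sum j (rescale (Suc n) \<circ> f)"]) simp
  ultimately have "(\<lambda>n. \<Sum>f\<in>{..<j} \<rightarrow>\<^sub>E marked_indices (Suc n).
      (\<Prod>i<j. exp (- x (snd (f i))) / real (Suc n)) * subset_sum j (rescale (Suc n) \<circ> f)) \<longlonglongrightarrow> intensity_mass x ^ j * difference_mean j"
    by simp
  then show ?thesis by (rule LIMSEQ_imp_Suc)
qed

text \<open>Newton expansion of a Poisson mean: multiplying the series of weighted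
  \<open>sample_mean\<close> values by the exponential series of \<open>- intensity_mass x\<close>
  gives a Cauchy product whose coefficients are forward differences.\<close>

lemma difference_mean_series:
  "(\<lambda>j. intensity_mass x ^ j / fact j * difference_mean j) sums
    (LINT \<nu>|mixed_law bivariate_space (intensity_mass x) (point_law x). h \<nu>)"
proof -
  let ?l = "intensity_mass x"
  define a where "a i = ?l ^ i / fact i * sample_mean i" for i
  define b where "b i = (- ?l) ^ i / fact i" for i
  have l: "0 < ?l" by (rule intensity_mass_pos)
  have na: "norm (a i) \<le> c * (?l ^ i / fact i)" for i
    using sample_mean_bound[of i] l mult_left_mono[of "\<bar>sample_mean i\<bar>" c "?l ^ i / fact i"]
    by (simp add: a_def abs_mult mult.commute)
  have se: "summable (\<lambda>i. ?l ^ i / fact i)" using summable_exp[of ?l] by (simp add: field_simps)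
  have sa: "summable (\<lambda>i. norm (a i))"
    by (rule summable_comparison_test'[OF summable_mult[OF se, of c]]) (use na in auto)
  have sb: "summable (\<lambda>i. norm (b i))" using se l by (simp add: b_def power_abs)
  have eb: "(\<Sum>i. b i) = exp (- ?l)"
    unfolding b_def exp_def by (simp add: field_simps)
  have "(LINT \<nu>|mixed_law bivariate_space ?l (point_law x). h \<nu>) = (LINT k|measure_pmf (poisson_pmf ?l). sample_mean k)"
    unfolding sample_mean_def
    by (rule integral_mixed_law[OF prob_point_law sets_point_law l h c])
  moreover have "(\<lambda>k. (?l ^ k / fact k * exp (- ?l)) *\<^sub>R sample_mean k) sums (LINT k|measure_pmf (poisson_pmf ?l). sample_mean k)"
    by (rule poisson_expectation[OF l]) (use sample_mean_bound in auto)
  moreover have "(\<lambda>k. (?l ^ k / fact k * exp (- ?l)) *\<^sub>R sample_mean k) = (\<lambda>k. exp (- ?l) * a k)"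
    by (auto simp: a_def)
  moreover have "(\<lambda>k. exp (- ?l) * a k) sums (exp (- ?l) * (\<Sum>k. a k))"
    using summable_norm_cancel[OF sa] by (intro sums_mult summable_sums)
  ultimately have I: "(LINT \<nu>|mixed_law bivariate_space ?l (point_law x). h \<nu>) = (\<Sum>k. a k) * exp (- ?l)"
    by (simp add: sums_iff mult.commute)
  have "(\<Sum>i\<le>j. a i * b (j - i)) = ?l ^ j / fact j * difference_mean j" for j
    unfolding difference_mean_def sum_distrib_left
  proof (intro sum.cong refl)
    fix i assume i: "i \<in> {..j}"
    have "?l ^ j = ?l ^ i * ?l ^ (j - i)" using i by (simp add: power_add[symmetric])
    moreover have "(- ?l) ^ (j - i) = (- 1) ^ (j - i) * ?l ^ (j - i)" by (rule power_minus)
    moreover have "real (j choose i) = fact j / (fact i * fact (j - i))" using i by (intro binomial_fact) auto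
    ultimately show "a i * b (j - i) = ?l ^ j / fact j * (real (j choose i) * ((- 1) ^ (j - i) * sample_mean i))"
      by (simp add: a_def b_def field_simps)
  qed
  with Cauchy_product_sums[OF sa sb] show ?thesis unfolding I eb by simp
qed

section \<open>Random index sets whose factorial moments approach product weights\<close>

context
  fixes M :: "'a measure" and R :: "nat \<Rightarrow> 'a \<Rightarrow> (nat \<times> nat) set"
  assumes M: "prob_space M"
    and R: "\<And>n \<omega>. R n \<omega> \<subseteq> marked_indices n"
    and Rm: "\<And>n a. {\<omega>\<in>space M. a \<in> R n \<omega>} \<in> sets M"
    and star: "\<And>j :: nat. (\<lambda>n. \<Sum>f\<in>{..<j} \<rightarrow>\<^sub>E marked_indices n.
      \<bar>(if inj_on f {..<j} then measure M {\<omega>\<in>space M. f ` {..<j} \<subseteq> R n \<omega>} else 0) -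
        (\<Prod>i<j. exp (- x (snd (f i))) / real n)\<bar>) \<longlonglongrightarrow> 0"
begin

lemma superset_event: "finite J \<Longrightarrow> {\<omega>\<in>space M. J \<subseteq> R n \<omega>} \<in> sets M"
proof -
  assume "finite J"
  then have "{\<omega>\<in>space M. \<forall>a\<in>J. a \<in> R n \<omega>} \<in> sets M"
    using Rm by (intro sets.sets_Collect_finite_All) auto
  then show ?thesis by (simp add: subset_iff Ball_def)
qed

lemma sum_over_random_subsets:
  assumes P: "\<And>J. P J \<Longrightarrow> J \<subseteq> marked_indices n"
  shows "(\<Sum>J | J \<subseteq> R n \<omega> \<and> P J. G J) = (\<Sum>J | P J. indicator {\<omega>. J \<subseteq> R n \<omega>} \<omega> * (G J :: real))"
proof -
  have "finite {J. P J}"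
    by (rule finite_subset[of _ "Pow (marked_indices n)"]) (use P in auto)
  then show ?thesis
    by (intro sum.mono_neutral_cong_left) (auto simp: indicator_def)
qed

text \<open>Only finitely many \<open>J\<close> can occur, so integrability and expectation reduce
  to the events that \<open>J\<close> is contained in the random set; the weights \<open>G\<close>
  are deterministic and arbitrary.\<close>

lemma integral_random_subsets:
  assumes P: "\<And>J. P J \<Longrightarrow> J \<subseteq> marked_indices n"
  shows "integrable M (\<lambda>\<omega>. \<Sum>J | J \<subseteq> R n \<omega> \<and> P J. G J)"
    and "(LINT \<omega>|M. (\<Sum>J | J \<subseteq> R n \<omega> \<and> P J. G J)) =
      (\<Sum>J | P J. measure M {\<omega>\<in>space M. J \<subseteq> R n \<omega>} * (G J :: real))"
proof -
  interpret M: prob_space M by (rule M)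
  have fin: "finite J" if "P J" for J using finite_subset[OF P[OF that]] by simp
  have eq: "(\<Sum>J | J \<subseteq> R n \<omega> \<and> P J. G J) = (\<Sum>J | P J. indicator {\<omega>\<in>space M. J \<subseteq> R n \<omega>} \<omega> * G J)" if "\<omega> \<in> space M" for \<omega>
    by (rule trans[OF sum_over_random_subsets[OF P]], assumption, intro sum.cong refl) (simp add: indicator_def that)
  have i: "integrable M (\<lambda>\<omega>. indicator {\<omega>\<in>space M. J \<subseteq> R n \<omega>} \<omega> * G J)" if "P J" for J
    using superset_event[OF fin[OF that]] by (intro integrable_mult_left integrable_real_indicator) (auto simp: M.emeasure_eq_measure)
  have "integrable M (\<lambda>\<omega>. \<Sum>J | P J. indicator {\<omega>\<in>space M. J \<subseteq> R n \<omega>} \<omega> * G J)"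
    using i by (intro Bochner_Integration.integrable_sum) auto
  then show "integrable M (\<lambda>\<omega>. \<Sum>J | J \<subseteq> R n \<omega> \<and> P J. G J)"
    by (rule Bochner_Integration.integrable_cong[OF refl, THEN iffD1, rotated]) (rule eq[symmetric])
  have "(LINT \<omega>|M. (\<Sum>J | J \<subseteq> R n \<omega> \<and> P J. G J)) = (LINT \<omega>|M. (\<Sum>J | P J. indicator {\<omega>\<in>space M. J \<subseteq> R n \<omega>} \<omega> * G J))"
    by (intro Bochner_Integration.integral_cong refl eq)
  also have "\<dots> = (\<Sum>J | P J. (LINT \<omega>|M. indicator {\<omega>\<in>space M. J \<subseteq> R n \<omega>} \<omega> * G J))"
    using i by (intro Bochner_Integration.integral_sum) auto
  also have "\<dots> = (\<Sum>J | P J. measure M {\<omega>\<in>space M. J \<subseteq> R n \<omega>} * G J)"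
    using superset_event fin by (intro sum.cong refl) simp
  finally show "(LINT \<omega>|M. (\<Sum>J | J \<subseteq> R n \<omega> \<and> P J. G J)) =
      (\<Sum>J | P J. measure M {\<omega>\<in>space M. J \<subseteq> R n \<omega>} * G J)" .
qed

text \<open>Subsets are replaced by injections at the price of \<open>fact j\<close>, and injections
  by all tuples, with probability 0 assigned to the new ones. Then \<open>star\<close> exchanges
  probabilities for product weights against the bounded \<open>G'\<close>. It is \<open>G'\<close>
  that has to be given on non-injective tuples, because the product weights charge them.\<close>

lemma factorial_moment_limit:
  fixes G :: "nat \<Rightarrow> (nat \<times> nat) set \<Rightarrow> real"
  assumes G: "\<And>n f. f \<in> injections j (marked_indices n) \<Longrightarrow> G n (f ` {..<j}) = G' n f"
    and K: "\<And>n f. f \<in> {..<j} \<rightarrow>\<^sub>E marked_indices n \<Longrightarrow> \<bar>G' n f\<bar> \<le> K"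
    and lim: "(\<lambda>n. \<Sum>f\<in>{..<j} \<rightarrow>\<^sub>E marked_indices n. (\<Prod>i<j. exp (- x (snd (f i))) / real n) * G' n f) \<longlonglongrightarrow> l"
  shows "(\<lambda>n. LINT \<omega>|M. (\<Sum>J | J \<subseteq> R n \<omega> \<and> card J = j. G n J)) \<longlonglongrightarrow> l / fact j"
proof -
  let ?F = "\<lambda>n. {..<j} \<rightarrow>\<^sub>E marked_indices n" and ?w = "\<lambda>n f. \<Prod>i<j. exp (- x (snd (f i))) / real n"
  let ?P = "\<lambda>n f. if inj_on f {..<j} then measure M {\<omega>\<in>space M. f ` {..<j} \<subseteq> R n \<omega>} else 0"
  let ?E = "\<lambda>n. LINT \<omega>|M. (\<Sum>J | J \<subseteq> R n \<omega> \<and> card J = j. G n J)"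
  have fin: "finite (?F n)" for n by (auto intro: finite_PiE)
  have E: "fact j * ?E n = (\<Sum>f\<in>?F n. ?P n f * G' n f)" for n
  proof -
    have s: "{J. J \<subseteq> R n \<omega> \<and> card J = j} = {J. J \<subseteq> R n \<omega> \<and> (J \<subseteq> marked_indices n \<and> card J = j)}" for \<omega>
      using R by auto
    have "fact j * ?E n = fact j * (\<Sum>J | J \<subseteq> marked_indices n \<and> card J = j. measure M {\<omega>\<in>space M. J \<subseteq> R n \<omega>} * G n J)"
      unfolding s by (subst integral_random_subsets(2)) auto
    also have "\<dots> = (\<Sum>f\<in>injections j (marked_indices n). measure M {\<omega>\<in>space M. f ` {..<j} \<subseteq> R n \<omega>} * G n (f ` {..<j}))"
      by (rule sum_subsets_eq_sum_injections) simp
    also have "\<dots> = (\<Sum>f\<in>injections j (marked_indices n). ?P n f * G' n f)"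
      using G by (intro sum.cong refl) (auto simp: injections_def)
    also have "\<dots> = (\<Sum>f\<in>?F n. ?P n f * G' n f)"
      by (rule sum.mono_neutral_left[OF fin]) (auto simp: injections_def)
    finally show ?thesis .
  qed
  have "(\<lambda>n. fact j * ?E n - (\<Sum>f\<in>?F n. ?w n f * G' n f)) \<longlonglongrightarrow> 0"
  proof (rule Lim_null_comparison)
    show "(\<lambda>n. \<bar>K\<bar> * (\<Sum>f\<in>?F n. \<bar>?P n f - ?w n f\<bar>)) \<longlonglongrightarrow> 0"
      using tendsto_mult[OF tendsto_const star[of j], of "\<bar>K\<bar>"] by simp
    have "norm (fact j * ?E n - (\<Sum>f\<in>?F n. ?w n f * G' n f)) \<le> \<bar>K\<bar> * (\<Sum>f\<in>?F n. \<bar>?P n f - ?w n f\<bar>)" for n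
    proof -
      have "fact j * ?E n - (\<Sum>f\<in>?F n. ?w n f * G' n f) = (\<Sum>f\<in>?F n. (?P n f - ?w n f) * G' n f)"
        unfolding E sum_subtractf[symmetric] left_diff_distrib ..
      then have "norm (fact j * ?E n - (\<Sum>f\<in>?F n. ?w n f * G' n f)) \<le> (\<Sum>f\<in>?F n. \<bar>(?P n f - ?w n f) * G' n f\<bar>)"
        by (simp only: real_norm_def sum_abs)
      also have "\<dots> \<le> (\<Sum>f\<in>?F n. \<bar>?P n f - ?w n f\<bar> * \<bar>K\<bar>)"
      proof (rule sum_mono)
        fix f assume "f \<in> ?F n"
        then have "\<bar>G' n f\<bar> \<le> \<bar>K\<bar>" using K by force
        then show "\<bar>(?P n f - ?w n f) * G' n f\<bar> \<le> \<bar>?P n f - ?w n f\<bar> * \<bar>K\<bar>"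
          unfolding abs_mult by (intro mult_left_mono) auto
      qed
      finally show ?thesis unfolding sum_distrib_right[symmetric] by (simp only: mult.commute)
    qed
    then show "\<forall>\<^sub>F n in sequentially. norm (fact j * ?E n - (\<Sum>f\<in>?F n. ?w n f * G' n f)) \<le> \<bar>K\<bar> * (\<Sum>f\<in>?F n. \<bar>?P n f - ?w n f\<bar>)"
      by simp
  qed
  from tendsto_add[OF this lim] have "(\<lambda>n. fact j * ?E n) \<longlonglongrightarrow> l" by simp
  from tendsto_divide[OF this tendsto_const[of "fact j"]] show ?thesis by simp
qed

lemma moebius_eq_subset_sum:
  assumes f: "f \<in> injections j (marked_indices n)"
  shows "moebius (\<lambda>A. h (point_sum bivariate_space A (rescale n))) (f ` {..<j}) = subset_sum j (rescale n \<circ> f)"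
proof -
  have inj: "inj_on f {..<j}" and fI: "\<And>i. i < j \<Longrightarrow> f i \<in> marked_indices n"
    using f by (auto simp: injections_def)
  have "inj_on ((`) f) (Pow {..<j})" using inj by (intro inj_on_image_Pow)
  then have "moebius (\<lambda>A. h (point_sum bivariate_space A (rescale n))) (f ` {..<j}) =
      (\<Sum>I\<in>Pow {..<j}. (- 1) ^ (card (f ` {..<j}) - card (f ` I)) * h (point_sum bivariate_space (f ` I) (rescale n)))"
    unfolding moebius_def image_Pow_surj[OF refl, symmetric] by (subst sum.reindex) auto
  also have "\<dots> = subset_sum j (rescale n \<circ> f)"
    unfolding subset_sum_def
  proof (intro sum.cong refl)
    fix I assume I: "I \<in> Pow {..<j}"
    have "finite I" "inj_on f I" using I inj by (auto intro: finite_subset inj_on_subset)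
    moreover have "f ` I \<subseteq> marked_indices n" using I fI by auto
    then have "rescale n \<in> f ` I \<rightarrow> bivariate_space" using rescale_in_space by blast
    ultimately show "(- 1) ^ (card (f ` {..<j}) - card (f ` I)) * h (point_sum bivariate_space (f ` I) (rescale n)) =
        (- 1) ^ (j - card I) * h (point_sum bivariate_space I (rescale n \<circ> f))"
      using inj by (simp add: point_sum_reindex card_image)
  qed
  finally show ?thesis .
qed

lemma expected_subset_count_limit:
  "(\<lambda>n. LINT \<omega>|M. real (card (R n \<omega>) choose j)) \<longlonglongrightarrow> intensity_mass x ^ j / fact j"
proof -
  have "(\<lambda>n. LINT \<omega>|M. (\<Sum>J | J \<subseteq> R n \<omega> \<and> card J = j. 1)) \<longlonglongrightarrow> intensity_mass x ^ j / fact j"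
  proof (rule factorial_moment_limit[where G' = "\<lambda>_ _. 1" and K = 1])
    have "\<forall>\<^sub>F n in sequentially. (\<Sum>f\<in>{..<j} \<rightarrow>\<^sub>E marked_indices n. (\<Prod>i<j. exp (- x (snd (f i))) / real n) * 1) = intensity_mass x ^ j"
      by (rule eventually_mono[OF eventually_gt_at_top[of 0]]) (simp add: sum_prod_marked_weights[where w = "\<lambda>d. exp (- x d)"] intensity_mass_def)
    then show "(\<lambda>n. \<Sum>f\<in>{..<j} \<rightarrow>\<^sub>E marked_indices n. (\<Prod>i<j. exp (- x (snd (f i))) / real n) * 1) \<longlonglongrightarrow> intensity_mass x ^ j"
      by (rule tendsto_eventually)
  qed auto
  moreover have "(\<Sum>J | J \<subseteq> R n \<omega> \<and> card J = j. 1) = real (card (R n \<omega>) choose j)" for n \<omega>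
    using n_subsets[OF finite_subset[OF R finite_marked_indices], of n \<omega> j] by simp
  ultimately show ?thesis by simp
qed

lemma point_sum_converges:
  "(\<lambda>n. LINT \<omega>|M. h (point_sum bivariate_space (R n \<omega>) (rescale n))) \<longlonglongrightarrow>
    (LINT \<nu>|mixed_law bivariate_space (intensity_mass x) (point_law x). h \<nu>)" (is "?e \<longlonglongrightarrow> ?S")
proof -
  interpret M: prob_space M by (rule M)
  let ?l = "intensity_mass x"
  define \<phi> where "\<phi> n A = h (point_sum bivariate_space A (rescale n))" for n A
  define T where "T n m = (\<Sum>j\<le>m. LINT \<omega>|M. (\<Sum>J | J \<subseteq> R n \<omega> \<and> card J = j. moebius (\<phi> n) J))" for n m
  define S where "S m = (\<Sum>j\<le>m. ?l ^ j * difference_mean j / fact j)" for m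
  \<comment> \<open>The limit in \<open>n\<close> of the truncation error at order \<open>m\<close>.
    The factorial beats the power of 3, so \<open>m\<close> is fixed first and \<open>n\<close> sent
    to infinity afterwards.\<close>
  define r where "r m = c * (1 + 3 ^ Suc m) * (?l ^ Suc m / fact (Suc m))" for m
  have \<phi>c: "\<bar>\<phi> n A\<bar> \<le> c" if "A \<subseteq> marked_indices n" for n A
    unfolding \<phi>_def using that rescale_in_space
    by (intro h_point_sum_bound) (auto intro: finite_subset[OF that])
  have Tlim: "(\<lambda>n. T n m) \<longlonglongrightarrow> S m" for m
    unfolding T_def S_def
  proof (intro tendsto_sum factorial_moment_limit[where G' = "\<lambda>n f. subset_sum j (rescale n \<circ> f)" and K = "2 ^ j * c" for j])
    show "moebius (\<phi> n) (f ` {..<j}) = subset_sum j (rescale n \<circ> f)" if "f \<in> injections j (marked_indices n)" for j n f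
      unfolding \<phi>_def by (rule moebius_eq_subset_sum[OF that])
    show "\<bar>subset_sum j (rescale n \<circ> f)\<bar> \<le> 2 ^ j * c" if "f \<in> {..<j} \<rightarrow>\<^sub>E marked_indices n" for j n f
      using that by (intro subset_sum_bound) (auto intro!: rescale_in_space)
  qed (rule subset_sum_Riemann)
  have fR: "finite (R n \<omega>)" for n \<omega> by (rule finite_subset[OF R]) simp
  have iJ: "integrable M (\<lambda>\<omega>. \<Sum>J | J \<subseteq> R n \<omega> \<and> card J = j. G J)" for n j and G :: "(nat \<times> nat) set \<Rightarrow> real"
  proof -
    have "{J. J \<subseteq> R n \<omega> \<and> card J = j} = {J. J \<subseteq> R n \<omega> \<and> (J \<subseteq> marked_indices n \<and> card J = j)}" for \<omega>
      using R by auto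
    then show ?thesis using integral_random_subsets(1)[of "\<lambda>J. J \<subseteq> marked_indices n \<and> card J = j" n G] by simp
  qed
  \<comment> \<open>Moebius inversion writes the functional as a finite sum over subsets of the
    random set, whose integrability is already known.\<close>
  have i\<phi>: "integrable M (\<lambda>\<omega>. \<phi> n (R n \<omega>))" for n
  proof -
    have "\<phi> n (R n \<omega>) = (\<Sum>J | J \<subseteq> R n \<omega> \<and> J \<subseteq> marked_indices n. moebius (\<phi> n) J)" for \<omega>
    proof -
      have "Pow (R n \<omega>) = {J. J \<subseteq> R n \<omega> \<and> J \<subseteq> marked_indices n}" using R[of n \<omega>] by blast
      then show ?thesis using moebius_inversion[where \<phi> = "\<phi> n", OF fR[of n \<omega>]] by simp
    qed
    then show ?thesis
      using integral_random_subsets(1)[of "\<lambda>J. J \<subseteq> marked_indices n" n "moebius (\<phi> n)"] by simp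
  qed
  have iC: "integrable M (\<lambda>\<omega>. real (card (R n \<omega>) choose j))" for n j
  proof -
    have "real (card (R n \<omega>) choose j) = (\<Sum>J | J \<subseteq> R n \<omega> \<and> card J = j. 1)" for \<omega>
      using n_subsets[OF fR, of n \<omega> j] by simp
    moreover have "integrable M (\<lambda>\<omega>. \<Sum>J | J \<subseteq> R n \<omega> \<and> card J = j. 1 :: real)" by (rule iJ)
    ultimately show ?thesis by simp
  qed
  have bound: "\<bar>?e n - T n m\<bar> \<le> c * (1 + 3 ^ Suc m) * (LINT \<omega>|M. real (card (R n \<omega>) choose Suc m))" for n m
  proof -
    have "?e n - T n m = (LINT \<omega>|M. \<phi> n (R n \<omega>) - (\<Sum>j\<le>m. \<Sum>J | J \<subseteq> R n \<omega> \<and> card J = j. moebius (\<phi> n) J))"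
      unfolding T_def using i\<phi> iJ by (simp add: \<phi>_def)
    also have "\<bar>\<dots>\<bar> \<le> (LINT \<omega>|M. c * (1 + 3 ^ Suc m) * real (card (R n \<omega>) choose Suc m))"
    proof (rule order_trans[OF integral_abs_bound integral_mono])
      show "integrable M (\<lambda>\<omega>. \<bar>\<phi> n (R n \<omega>) - (\<Sum>j\<le>m. \<Sum>J | J \<subseteq> R n \<omega> \<and> card J = j. moebius (\<phi> n) J)\<bar>)"
        using i\<phi> iJ by (intro integrable_abs Bochner_Integration.integrable_diff Bochner_Integration.integrable_sum)
      show "\<bar>\<phi> n (R n \<omega>) - (\<Sum>j\<le>m. \<Sum>J | J \<subseteq> R n \<omega> \<and> card J = j. moebius (\<phi> n) J)\<bar> \<le>
          c * (1 + 3 ^ Suc m) * real (card (R n \<omega>) choose Suc m)" for \<omega>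
        using R by (intro moebius_truncation[OF fR] \<phi>c) (auto intro: order_trans)
    qed (use iC in simp)
    finally show ?thesis by simp
  qed
  have Slim: "S \<longlonglongrightarrow> ?S"
    using difference_mean_series unfolding sums_def_le S_def by simp
  have rlim: "r \<longlonglongrightarrow> 0"
  proof -
    have "(\<lambda>m. ?l ^ m / fact m) \<longlonglongrightarrow> 0" and "(\<lambda>m. (3 * ?l) ^ m / fact m) \<longlonglongrightarrow> 0"
      using summable_LIMSEQ_zero[OF summable_exp[of ?l]] summable_LIMSEQ_zero[OF summable_exp[of "3 * ?l"]]
      by (simp_all add: field_simps)
    then have "(\<lambda>m. c * (?l ^ Suc m / fact (Suc m) + (3 * ?l) ^ Suc m / fact (Suc m))) \<longlonglongrightarrow> c * (0 + 0)"
      by (intro tendsto_mult tendsto_const tendsto_add LIMSEQ_Suc)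
    moreover have "c * (?l ^ Suc m / fact (Suc m) + (3 * ?l) ^ Suc m / fact (Suc m)) = r m" for m
      unfolding r_def power_mult_distrib by (simp add: add_divide_distrib distrib_left distrib_right mult_ac del: power_Suc fact_Suc)
    ultimately show ?thesis by simp
  qed
  show ?thesis
  proof (rule LIMSEQ_I)
    fix \<epsilon> :: real assume \<epsilon>: "0 < \<epsilon>"
    have "\<forall>\<^sub>F m in sequentially. \<bar>r m\<bar> < \<epsilon> / 4 \<and> \<bar>S m - ?S\<bar> < \<epsilon> / 4"
      using order_tendstoD(2)[OF tendsto_rabs_zero[OF rlim], of "\<epsilon> / 4"] \<epsilon>
        tendstoD[OF Slim, of "\<epsilon> / 4"] by (simp add: dist_real_def eventually_conj_iff)
    then obtain m where m: "\<bar>r m\<bar> < \<epsilon> / 4" "\<bar>S m - ?S\<bar> < \<epsilon> / 4"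
      by (auto simp: eventually_sequentially)
    have "(\<lambda>n. c * (1 + 3 ^ Suc m) * (LINT \<omega>|M. real (card (R n \<omega>) choose Suc m))) \<longlonglongrightarrow> r m"
      unfolding r_def by (intro tendsto_mult tendsto_const expected_subset_count_limit)
    then have "\<forall>\<^sub>F n in sequentially. c * (1 + 3 ^ Suc m) * (LINT \<omega>|M. real (card (R n \<omega>) choose Suc m)) < \<epsilon> / 4"
      by (rule order_tendstoD(2)) (use m(1) in linarith)
    moreover have "\<forall>\<^sub>F n in sequentially. \<bar>T n m - S m\<bar> < \<epsilon> / 4"
      using tendstoD[OF Tlim, of "\<epsilon> / 4" m] \<epsilon> by (simp add: dist_real_def)
    ultimately have "\<forall>\<^sub>F n in sequentially. norm (?e n - ?S) < \<epsilon>"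
    proof eventually_elim
      case (elim n)
      then show ?case using bound[of n m] m(2) unfolding real_norm_def by linarith
    qed
    then show "\<exists>no. \<forall>n\<ge>no. norm (?e n - ?S) < \<epsilon>" by (simp add: eventually_sequentially)
  qed
qed

end

end

section \<open>Exceedance levels for Weibull-type tails\<close>

text \<open>Only the ratio at 2 enters: along \<open>2 ^ k * t1\<close> the logarithm changes by at
  most \<open>D\<close> per step, so it grows at most linearly in \<open>k\<close>, that is, in
  \<open>ln t\<close>. Monotonicity carries the bound to the points between two dyadic ones.\<close>

lemma regularly_varying_log_bound:
  assumes mono: "ultimately_monotone g" and rv: "regularly_varying g \<alpha>" and pos: "\<forall>\<^sub>F t in at_top. 0 < g t"
  shows "\<exists>A B. \<forall>\<^sub>F t in at_top. \<bar>ln (g t)\<bar> \<le> A + B * ln t"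
proof -
  define a where "a = (2::real) powr \<alpha>"
  have a: "0 < a" by (simp add: a_def)
  have lim: "((\<lambda>t. g (t * 2) / g t) \<longlongrightarrow> a) at_top"
    using rv by (simp add: regularly_varying_def a_def)
  have ev: "\<forall>\<^sub>F t in at_top. a / 2 < g (t * 2) / g t" "\<forall>\<^sub>F t in at_top. g (t * 2) / g t < 2 * a"
    by (rule order_tendstoD[OF lim]; use a in simp)+
  obtain t0 where t0: "mono_on {t0..} g \<or> monotone_on {t0..} (\<le>) (\<ge>) g"
    using mono by (auto simp: ultimately_monotone_def)
  have "\<forall>\<^sub>F t in at_top. a / 2 < g (t * 2) / g t \<and> g (t * 2) / g t < 2 * a \<and> 0 < g t \<and> t0 \<le> t"
    using ev pos eventually_ge_at_top[of t0] by eventually_elim auto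
  then obtain N where N: "\<And>t. N \<le> t \<Longrightarrow> a / 2 < g (t * 2) / g t \<and> g (t * 2) / g t < 2 * a \<and> 0 < g t \<and> t0 \<le> t"
    by (auto simp: eventually_at_top_linorder)
  define t1 where "t1 = max N 1"
  have t1: "1 \<le> t1" "N \<le> t1" by (auto simp: t1_def)
  define D where "D = \<bar>ln (2 * a)\<bar> + \<bar>ln (a / 2)\<bar>"
  have step: "\<bar>ln (g (t * 2)) - ln (g t)\<bar> \<le> D" if "t1 \<le> t" for t
  proof -
    have n: "N \<le> t" "N \<le> t * 2" using that t1 by auto
    have g: "0 < g t" "0 < g (t * 2)" using N[OF n(1)] N[OF n(2)] by auto
    have "ln (a / 2) \<le> ln (g (t * 2) / g t)" "ln (g (t * 2) / g t) \<le> ln (2 * a)"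
      using N[OF n(1)] a g by (auto intro!: ln_mono)
    moreover have "ln (g (t * 2) / g t) = ln (g (t * 2)) - ln (g t)" using g by (simp add: ln_div)
    ultimately show ?thesis unfolding D_def by linarith
  qed
  have geom: "t1 \<le> 2 ^ k * t1" for k
    using t1 mult_right_mono[of 1 "2 ^ k" t1] by simp
  have dyadic: "\<bar>ln (g (2 ^ k * t1))\<bar> \<le> \<bar>ln (g t1)\<bar> + real k * D" for k
  proof (induction k)
    case (Suc k)
    have "\<bar>ln (g (2 ^ k * t1 * 2)) - ln (g (2 ^ k * t1))\<bar> \<le> D" by (rule step[OF geom])
    moreover have e: "2 ^ Suc k * t1 = 2 ^ k * t1 * 2" by simp
    moreover have "real (Suc k) * D = real k * D + D" by (simp add: distrib_right)
    ultimately show ?case using Suc unfolding e by linarith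
  qed simp
  have D0: "0 \<le> D" by (simp add: D_def)
  have "\<bar>ln (g t)\<bar> \<le> (\<bar>ln (g t1)\<bar> + D) + D / ln 2 * ln t" if t: "t1 \<le> t" for t
  proof -
    \<comment> \<open>The dyadic block of \<open>t\<close>: both \<open>2 ^ k * t1 \<le> t\<close>
      and \<open>t \<le> 2 ^ Suc k * t1\<close>.\<close>
    define k where "k = nat \<lfloor>log 2 (t / t1)\<rfloor>"
    have q: "1 \<le> t / t1" using t t1 by simp
    then have "0 \<le> log 2 (t / t1)" by (subst zero_le_log_cancel_iff) auto
    then have k: "real k \<le> log 2 (t / t1)" "log 2 (t / t1) \<le> real (Suc k)" unfolding k_def by linarith+
    have "2 powr real k \<le> t / t1" using k(1) q by (subst (asm) le_log_iff) auto
    then have lo: "2 ^ k * t1 \<le> t" using t1 by (simp add: powr_realpow field_simps)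
    have "t / t1 \<le> 2 powr real (Suc k)" using k(2) q by (subst (asm) log_le_iff) auto
    then have hi: "t \<le> 2 ^ Suc k * t1" using t1 by (simp add: powr_realpow field_simps del: power_Suc of_nat_Suc)
    have pos': "0 < g s \<and> t0 \<le> s" if "t1 \<le> s" for s using N[of s] that t1 by auto
    have gs: "0 < g t" "0 < g (2 ^ k * t1)" "0 < g (2 ^ Suc k * t1)"
      using pos'[OF t] pos'[OF geom] by blast+
    have dom: "2 ^ k * t1 \<in> {t0..}" "t \<in> {t0..}" "2 ^ Suc k * t1 \<in> {t0..}"
      using pos'[OF t] pos'[OF geom] unfolding atLeast_iff by blast+
    have "g (2 ^ k * t1) \<le> g t \<and> g t \<le> g (2 ^ Suc k * t1) \<or> g (2 ^ Suc k * t1) \<le> g t \<and> g t \<le> g (2 ^ k * t1)"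
      using t0 lo hi dom unfolding monotone_on_def by blast
    then have "ln (g (2 ^ k * t1)) \<le> ln (g t) \<and> ln (g t) \<le> ln (g (2 ^ Suc k * t1)) \<or>
        ln (g (2 ^ Suc k * t1)) \<le> ln (g t) \<and> ln (g t) \<le> ln (g (2 ^ k * t1))"
      using gs by (auto simp: ln_le_cancel_iff simp del: power_Suc)
    moreover have "real (Suc k) * D = real k * D + D" by (simp add: distrib_right)
    ultimately have "\<bar>ln (g t)\<bar> \<le> \<bar>ln (g t1)\<bar> + D + real k * D"
      using dyadic[of k] dyadic[of "Suc k"] D0 by linarith
    moreover have "real k * D \<le> (ln t / ln 2) * D"
    proof (rule mult_right_mono[OF _ D0])
      have "log 2 (t / t1) \<le> log 2 t" using t t1 by (subst log_le_cancel_iff) (auto simp: field_simps)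
      then show "real k \<le> ln t / ln 2" using k(1) by (simp add: log_def)
    qed
    ultimately show ?thesis by (simp add: mult.commute)
  qed
  then show ?thesis using eventually_ge_at_top[of t1] by (blast intro: eventually_mono)
qed

text \<open>\<open>ln (g t)\<close> is of at most logarithmic size and so negligible against
  \<open>t powr p\<close>; halving and doubling \<open>L\<close> absorbs \<open>g\<close> together
  with the constants from the asymptotic equivalence.\<close>

lemma weibull_tail_bounds:
  assumes L: "0 < L" and p: "0 < p" and mono: "ultimately_monotone g" and rv: "regularly_varying g \<alpha>"
    and T: "\<And>t. 0 \<le> T t" and eq: "T \<sim>[at_top] (\<lambda>t. g t * exp (- L * t powr p))"
  shows "\<forall>\<^sub>F t in at_top. exp (- (2 * L * t powr p)) \<le> T t \<and> T t \<le> exp (- (L / 2 * t powr p))"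
proof -
  \<comment> \<open>Regular variation at the factor 1 says that \<open>g t / g t\<close> tends to 1;
    as division by zero gives 0, this forces \<open>g t\<close> to be nonzero eventually.\<close>
  have "((\<lambda>t. g (t * 1) / g t) \<longlongrightarrow> 1 powr \<alpha>) at_top" using rv zero_less_one unfolding regularly_varying_def by blast
  then have "\<forall>\<^sub>F t in at_top. 0 < g t / g t" by (intro order_tendstoD(1)[of _ 1]) auto
  then have g0: "\<forall>\<^sub>F t in at_top. g t \<noteq> 0" by (rule eventually_mono) auto
  have "((\<lambda>t. if T t = 0 \<and> g t * exp (- L * t powr p) = 0 then 1 else T t / (g t * exp (- L * t powr p))) \<longlongrightarrow> 1) at_top"
    using eq unfolding asymp_equiv_def .
  from order_tendstoD(1)[OF this, of "1/2"] order_tendstoD(2)[OF this, of 2]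
  have "\<forall>\<^sub>F t in at_top. 1/2 < (if T t = 0 \<and> g t * exp (- L * t powr p) = 0 then 1 else T t / (g t * exp (- L * t powr p)))"
    "\<forall>\<^sub>F t in at_top. (if T t = 0 \<and> g t * exp (- L * t powr p) = 0 then 1 else T t / (g t * exp (- L * t powr p))) < 2"
    by simp_all
  then have r: "\<forall>\<^sub>F t in at_top. 1/2 < T t / (g t * exp (- L * t powr p)) \<and> T t / (g t * exp (- L * t powr p)) < 2"
    using g0 by eventually_elim simp
  \<comment> \<open>The tail is nonnegative and its ratio to the approximation exceeds 1/2, which
    fixes the sign of \<open>g\<close>.\<close>
  have pos: "\<forall>\<^sub>F t in at_top. 0 < g t"
    using r
  proof eventually_elim
    case (elim t)
    show ?case
    proof (rule ccontr)
      assume "\<not> 0 < g t"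
      then have "T t / (g t * exp (- L * t powr p)) \<le> 0" using T[of t] by (intro divide_nonneg_nonpos mult_nonpos_nonneg) auto
      then show False using elim by linarith
    qed
  qed
  obtain A B where AB: "\<forall>\<^sub>F t in at_top. \<bar>ln (g t)\<bar> \<le> A + B * ln t"
    using regularly_varying_log_bound[OF mono rv pos] by auto
  \<comment> \<open>The extra 1 pays for the factors 2 and 1/2, because
    \<open>2 \<le> exp 1\<close>.\<close>
  have "\<forall>\<^sub>F t in at_top. (A + 1) + B * ln t \<le> L / 2 * t powr p"
    using L p by real_asymp
  then show ?thesis using r pos AB
  proof eventually_elim
    case (elim t)
    let ?w = "t powr p"
    have ge: "g t * exp (- L * ?w) = exp (ln (g t) - L * ?w)"
      using elim by (simp add: exp_diff exp_minus field_simps)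
    have up: "T t \<le> 2 * exp (ln (g t) - L * ?w)" and lo: "1/2 * exp (ln (g t) - L * ?w) \<le> T t"
      using elim unfolding ge by (auto simp: divide_less_eq less_divide_eq)
    have e: "2 \<le> exp (1::real)" using exp_ge_add_one_self[of 1] by simp
    have "T t \<le> exp 1 * exp (ln (g t) - L * ?w)"
      by (rule order_trans[OF up mult_right_mono[OF e exp_ge_zero]])
    also have "\<dots> = exp (1 + (ln (g t) - L * ?w))" by (simp only: exp_add)
    also have "\<dots> \<le> exp (- (L / 2 * ?w))" using elim by (subst exp_le_cancel_iff) linarith
    finally have 1: "T t \<le> exp (- (L / 2 * ?w))" .
    have "exp (- (2 * L * ?w)) \<le> exp (- 1 + (ln (g t) - L * ?w))"
    proof (subst exp_le_cancel_iff)
      have "0 \<le> L * ?w" using L by simp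
      then show "- (2 * L * ?w) \<le> - 1 + (ln (g t) - L * ?w)" using elim by linarith
    qed
    also have "\<dots> = exp (- 1) * exp (ln (g t) - L * ?w)" by (simp only: exp_add)
    also have "\<dots> \<le> 1/2 * exp (ln (g t) - L * ?w)"
    proof (rule mult_right_mono)
      show "exp (- 1) \<le> (1/2 :: real)" using e by (simp add: exp_minus field_simps)
    qed simp
    finally show ?case using 1 lo by simp
  qed
qed

section \<open>Normal tails and the size of the levels\<close>

text \<open>Only \<open>{y<..y+1}\<close> is kept, where
  \<open>z\<^sup>2 / 2 \<le> y\<^sup>2 + 1\<close>. The exponent is twice the true one, which is
  affordable because the later comparison with \<open>1 / n\<close> has a factor
  \<open>sqrt n\<close> to spare.\<close>

lemma std_normal_tail_lower:
  assumes y: "0 \<le> y"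
  shows "exp (- 1) / sqrt (2 * pi) * exp (- y\<^sup>2) \<le> measure std_normal_distribution {y<..}"
proof -
  interpret N: prob_space std_normal_distribution by (rule prob_space_normal_density) simp
  have "ennreal (exp (- 1) / sqrt (2 * pi) * exp (- y\<^sup>2)) = (\<integral>\<^sup>+z. ennreal (exp (- 1) / sqrt (2 * pi) * exp (- y\<^sup>2)) * indicator {y<..y+1} z \<partial>lborel)"
    by (subst nn_integral_cmult_indicator) auto
  also have "\<dots> \<le> (\<integral>\<^sup>+z. ennreal (std_normal_density z) * indicator {y<..} z \<partial>lborel)"
  proof (rule nn_integral_mono)
    fix z :: real
    show "ennreal (exp (- 1) / sqrt (2 * pi) * exp (- y\<^sup>2)) * indicator {y<..y+1} z \<le> ennreal (std_normal_density z) * indicator {y<..} z"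
    proof (cases "z \<in> {y<..y+1}")
      case True
      have "z\<^sup>2 \<le> (y + 1)\<^sup>2" using True y by (intro power_mono) auto
      moreover have "0 \<le> (y - 1)\<^sup>2" by simp
      ultimately have "z\<^sup>2 / 2 \<le> y\<^sup>2 + 1" by (simp add: power2_eq_square algebra_simps)
      then have "exp (- 1 + - y\<^sup>2) \<le> exp (- z\<^sup>2 / 2)" by simp
      then have "exp (- 1) * exp (- y\<^sup>2) \<le> exp (- z\<^sup>2 / 2)" by (simp only: exp_add)
      then have "exp (- 1) / sqrt (2 * pi) * exp (- y\<^sup>2) \<le> std_normal_density z"
        by (simp add: std_normal_density_def divide_right_mono)
      then show ?thesis using True by (auto intro: ennreal_leI)
    qed simp
  qed
  also have "\<dots> = emeasure std_normal_distribution {y<..}" by (subst emeasure_density) auto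
  finally show ?thesis by (simp add: N.emeasure_eq_measure)
qed

text \<open>For \<open>\<bar>z\<bar> > y\<close> one has
  \<open>z\<^sup>2 \<ge> y\<^sup>2 + (\<bar>z\<bar> - y)\<^sup>2\<close>, so the density is at most
  \<open>exp (- y\<^sup>2 / 2)\<close> times the sum of two normal densities centred at
  \<open>y\<close> and \<open>- y\<close>, of total mass 2.\<close>

lemma std_normal_tail_upper:
  assumes y: "0 \<le> y"
  shows "measure std_normal_distribution {z. y < \<bar>z\<bar>} \<le> 2 * exp (- y\<^sup>2 / 2)"
proof -
  interpret N: prob_space std_normal_distribution by (rule prob_space_normal_density) simp
  have one: "(\<integral>\<^sup>+z. ennreal (normal_density m 1 z) \<partial>lborel) = 1" for m
    using prob_space.emeasure_space_1[OF prob_space_normal_density[of 1 m]] by (simp add: emeasure_density)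
  have s: "{z. y < \<bar>z\<bar>} \<in> sets borel" by measurable
  have sq: "y\<^sup>2 + (\<bar>z\<bar> - y)\<^sup>2 \<le> z\<^sup>2" if "y < \<bar>z\<bar>" for z
  proof -
    have "z\<^sup>2 = \<bar>z\<bar>\<^sup>2" by simp
    also have "\<bar>z\<bar>\<^sup>2 - (y\<^sup>2 + (\<bar>z\<bar> - y)\<^sup>2) = 2 * y * (\<bar>z\<bar> - y)" by (simp add: power2_eq_square algebra_simps)
    moreover have "0 \<le> 2 * y * (\<bar>z\<bar> - y)" using y that by simp
    ultimately show ?thesis by linarith
  qed
  have "emeasure std_normal_distribution {z. y < \<bar>z\<bar>} = (\<integral>\<^sup>+z. ennreal (std_normal_density z) * indicator {z. y < \<bar>z\<bar>} z \<partial>lborel)"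
    using s by (subst emeasure_density) auto
  also have "\<dots> \<le> (\<integral>\<^sup>+z. ennreal (exp (- y\<^sup>2 / 2)) * (ennreal (normal_density y 1 z) + ennreal (normal_density (- y) 1 z)) \<partial>lborel)"
  proof (rule nn_integral_mono)
    fix z :: real
    show "ennreal (std_normal_density z) * indicator {z. y < \<bar>z\<bar>} z \<le> ennreal (exp (- y\<^sup>2 / 2)) * (ennreal (normal_density y 1 z) + ennreal (normal_density (- y) 1 z))"
    proof (cases "y < \<bar>z\<bar>")
      case True
      have "exp (- z\<^sup>2 / 2) \<le> exp (- y\<^sup>2 / 2 + - (\<bar>z\<bar> - y)\<^sup>2 / 2)" using sq[OF True] by (simp add: field_simps)
      also have "\<dots> = exp (- y\<^sup>2 / 2) * exp (- (\<bar>z\<bar> - y)\<^sup>2 / 2)" by (simp only: exp_add)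
      finally have 1: "std_normal_density z \<le> exp (- y\<^sup>2 / 2) * (exp (- (\<bar>z\<bar> - y)\<^sup>2 / 2) / sqrt (2 * pi))"
        by (simp add: std_normal_density_def divide_right_mono)
      have "exp (- (\<bar>z\<bar> - y)\<^sup>2 / 2) / sqrt (2 * pi) \<le> normal_density y 1 z + normal_density (- y) 1 z"
      proof (cases "0 \<le> z")
        case True then show ?thesis by (simp add: normal_density_def)
      next
        case False
        then have "(\<bar>z\<bar> - y)\<^sup>2 = (z + y)\<^sup>2" by (simp add: power2_eq_square algebra_simps)
        then show ?thesis by (simp add: normal_density_def)
      qed
      from mult_left_mono[OF this exp_ge_zero[of "- y\<^sup>2 / 2"]] 1
      have "std_normal_density z \<le> exp (- y\<^sup>2 / 2) * (normal_density y 1 z + normal_density (- y) 1 z)" by linarith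
      then show ?thesis using True
        by (simp add: ennreal_mult[symmetric] ennreal_plus[symmetric] ennreal_leI del: ennreal_plus)
    qed simp
  qed
  also have "\<dots> = ennreal (exp (- y\<^sup>2 / 2)) * (1 + 1)"
    by (subst nn_integral_cmult, simp, subst nn_integral_add) (auto simp: one)
  also have "\<dots> = ennreal (2 * exp (- y\<^sup>2 / 2))"
    by (subst ennreal_mult) (auto simp: mult.commute)
  finally show ?thesis by (simp add: N.emeasure_eq_measure)
qed

text \<open>Comparing with the event that \<open>S\<close> is of order \<open>(ln n) powr (1/p)\<close> and \<open>X\<close> of order \<open>sqrt (ln n)\<close>, which has
  probability much larger than \<open>1/n\<close>, shows that \<open>u n / sqrt (ln n)\<close> is at least of order \<open>(ln n) powr (1/p)\<close>.\<close>

lemma exceedance_level: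
  fixes T G :: "real \<Rightarrow> real"
  assumes L: "0 < L" and p: "0 < p" and T: "antimono T" and G: "antimono G"
    and tail: "\<forall>\<^sub>F t in at_top. exp (- (2 * L * t powr p)) \<le> T t \<and> T t \<le> exp (- (L / 2 * t powr p))"
    and prod: "\<And>s v. 0 < s \<Longrightarrow> 0 \<le> v \<Longrightarrow> T s * measure std_normal_distribution {v / s<..} \<le> G v"
  shows "\<exists>\<delta>>0. \<forall>u \<kappa>. (\<lambda>n. real n * G (u n)) \<longlonglongrightarrow> \<kappa> \<longrightarrow>
    (\<forall>\<^sub>F n in sequentially. 0 < u n \<and> T (u n / (2 * sqrt (ln (real n)))) \<le> real n powr - \<delta>)"
proof -
  \<comment> \<open>The \<open>8 * L\<close> makes \<open>T (s n)\<close> at least \<open>n\<close>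
    to the power -1/4, and \<open>v n / s n = sqrt (ln n) / 2\<close> makes the normal factor of the
    same order. Their product, of order \<open>1 / sqrt n\<close>, is far above
    \<open>1 / n\<close>, so a level below \<open>v n\<close> would be exceeded too often.\<close>
  define k where "k = 1/2 * (8 * L) powr - (1 / p)"
  have k: "0 < k" using L by (simp add: k_def)
  \<comment> \<open>Since \<open>r n = v n / (2 * sqrt (ln n))\<close>, the exponent satisfies
    \<open>L / 2 * r n powr p = \<delta> * ln n\<close>. It depends on \<open>L\<close> and
    \<open>p\<close> only, so it serves all levels at once.\<close>
  define \<delta> where "\<delta> = L / 2 * (k / 2) powr p"
  have \<delta>: "0 < \<delta>" using L k by (simp add: \<delta>_def)
  define c0 where "c0 = exp (- 1) / sqrt (2 * pi)"
  have c0: "0 < c0" by (simp add: c0_def)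
  define s where "s n = (ln (real n) / (8 * L)) powr (1 / p)" for n
  define r where "r n = k / 2 * ln (real n) powr (1 / p)" for n
  define v where "v n = k * ln (real n) powr (1 / p) * sqrt (ln (real n))" for n
  have s_top: "filterlim s at_top sequentially" unfolding s_def using L p by real_asymp
  have r_top: "filterlim r at_top sequentially" unfolding r_def using k p by real_asymp
  have ev_s: "\<forall>\<^sub>F n in sequentially. exp (- (2 * L * s n powr p)) \<le> T (s n)"
    using eventually_compose_filterlim[OF tail s_top] by (auto elim: eventually_mono)
  have ev_r: "\<forall>\<^sub>F n in sequentially. T (r n) \<le> exp (- (L / 2 * r n powr p))"
    using eventually_compose_filterlim[OF tail r_top] by (auto elim: eventually_mono)
  show ?thesis
  proof (intro exI conjI allI impI)
    fix u :: "nat \<Rightarrow> real" and \<kappa> assume lim: "(\<lambda>n. real n * G (u n)) \<longlonglongrightarrow> \<kappa>"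
    have "\<forall>\<^sub>F n in sequentially. real n * G (u n) < \<kappa> + 1" using order_tendstoD(2)[OF lim, of "\<kappa> + 1"] by simp
    moreover have "\<forall>\<^sub>F n in sequentially. \<kappa> + 1 < c0 * sqrt (real n)" using c0 by real_asymp
    ultimately show "\<forall>\<^sub>F n in sequentially. 0 < u n \<and> T (u n / (2 * sqrt (ln (real n)))) \<le> real n powr - \<delta>"
      using ev_s ev_r eventually_gt_at_top[of 1]
    proof eventually_elim
      case (elim n)
      have ln: "0 < ln (real n)" using elim by simp
      have s0: "0 < s n" using ln L by (simp add: s_def)
      have sp: "s n powr p = ln (real n) / (8 * L)" using ln L p by (simp add: s_def powr_powr)
      have v0: "0 < v n" using k ln by (simp add: v_def)
      have vs: "v n / s n = 1/2 * sqrt (ln (real n))"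
      proof -
        have "s n = ln (real n) powr (1 / p) * (8 * L) powr - (1 / p)"
          using ln L by (simp add: s_def powr_divide powr_minus_divide)
        then have "v n = 1/2 * sqrt (ln (real n)) * s n" by (simp add: v_def k_def)
        then show ?thesis using s0 by simp
      qed
      have big: "v n < u n"
      proof (rule ccontr)
        assume "\<not> v n < u n"
        then have "G (v n) \<le> G (u n)" using G by (simp add: antimono_def)
        have "exp (- (ln (real n) / 4)) * (c0 * exp (- (ln (real n) / 4))) \<le> T (s n) * measure std_normal_distribution {v n / s n<..}"
        proof (rule mult_mono)
          show "exp (- (ln (real n) / 4)) \<le> T (s n)" using elim(3) L unfolding sp by simp
          have sq: "(v n / s n)\<^sup>2 = ln (real n) / 4" unfolding vs using ln by (simp add: power_mult_distrib power2_eq_square)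
          show "c0 * exp (- (ln (real n) / 4)) \<le> measure std_normal_distribution {v n / s n<..}"
            using std_normal_tail_lower[of "v n / s n"] v0 s0 unfolding sq c0_def by simp
          show "0 \<le> T (s n)" using elim(3) exp_ge_zero order_trans by blast
        qed (use c0 in simp)
        also have "\<dots> \<le> G (v n)" using prod[OF s0, of "v n"] v0 by simp
        also have "\<dots> \<le> G (u n)" by fact
        finally have "c0 * (exp (- (ln (real n) / 4)) * exp (- (ln (real n) / 4))) \<le> G (u n)" by (simp add: mult_ac)
        moreover have "exp (- (ln (real n) / 4)) * exp (- (ln (real n) / 4)) = 1 / sqrt (real n)"
        proof -
          have "exp (- (ln (real n) / 4)) * exp (- (ln (real n) / 4)) = exp (- (1/2 * ln (real n)))" by (simp add: exp_add[symmetric])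
          also have "\<dots> = real n powr - (1/2)" using elim by (simp add: powr_def)
          also have "\<dots> = 1 / sqrt (real n)" by (simp add: powr_minus_divide powr_half_sqrt)
          finally show ?thesis .
        qed
        ultimately have "c0 * (1 / sqrt (real n)) \<le> G (u n)" by simp
        then have "real n * (c0 * (1 / sqrt (real n))) \<le> real n * G (u n)" by (intro mult_left_mono) auto
        moreover have "real n * (c0 * (1 / sqrt (real n))) = c0 * (real n / sqrt (real n))" by simp
        then have "real n * (c0 * (1 / sqrt (real n))) = c0 * sqrt (real n)" by (simp only: real_div_sqrt of_nat_0_le_iff)
        ultimately show False using elim(1,2) by linarith
      qed
      have "r n \<le> u n / (2 * sqrt (ln (real n)))"
      proof -
        have "r n * (2 * sqrt (ln (real n))) = v n" by (simp add: r_def v_def)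
        then show ?thesis using big ln by (simp add: pos_le_divide_eq)
      qed
      then have "T (u n / (2 * sqrt (ln (real n)))) \<le> T (r n)" using T by (simp add: antimono_def)
      also have "\<dots> \<le> exp (- (L / 2 * r n powr p))" by (rule elim)
      also have "\<dots> = real n powr - \<delta>"
      proof -
        have "r n powr p = (k / 2) powr p * ln (real n)"
          using k ln p unfolding r_def by (subst powr_mult) (auto simp: powr_powr)
        then show ?thesis using elim by (simp add: \<delta>_def powr_def mult_ac)
      qed
      finally show ?case using big v0 by simp
    qed
  qed (rule \<delta>)
qed

section \<open>Conditioning on the scales\<close>

text \<open>A combination of the \<open>X\<close> may degenerate to a constant; with mean 0 this is
  the point mass at 0, for which the formula holds with \<open>q = 0\<close>.\<close>

lemma normal_rv_char:
  assumes M: "prob_space M" and Z: "normal_rv M Z" and m: "(LINT \<omega>|M. Z \<omega>) = 0"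
    and q: "(LINT \<omega>|M. (Z \<omega>)\<^sup>2) = q"
  shows "(CLINT \<omega>|M. iexp (Z \<omega>)) = exp (- q / 2)"
proof -
  interpret prob_space M by fact
  obtain \<mu> \<sigma> where Zm[measurable]: "Z \<in> borel_measurable M" and s: "0 \<le> \<sigma>"
    and d: "distr M borel Z = (if \<sigma> = 0 then return borel \<mu> else density lborel (normal_density \<mu> \<sigma>))"
    using Z by (auto simp: normal_rv_def)
  have c: "(CLINT \<omega>|M. iexp (Z \<omega>)) = (CLINT z|distr M borel Z. iexp z)"
    by (subst integral_distr) auto
  show ?thesis
  proof (cases "\<sigma> = 0")
    case True
    have "(LINT \<omega>|M. Z \<omega>) = (LINT z|distr M borel Z. z)" by (subst integral_distr) auto
    then have "\<mu> = 0" using m d True by (simp add: integral_return)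
    moreover have "(LINT \<omega>|M. (Z \<omega>)\<^sup>2) = (LINT z|distr M borel Z. z\<^sup>2)" by (subst integral_distr) auto
    ultimately have "q = 0" using q d True by (simp add: integral_return)
    moreover have "(CLINT \<omega>|M. iexp (Z \<omega>)) = 1" unfolding c using d True \<open>\<mu> = 0\<close> by (simp add: integral_return)
    ultimately show ?thesis by simp
  next
    case False
    then have D: "distributed M lborel Z (normal_density \<mu> \<sigma>)" and s0: "0 < \<sigma>"
      using d s by (auto simp: distributed_def distr_cong[OF refl sets_lborel])
    have "\<mu> = 0" using normal_distributed_expectation[OF s0 D] m by simp
    moreover have "q = \<sigma>\<^sup>2" using normal_distributed_variance[OF s0 D] m q by simp
    ultimately show ?thesis
      using char_normal[OF s0, of \<mu> 1] d False unfolding c by simp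
  qed
qed

definition correlation :: "(nat \<Rightarrow> real) \<Rightarrow> nat \<Rightarrow> nat \<Rightarrow> real" where
  "correlation \<rho> m n = (if m = n then 1 else if m < n then \<rho> (n - m) else \<rho> (m - n))"

text \<open>A centred normal variable is determined by its variance, and for a linear combination of
  the sequence this is the quadratic form of the correlations.\<close>

lemma stationary_gaussian_family:
  assumes M: "prob_space M" and G: "standard_stationary_gaussian M Xs \<rho>"
    and J: "finite J" and k: "inj_on k J" "\<And>i. i \<in> J \<Longrightarrow> 1 \<le> k i"
  shows "gaussian_family M J (\<lambda>i. Xs (k i)) (\<lambda>i l. correlation \<rho> (k i) (k l))"
  unfolding gaussian_family_def
proof (intro conjI ballI allI)
  interpret prob_space M by fact
  have dist: "distributed M lborel (Xs n) std_normal_density" if "1 \<le> n" for n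
    using G that by (auto simp: standard_stationary_gaussian_def)
  have Xm: "Xs n \<in> borel_measurable M" if "1 \<le> n" for n
    using distributed_measurable[OF dist[OF that]] by simp
  show "Xs (k i) \<in> borel_measurable M" if "i \<in> J" for i using Xm k that by simp
  have i1: "integrable M (Xs n)" if "1 \<le> n" for n
    using distributed_integrable[OF dist[OF that], of "\<lambda>x. x"] integrable_std_normal_moment[of 1] by simp
  have i2: "integrable M (\<lambda>\<omega>. (Xs n \<omega>)\<^sup>2)" if "1 \<le> n" for n
    using distributed_integrable[OF dist[OF that], of "\<lambda>x. x\<^sup>2"] integrable_std_normal_moment[of 2] by simp
  have e1: "(LINT \<omega>|M. Xs n \<omega>) = 0" if "1 \<le> n" for n
    using standard_normal_distributed_expectation[OF dist[OF that]] .
  have e2: "(LINT \<omega>|M. (Xs n \<omega>)\<^sup>2) = 1" if "1 \<le> n" for n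
    using standard_normal_distributed_variance[OF dist[OF that]] e1[OF that] by simp
  have i11: "integrable M (\<lambda>\<omega>. Xs m \<omega> * Xs n \<omega>)" if "1 \<le> m" "1 \<le> n" for m n
  proof (rule Bochner_Integration.integrable_bound[OF Bochner_Integration.integrable_add[OF i2[OF that(1)] i2[OF that(2)]]])
    show "(\<lambda>\<omega>. Xs m \<omega> * Xs n \<omega>) \<in> borel_measurable M" using Xm that by simp
    have "\<bar>a * b\<bar> \<le> a\<^sup>2 + b\<^sup>2" for a b :: real
    proof -
      have "2 * (\<bar>a\<bar> * \<bar>b\<bar>) \<le> a\<^sup>2 + b\<^sup>2"
        using zero_le_power2[of "\<bar>a\<bar> - \<bar>b\<bar>"] by (simp add: power2_diff)
      moreover have "0 \<le> \<bar>a\<bar> * \<bar>b\<bar>" by simp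
      ultimately show ?thesis unfolding abs_mult by linarith
    qed
    then show "AE \<omega> in M. norm (Xs m \<omega> * Xs n \<omega>) \<le> norm ((Xs m \<omega>)\<^sup>2 + (Xs n \<omega>)\<^sup>2)"
      by (auto simp: abs_of_nonneg)
  qed
  have st: "(LINT \<omega>|M. Xs j \<omega> * Xs (n + j) \<omega>) = \<rho> n" if "1 \<le> j" "1 \<le> n" for j n
    using G that by (auto simp: standard_stationary_gaussian_def)
  have e11: "(LINT \<omega>|M. Xs m \<omega> * Xs n \<omega>) = correlation \<rho> m n" if "1 \<le> m" "1 \<le> n" for m n
  proof -
    consider "m = n" | "m < n" | "n < m" by linarith
    then show ?thesis
    proof cases
      case 1 then show ?thesis using e2[OF that(1)] by (simp add: correlation_def power2_eq_square)
    next
      case 2 then show ?thesis using st[of m "n - m"] that by (simp add: correlation_def)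
    next
      case 3 then show ?thesis using st[of n "m - n"] that by (simp add: correlation_def mult.commute)
    qed
  qed
  fix t :: "'b \<Rightarrow> real"
  let ?Z = "\<lambda>\<omega>. \<Sum>i\<in>J. t i * Xs (k i) \<omega>"
  have jg: "\<forall>J a. finite J \<and> J \<subseteq> {1..} \<longrightarrow> normal_rv M (\<lambda>\<omega>. \<Sum>j\<in>J. a j * Xs j \<omega>)"
    using G unfolding standard_stationary_gaussian_def jointly_gaussian_def by (rule conjunct1)
  have "finite (k ` J) \<and> k ` J \<subseteq> {1..}" using J k by auto
  \<comment> \<open>Joint normality speaks about sets of times, so the coefficients are carried from
    \<open>J\<close> to its image under \<open>k\<close>.\<close>
  with jg[THEN spec[of _ "k ` J"], THEN spec[of _ "\<lambda>j. t (the_inv_into J k j)"]]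
  have "normal_rv M (\<lambda>\<omega>. \<Sum>j\<in>k ` J. t (the_inv_into J k j) * Xs j \<omega>)" by blast
  moreover have "(\<Sum>j\<in>k ` J. t (the_inv_into J k j) * Xs j \<omega>) = ?Z \<omega>" for \<omega>
    using k(1) by (subst sum.reindex) (auto simp: the_inv_into_f_f intro!: sum.cong)
  ultimately have "normal_rv M ?Z" by simp
  moreover have "(LINT \<omega>|M. ?Z \<omega>) = 0"
    using k(2) i1 e1 by (subst Bochner_Integration.integral_sum) auto
  moreover have "(LINT \<omega>|M. (?Z \<omega>)\<^sup>2) = (\<Sum>i\<in>J. \<Sum>l\<in>J. correlation \<rho> (k i) (k l) * t i * t l)"
  proof -
    have "(?Z \<omega>)\<^sup>2 = (\<Sum>i\<in>J. \<Sum>l\<in>J. (t i * t l) * (Xs (k i) \<omega> * Xs (k l) \<omega>))" for \<omega>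
      unfolding power2_eq_square sum_product by (intro sum.cong refl) simp
    then have "(LINT \<omega>|M. (?Z \<omega>)\<^sup>2) = (LINT \<omega>|M. (\<Sum>i\<in>J. \<Sum>l\<in>J. (t i * t l) * (Xs (k i) \<omega> * Xs (k l) \<omega>)))"
      by simp
    also have "\<dots> = (\<Sum>i\<in>J. LINT \<omega>|M. (\<Sum>l\<in>J. (t i * t l) * (Xs (k i) \<omega> * Xs (k l) \<omega>)))"
      using k(2) i11 by (intro Bochner_Integration.integral_sum Bochner_Integration.integrable_sum integrable_mult_right) auto
    also have "\<dots> = (\<Sum>i\<in>J. \<Sum>l\<in>J. (LINT \<omega>|M. (t i * t l) * (Xs (k i) \<omega> * Xs (k l) \<omega>)))"
      using k(2) i11 by (intro sum.cong refl Bochner_Integration.integral_sum integrable_mult_right) auto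
    also have "\<dots> = (\<Sum>i\<in>J. \<Sum>l\<in>J. correlation \<rho> (k i) (k l) * t i * t l)"
      using k(2) e11 by (intro sum.cong refl) simp
    finally show ?thesis .
  qed
  ultimately show "(CLINT \<omega>|M. iexp (?Z \<omega>)) = exp (- (\<Sum>i\<in>J. \<Sum>l\<in>J. correlation \<rho> (k i) (k l) * t i * t l) / 2)"
    using normal_rv_char[OF M, of ?Z] by simp
qed

lemma correlation_sym: "correlation \<rho> m n = correlation \<rho> n m"
  by (auto simp: correlation_def)

lemma stationary_gaussian_comparison:
  assumes M: "prob_space M" and G: "standard_stationary_gaussian M Xs \<rho>"
    and J: "finite J" and k: "inj_on k J" "\<And>i. i \<in> J \<Longrightarrow> 1 \<le> k i"
    and c: "\<And>i l. i \<in> J \<Longrightarrow> l \<in> J \<Longrightarrow> i \<noteq> l \<Longrightarrow> \<bar>correlation \<rho> (k i) (k l)\<bar> \<le> \<eta>"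
    and \<eta>: "0 \<le> \<eta>" "3 ^ card J * \<eta> \<le> 1/4" and b: "1 \<le> b"
    and B: "\<And>i. i \<in> J \<Longrightarrow> B i \<in> sets borel" "\<And>i. i \<in> J \<Longrightarrow> B i \<subseteq> {-b..b}"
  shows "measure M {\<omega>\<in>space M. \<forall>i\<in>J. Xs (k i) \<omega> \<in> B i} \<le> exp (4 * 4 ^ card J * \<eta> * b\<^sup>2) * (\<Prod>i\<in>J. measure std_normal_distribution (B i))"
    and "exp (- (4 * 4 ^ card J * \<eta> * b\<^sup>2)) * (\<Prod>i\<in>J. measure std_normal_distribution (B i)) \<le> measure M {\<omega>\<in>space M. \<forall>i\<in>J. Xs (k i) \<omega> \<in> B i}"
proof -
  have "\<bar>correlation \<rho> (k i) (k l) - of_bool (i = l)\<bar> \<le> \<eta>" if "i \<in> J" "l \<in> J" for i l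
    using c[OF that] \<eta> by (cases "i = l") (auto simp: correlation_def)
  from gaussian_rectangle_comparison[OF J M stationary_gaussian_family[OF M G J k] correlation_sym this \<eta> b, of "\<lambda>_. 0" B]
  show "measure M {\<omega>\<in>space M. \<forall>i\<in>J. Xs (k i) \<omega> \<in> B i} \<le> exp (4 * 4 ^ card J * \<eta> * b\<^sup>2) * (\<Prod>i\<in>J. measure std_normal_distribution (B i))"
    and "exp (- (4 * 4 ^ card J * \<eta> * b\<^sup>2)) * (\<Prod>i\<in>J. measure std_normal_distribution (B i)) \<le> measure M {\<omega>\<in>space M. \<forall>i\<in>J. Xs (k i) \<omega> \<in> B i}"
    using B \<eta> b by auto
qed

section \<open>Freezing the scales by Fubini\<close>

text \<open>Independence makes the joint law a product, so the inner probability can be taken over a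
  second point \<open>\<omega>'\<close> of the same space while \<open>A\<close> stays frozen at
  \<open>\<omega>\<close>. This takes the place of conditional expectations.\<close>

lemma (in prob_space) indep_var_conditioning:
  assumes ind: "indep_var S A T B" and D: "D \<in> sets (S \<Otimes>\<^sub>M T)"
  shows "emeasure M {\<omega>\<in>space M. (A \<omega>, B \<omega>) \<in> D} = (\<integral>\<^sup>+\<omega>. emeasure M {\<omega>'\<in>space M. (A \<omega>, B \<omega>') \<in> D} \<partial>M)"
proof -
  have A[measurable]: "A \<in> M \<rightarrow>\<^sub>M S" and B[measurable]: "B \<in> M \<rightarrow>\<^sub>M T"
    and eq: "distr M S A \<Otimes>\<^sub>M distr M T B = distr M (S \<Otimes>\<^sub>M T) (\<lambda>x. (A x, B x))"
    using ind by (auto simp: indep_var_distribution_eq)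
  interpret T: prob_space "distr M T B" by (rule prob_space_distr) fact
  have D': "D \<in> sets (distr M S A \<Otimes>\<^sub>M distr M T B)" using D by simp
  have "emeasure M {\<omega>\<in>space M. (A \<omega>, B \<omega>) \<in> D} = emeasure (distr M (S \<Otimes>\<^sub>M T) (\<lambda>x. (A x, B x))) D"
    using D by (subst emeasure_distr) (auto simp: vimage_def Int_def conj_commute)
  also have "\<dots> = (\<integral>\<^sup>+a. emeasure (distr M T B) (Pair a -` D) \<partial>distr M S A)"
    unfolding eq[symmetric] by (rule T.emeasure_pair_measure_alt[OF D'])
  also have "\<dots> = (\<integral>\<^sup>+\<omega>. emeasure (distr M T B) (Pair (A \<omega>) -` D) \<partial>M)"
    by (rule nn_integral_distr[OF A]) (use T.measurable_emeasure_Pair[OF D'] in simp)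
  also have "\<dots> = (\<integral>\<^sup>+\<omega>. emeasure M {\<omega>'\<in>space M. (A \<omega>, B \<omega>') \<in> D} \<partial>M)"
  proof (rule nn_integral_cong)
    fix \<omega>
    have "Pair (A \<omega>) -` D \<in> sets T" using D by (rule sets_Pair1)
    then show "emeasure (distr M T B) (Pair (A \<omega>) -` D) = emeasure M {\<omega>'\<in>space M. (A \<omega>, B \<omega>') \<in> D}"
      by (subst emeasure_distr) (auto simp: vimage_def Int_def conj_commute)
  qed
  finally show ?thesis .
qed

context
  fixes M :: "'a measure" and Xs Ss :: "nat \<Rightarrow> 'a \<Rightarrow> real" and X S :: "'a \<Rightarrow> real" and \<rho> :: "nat \<Rightarrow> real"
  assumes M: "prob_space M" and G: "standard_stationary_gaussian M Xs \<rho>"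
    and X: "distributed M lborel X std_normal_density"
    and indS: "prob_space.indep_vars M (\<lambda>_. borel) (\<lambda>n. if n = 0 then S else Ss n) UNIV"
    and Ss0: "\<And>n. 1 \<le> n \<Longrightarrow> AE \<omega> in M. 0 \<le> Ss n \<omega>"
    and law: "\<And>n. 1 \<le> n \<Longrightarrow> distr M borel (Ss n) = distr M borel S"
    and indSX: "prob_space.indep_var M
           (PiM UNIV (\<lambda>_. borel)) (\<lambda>\<omega> n. if n = 0 then S \<omega> else Ss n \<omega>)
           (PiM {1..} (\<lambda>_. borel)) (\<lambda>\<omega>. \<lambda>n\<in>{1..}. Xs n \<omega>)"
    and indX: "prob_space.indep_var M
           (PiM UNIV (\<lambda>_. borel)) (\<lambda>\<omega> n. if n = 0 then S \<omega> else Ss n \<omega>)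
           (PiM {0} (\<lambda>_. borel)) (\<lambda>\<omega>. \<lambda>n\<in>{0::nat}. X \<omega>)"
begin

lemma S_measurable: "S \<in> borel_measurable M" and Ss_measurable: "1 \<le> n \<Longrightarrow> Ss n \<in> borel_measurable M"
proof -
  interpret prob_space M by (rule M)
  have "(if n = 0 then S else Ss n) \<in> borel_measurable M" for n
    using indS unfolding indep_vars_def by blast
  from this[of 0] this[of n] show "S \<in> borel_measurable M" "1 \<le> n \<Longrightarrow> Ss n \<in> borel_measurable M" by auto
qed

lemma Xs_measurable: "1 \<le> n \<Longrightarrow> Xs n \<in> borel_measurable M"
  using G distributed_measurable[of M lborel "Xs n"] by (auto simp: standard_stationary_gaussian_def)

lemma X_measurable: "X \<in> borel_measurable M"
  using distributed_measurable[OF X] by simp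

lemma section_measurable:
  assumes C: "C \<in> sets (borel \<Otimes>\<^sub>M borel)"
  shows "{x. (s :: real, x :: real) \<in> C} \<in> sets borel"
    and "(\<lambda>s. emeasure std_normal_distribution {x. (s, x) \<in> C}) \<in> borel_measurable borel"
proof -
  interpret N: prob_space std_normal_distribution by (rule prob_std_normal)
  have eq: "Pair s -` C = {x. (s, x) \<in> C}" for s by auto
  show "{x. (s, x) \<in> C} \<in> sets borel" using sets_Pair1[OF C, of s] by (simp add: eq)
  have "sets (borel \<Otimes>\<^sub>M std_normal_distribution) = sets (borel \<Otimes>\<^sub>M (borel :: real measure))"
    by (intro sets_pair_measure_cong) auto
  then have "C \<in> sets (borel \<Otimes>\<^sub>M std_normal_distribution)" using C by simp
  from N.measurable_emeasure_Pair[OF this]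
  show "(\<lambda>s. emeasure std_normal_distribution {x. (s, x) \<in> C}) \<in> borel_measurable borel" by (simp add: eq)
qed

lemma SX_conditioning:
  assumes C: "C \<in> sets (borel \<Otimes>\<^sub>M borel)"
  shows "emeasure M {\<omega>\<in>space M. (S \<omega>, X \<omega>) \<in> C} = (\<integral>\<^sup>+\<omega>. emeasure std_normal_distribution {x. (S \<omega>, x) \<in> C} \<partial>M)"
proof -
  interpret prob_space M by (rule M)
  let ?D = "{p \<in> space (PiM UNIV (\<lambda>_. borel) \<Otimes>\<^sub>M PiM {0::nat} (\<lambda>_. borel)). (fst p (0::nat), snd p 0) \<in> C}"
  have "(\<lambda>p. (fst p 0, snd p 0)) \<in> PiM (UNIV :: nat set) (\<lambda>_. borel) \<Otimes>\<^sub>M PiM {0::nat} (\<lambda>_. borel) \<rightarrow>\<^sub>M (borel :: real measure) \<Otimes>\<^sub>M (borel :: real measure)"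
    by (intro measurable_Pair measurable_compose[OF measurable_fst measurable_component_singleton] measurable_compose[OF measurable_snd measurable_component_singleton]) auto
  from measurable_sets[OF this C] have D: "?D \<in> sets (PiM UNIV (\<lambda>_. borel) \<Otimes>\<^sub>M PiM {0::nat} (\<lambda>_. borel))"
    by (simp add: vimage_def Int_def conj_commute)
  have e: "emeasure M {\<omega>'\<in>space M. (s, X \<omega>') \<in> C} = emeasure std_normal_distribution {x. (s, x) \<in> C}" for s
  proof -
    have "emeasure M {\<omega>'\<in>space M. (s, X \<omega>') \<in> C} = emeasure (distr M lborel X) {x. (s, x) \<in> C}"
      using X_measurable section_measurable(1)[OF C, of s] by (subst emeasure_distr) (auto simp: vimage_def Int_def conj_commute)
    then show ?thesis using X by (simp add: distributed_def)
  qed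
  show ?thesis
    using indep_var_conditioning[OF indX D] by (simp add: e space_pair_measure space_PiM)
qed

text \<open>\<open>Ss n\<close> and \<open>S\<close> share a law, so the mean for a single
  coordinate is the same for every \<open>n\<close> and is expressed by the reference pair
  \<open>S\<close>, \<open>X\<close>.\<close>

lemma SsX_conditioning:
  assumes "C \<in> sets (borel \<Otimes>\<^sub>M borel)" "1 \<le> n"
  shows "(\<integral>\<^sup>+\<omega>. emeasure std_normal_distribution {x. (Ss n \<omega>, x) \<in> C} \<partial>M) = emeasure M {\<omega>\<in>space M. (S \<omega>, X \<omega>) \<in> C}"
proof -
  have "(\<integral>\<^sup>+\<omega>. emeasure std_normal_distribution {x. (Ss n \<omega>, x) \<in> C} \<partial>M) = (\<integral>\<^sup>+s. emeasure std_normal_distribution {x. (s, x) \<in> C} \<partial>distr M borel (Ss n))"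
    using Ss_measurable[OF assms(2)] section_measurable(2)[OF assms(1)] by (subst nn_integral_distr) auto
  also have "\<dots> = (\<integral>\<^sup>+\<omega>. emeasure std_normal_distribution {x. (S \<omega>, x) \<in> C} \<partial>M)"
    unfolding law[OF assms(2)] using S_measurable section_measurable(2)[OF assms(1)] by (subst nn_integral_distr) auto
  finally show ?thesis by (simp add: SX_conditioning[OF assms(1)])
qed

lemma joint_conditioning:
  fixes C :: "'i \<Rightarrow> (real \<times> real) set"
  assumes J: "finite J" and k: "\<And>i. i \<in> J \<Longrightarrow> 1 \<le> k i" and C: "\<And>i. i \<in> J \<Longrightarrow> C i \<in> sets (borel \<Otimes>\<^sub>M borel)"
  shows "emeasure M {\<omega>\<in>space M. \<forall>i\<in>J. (Ss (k i) \<omega>, Xs (k i) \<omega>) \<in> C i} =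
    (\<integral>\<^sup>+\<omega>. emeasure M {\<omega>'\<in>space M. \<forall>i\<in>J. (Ss (k i) \<omega>, Xs (k i) \<omega>') \<in> C i} \<partial>M)"
proof -
  interpret prob_space M by (rule M)
  let ?Q = "PiM (UNIV :: nat set) (\<lambda>_. borel) \<Otimes>\<^sub>M PiM {1::nat..} (\<lambda>_. borel) :: ((nat \<Rightarrow> real) \<times> (nat \<Rightarrow> real)) measure"
  let ?D = "{p \<in> space ?Q. \<forall>i\<in>J. (fst p (k i), snd p (k i)) \<in> C i}"
  have D: "?D \<in> sets ?Q"
  proof (rule sets.sets_Collect_finite_All[OF _ J])
    fix i assume i: "i \<in> J"
    have "(\<lambda>p. (fst p (k i), snd p (k i))) \<in> ?Q \<rightarrow>\<^sub>M borel \<Otimes>\<^sub>M borel"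
      using k[OF i] by (intro measurable_Pair measurable_compose[OF measurable_fst measurable_component_singleton] measurable_compose[OF measurable_snd measurable_component_singleton]) auto
    from measurable_sets[OF this C[OF i]] show "{p \<in> space ?Q. (fst p (k i), snd p (k i)) \<in> C i} \<in> sets ?Q"
      by (simp add: vimage_def Int_def conj_commute)
  qed
  have mem: "((\<lambda>n. if n = 0 then S \<omega> else Ss n \<omega>), (\<lambda>n\<in>{1..}. Xs n \<omega>')) \<in> ?D \<longleftrightarrow> (\<forall>i\<in>J. (Ss (k i) \<omega>, Xs (k i) \<omega>') \<in> C i)" for \<omega> \<omega>'
  proof -
    have "(\<lambda>n\<in>{1..}. Xs n \<omega>') (k i) = Xs (k i) \<omega>'" "(if k i = 0 then S \<omega> else Ss (k i) \<omega>) = Ss (k i) \<omega>" if "i \<in> J" for i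
      using k[OF that] by auto
    then show ?thesis by (simp add: space_pair_measure space_PiM)
  qed
  show ?thesis using indep_var_conditioning[OF indSX D] unfolding mem .
qed

lemma Ss_nn_integral_prod:
  fixes \<psi> :: "'i \<Rightarrow> real \<Rightarrow> ennreal"
  assumes J: "finite J" and k: "inj_on k J" "\<And>i. i \<in> J \<Longrightarrow> 1 \<le> k i" and \<psi>: "\<And>i. i \<in> J \<Longrightarrow> \<psi> i \<in> borel_measurable borel"
  shows "(\<integral>\<^sup>+\<omega>. (\<Prod>i\<in>J. \<psi> i (Ss (k i) \<omega>)) \<partial>M) = (\<Prod>i\<in>J. \<integral>\<^sup>+\<omega>. \<psi> i (Ss (k i) \<omega>) \<partial>M)"
proof -
  interpret prob_space M by (rule M)
  let ?i = "the_inv_into J k"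
  have "indep_vars (\<lambda>_. borel) (\<lambda>m. \<lambda>\<omega>. \<psi> (?i m) ((if m = 0 then S else Ss m) \<omega>)) (k ` J)"
    using \<psi> k by (intro indep_vars_compose2[OF indep_vars_subset[OF indS]]) (auto simp: the_inv_into_f_f)
  from indep_vars_nn_integral[OF finite_imageI[OF J] this]
  have "(\<integral>\<^sup>+\<omega>. (\<Prod>m\<in>k ` J. \<psi> (?i m) ((if m = 0 then S else Ss m) \<omega>)) \<partial>M) =
    (\<Prod>m\<in>k ` J. \<integral>\<^sup>+\<omega>. \<psi> (?i m) ((if m = 0 then S else Ss m) \<omega>) \<partial>M)" by simp
  also have "(\<Prod>m\<in>k ` J. \<integral>\<^sup>+\<omega>. \<psi> (?i m) ((if m = 0 then S else Ss m) \<omega>) \<partial>M) = (\<Prod>i\<in>J. \<integral>\<^sup>+\<omega>. \<psi> i (Ss (k i) \<omega>) \<partial>M)"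
    unfolding prod.reindex[OF k(1)] comp_def
  proof (intro prod.cong refl)
    fix i assume i: "i \<in> J"
    then have "k i \<noteq> 0" using k(2)[OF i] by simp
    then show "(\<integral>\<^sup>+\<omega>. \<psi> (?i (k i)) ((if k i = 0 then S else Ss (k i)) \<omega>) \<partial>M) = (\<integral>\<^sup>+\<omega>. \<psi> i (Ss (k i) \<omega>) \<partial>M)"
      by (simp add: the_inv_into_f_f[OF k(1) i])
  qed
  also have "(\<lambda>\<omega>. \<Prod>m\<in>k ` J. \<psi> (?i m) ((if m = 0 then S else Ss m) \<omega>)) = (\<lambda>\<omega>. \<Prod>i\<in>J. \<psi> i (Ss (k i) \<omega>))"
  proof
    fix \<omega>
    show "(\<Prod>m\<in>k ` J. \<psi> (?i m) ((if m = 0 then S else Ss m) \<omega>)) = (\<Prod>i\<in>J. \<psi> i (Ss (k i) \<omega>))"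
      unfolding prod.reindex[OF k(1)] comp_def
    proof (intro prod.cong refl)
      fix i assume i: "i \<in> J"
      then have "k i \<noteq> 0" using k(2)[OF i] by simp
      then show "\<psi> (?i (k i)) ((if k i = 0 then S else Ss (k i)) \<omega>) = \<psi> i (Ss (k i) \<omega>)"
        by (simp add: the_inv_into_f_f[OF k(1) i])
    qed
  qed
  finally show ?thesis .
qed

text \<open>With the scales frozen, the coordinates in \<open>K\<close> are compared with
  independent normals, and those outside are discarded except for what their regions imply about the
  scales. Correlations involving an index outside \<open>K\<close> never enter.\<close>

lemma joint_upper:
  fixes C :: "'i \<Rightarrow> (real \<times> real) set"
  assumes J: "finite J" and k: "inj_on k J" "\<And>i. i \<in> J \<Longrightarrow> 1 \<le> k i" and C: "\<And>i. i \<in> J \<Longrightarrow> C i \<in> sets (borel \<Otimes>\<^sub>M borel)"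
    and Cb: "\<And>i s x. i \<in> J \<Longrightarrow> (s, x) \<in> C i \<Longrightarrow> \<bar>x\<bar> \<le> b" "\<And>i s x. i \<in> J \<Longrightarrow> (s, x) \<in> C i \<Longrightarrow> 0 \<le> s \<Longrightarrow> v i < s"
    and K: "K \<subseteq> J" and c: "\<And>i l. i \<in> K \<Longrightarrow> l \<in> K \<Longrightarrow> i \<noteq> l \<Longrightarrow> \<bar>correlation \<rho> (k i) (k l)\<bar> \<le> \<eta>"
    and \<eta>: "0 \<le> \<eta>" "3 ^ card K * \<eta> \<le> 1/4" and b: "1 \<le> b"
  shows "measure M {\<omega>\<in>space M. \<forall>i\<in>J. (Ss (k i) \<omega>, Xs (k i) \<omega>) \<in> C i} \<le> exp (4 * 4 ^ card K * \<eta> * b\<^sup>2) *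
    ((\<Prod>i\<in>K. measure M {\<omega>\<in>space M. (S \<omega>, X \<omega>) \<in> C i}) * (\<Prod>i\<in>J - K. measure M {\<omega>\<in>space M. v i < S \<omega>}))"
proof -
  interpret prob_space M by (rule M)
  interpret N: prob_space std_normal_distribution by (rule prob_std_normal)
  let ?e = "exp (4 * 4 ^ card K * \<eta> * b\<^sup>2)"
  \<comment> \<open>One factor per coordinate: in \<open>K\<close> the normal probability at a
    frozen scale, otherwise the indicator that the scale is large. A product of functions of
    distinct scales integrates factor by factor.\<close>
  define \<psi> where "\<psi> i s = (if i \<in> K then emeasure std_normal_distribution {x. (s, x) \<in> C i} else indicator {v i<..} s)" for i s
  have fK: "finite K" using K J finite_subset by blast
  have kK: "inj_on k K" "\<And>i. i \<in> K \<Longrightarrow> 1 \<le> k i" using k K by (auto intro: inj_on_subset)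
  have \<psi>m: "\<psi> i \<in> borel_measurable borel" if "i \<in> J" for i
    unfolding \<psi>_def[abs_def] using section_measurable(2)[OF C[OF that]] by (cases "i \<in> K") auto
  \<comment> \<open>\<open>Cb(2)\<close> speaks about nonnegative scales, and nonnegativity holds
    only almost surely; hence the comparison of integrands below is an almost sure one.\<close>
  have nn: "AE \<omega> in M. \<forall>i\<in>J. 0 \<le> Ss (k i) \<omega>"
    using J Ss0 k(2) by (intro AE_finite_allI) auto
  have "emeasure M {\<omega>\<in>space M. \<forall>i\<in>J. (Ss (k i) \<omega>, Xs (k i) \<omega>) \<in> C i} =
    (\<integral>\<^sup>+\<omega>. emeasure M {\<omega>'\<in>space M. \<forall>i\<in>J. (Ss (k i) \<omega>, Xs (k i) \<omega>') \<in> C i} \<partial>M)"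
    by (rule joint_conditioning[OF J k(2) C])
  also have "\<dots> \<le> (\<integral>\<^sup>+\<omega>. ennreal ?e * (\<Prod>i\<in>J. \<psi> i (Ss (k i) \<omega>)) \<partial>M)"
  proof (rule nn_integral_mono_AE)
    show "AE \<omega> in M. emeasure M {\<omega>'\<in>space M. \<forall>i\<in>J. (Ss (k i) \<omega>, Xs (k i) \<omega>') \<in> C i} \<le> ennreal ?e * (\<Prod>i\<in>J. \<psi> i (Ss (k i) \<omega>))"
      using nn
    proof eventually_elim
      case (elim \<omega>)
      let ?B = "\<lambda>i. {x. (Ss (k i) \<omega>, x) \<in> C i}"
      let ?A = "{\<omega>'\<in>space M. \<forall>i\<in>J. (Ss (k i) \<omega>, Xs (k i) \<omega>') \<in> C i}"
      show ?case
      proof (cases "\<forall>i\<in>J - K. v i < Ss (k i) \<omega>")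
        case False
        then have A0: "?A = {}" using Cb(2) elim by fastforce
        show ?thesis unfolding A0 by simp
      next
        case True
        have "(\<Prod>i\<in>J. \<psi> i (Ss (k i) \<omega>)) = (\<Prod>i\<in>K. \<psi> i (Ss (k i) \<omega>)) * (\<Prod>i\<in>J - K. \<psi> i (Ss (k i) \<omega>))"
          using prod.subset_diff[OF K J] by (simp add: mult.commute)
        also have "(\<Prod>i\<in>J - K. \<psi> i (Ss (k i) \<omega>)) = 1" using True by (intro prod.neutral) (auto simp: \<psi>_def)
        also have "(\<Prod>i\<in>K. \<psi> i (Ss (k i) \<omega>)) = ennreal (\<Prod>i\<in>K. measure std_normal_distribution (?B i))"
          by (simp add: \<psi>_def N.emeasure_eq_measure prod_ennreal)
        finally have \<psi>: "(\<Prod>i\<in>J. \<psi> i (Ss (k i) \<omega>)) = ennreal (\<Prod>i\<in>K. measure std_normal_distribution (?B i))" by simp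
        have Bm: "?B i \<in> sets borel" if "i \<in> K" for i using section_measurable(1) C K that by blast
        have "measure M ?A \<le> measure M {\<omega>'\<in>space M. \<forall>i\<in>K. Xs (k i) \<omega>' \<in> ?B i}"
        proof (rule finite_measure_mono)
          show "?A \<subseteq> {\<omega>'\<in>space M. \<forall>i\<in>K. Xs (k i) \<omega>' \<in> ?B i}" using K by auto
          show "{\<omega>'\<in>space M. \<forall>i\<in>K. Xs (k i) \<omega>' \<in> ?B i} \<in> events"
          proof (rule sets.sets_Collect_finite_All[OF _ fK])
            fix i assume i: "i \<in> K"
            show "{\<omega>'\<in>space M. Xs (k i) \<omega>' \<in> ?B i} \<in> events"
              using measurable_sets[OF Xs_measurable[OF kK(2)[OF i]] Bm[OF i]] by (simp add: vimage_def Int_def conj_commute)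
          qed
        qed
        also have "\<dots> \<le> ?e * (\<Prod>i\<in>K. measure std_normal_distribution (?B i))"
        proof (rule stationary_gaussian_comparison(1)[OF M G fK kK c \<eta> b Bm])
          show "?B i \<subseteq> {-b..b}" if "i \<in> K" for i
            using Cb(1)[of i] that K by (auto simp: abs_le_iff) (use neg_le_iff_le in force)+
        qed
        finally show ?thesis
          unfolding \<psi> by (simp add: emeasure_eq_measure ennreal_mult[symmetric] prod_nonneg ennreal_leI)
      qed
    qed
  qed
  also have "\<dots> = ennreal ?e * (\<integral>\<^sup>+\<omega>. (\<Prod>i\<in>J. \<psi> i (Ss (k i) \<omega>)) \<partial>M)"
    using \<psi>m Ss_measurable k(2) by (intro nn_integral_cmult borel_measurable_prod measurable_compose[OF Ss_measurable \<psi>m]) auto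
  also have "(\<integral>\<^sup>+\<omega>. (\<Prod>i\<in>J. \<psi> i (Ss (k i) \<omega>)) \<partial>M) = (\<Prod>i\<in>J. \<integral>\<^sup>+\<omega>. \<psi> i (Ss (k i) \<omega>) \<partial>M)"
    by (rule Ss_nn_integral_prod[OF J k \<psi>m])
  also have "\<dots> = (\<Prod>i\<in>K. \<integral>\<^sup>+\<omega>. \<psi> i (Ss (k i) \<omega>) \<partial>M) * (\<Prod>i\<in>J - K. \<integral>\<^sup>+\<omega>. \<psi> i (Ss (k i) \<omega>) \<partial>M)"
    using prod.subset_diff[OF K J] by (simp add: mult.commute)
  also have "(\<Prod>i\<in>K. \<integral>\<^sup>+\<omega>. \<psi> i (Ss (k i) \<omega>) \<partial>M) = (\<Prod>i\<in>K. ennreal (measure M {\<omega>\<in>space M. (S \<omega>, X \<omega>) \<in> C i}))"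
    using SsX_conditioning C K kK by (intro prod.cong refl) (auto simp: \<psi>_def emeasure_eq_measure)
  also have "(\<Prod>i\<in>J - K. \<integral>\<^sup>+\<omega>. \<psi> i (Ss (k i) \<omega>) \<partial>M) = (\<Prod>i\<in>J - K. ennreal (measure M {\<omega>\<in>space M. v i < S \<omega>}))"
  proof (intro prod.cong refl)
    fix i assume i: "i \<in> J - K"
    have k1: "1 \<le> k i" using i k by auto
    have "(\<integral>\<^sup>+\<omega>. \<psi> i (Ss (k i) \<omega>) \<partial>M) = (\<integral>\<^sup>+s. indicator {v i<..} s \<partial>distr M borel (Ss (k i)))"
      using i Ss_measurable[OF k1] by (subst nn_integral_distr) (auto simp: \<psi>_def)
    also have "\<dots> = emeasure (distr M borel S) {v i<..}" unfolding law[OF k1] by simp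
    also have "\<dots> = emeasure M {\<omega>\<in>space M. v i < S \<omega>}"
      using S_measurable by (subst emeasure_distr) (auto simp: vimage_def Int_def conj_commute)
    finally show "(\<integral>\<^sup>+\<omega>. \<psi> i (Ss (k i) \<omega>) \<partial>M) = ennreal (measure M {\<omega>\<in>space M. v i < S \<omega>})"
      by (simp add: emeasure_eq_measure)
  qed
  finally have "ennreal (measure M {\<omega>\<in>space M. \<forall>i\<in>J. (Ss (k i) \<omega>, Xs (k i) \<omega>) \<in> C i}) \<le> ennreal (?e *
    ((\<Prod>i\<in>K. measure M {\<omega>\<in>space M. (S \<omega>, X \<omega>) \<in> C i}) * (\<Prod>i\<in>J - K. measure M {\<omega>\<in>space M. v i < S \<omega>})))"
    by (simp add: emeasure_eq_measure prod_ennreal ennreal_mult[symmetric] prod_nonneg)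
  then show ?thesis by (subst (asm) ennreal_le_iff) (auto intro!: mult_nonneg_nonneg prod_nonneg)
qed

lemma joint_lower:
  fixes C :: "'i \<Rightarrow> (real \<times> real) set"
  assumes J: "finite J" and k: "inj_on k J" "\<And>i. i \<in> J \<Longrightarrow> 1 \<le> k i" and C: "\<And>i. i \<in> J \<Longrightarrow> C i \<in> sets (borel \<Otimes>\<^sub>M borel)"
    and Cb: "\<And>i s x. i \<in> J \<Longrightarrow> (s, x) \<in> C i \<Longrightarrow> \<bar>x\<bar> \<le> b"
    and c: "\<And>i l. i \<in> J \<Longrightarrow> l \<in> J \<Longrightarrow> i \<noteq> l \<Longrightarrow> \<bar>correlation \<rho> (k i) (k l)\<bar> \<le> \<eta>"
    and \<eta>: "0 \<le> \<eta>" "3 ^ card J * \<eta> \<le> 1/4" and b: "1 \<le> b"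
  shows "exp (- (4 * 4 ^ card J * \<eta> * b\<^sup>2)) * (\<Prod>i\<in>J. measure M {\<omega>\<in>space M. (S \<omega>, X \<omega>) \<in> C i}) \<le>
    measure M {\<omega>\<in>space M. \<forall>i\<in>J. (Ss (k i) \<omega>, Xs (k i) \<omega>) \<in> C i}"
proof -
  interpret prob_space M by (rule M)
  interpret N: prob_space std_normal_distribution by (rule prob_std_normal)
  let ?e = "exp (- (4 * 4 ^ card J * \<eta> * b\<^sup>2))"
  define \<psi> where "\<psi> i s = emeasure std_normal_distribution {x. (s, x) \<in> C i}" for i s
  have \<psi>m: "\<psi> i \<in> borel_measurable borel" if "i \<in> J" for i
    unfolding \<psi>_def[abs_def] by (rule section_measurable(2)[OF C[OF that]])
  have "ennreal (?e * (\<Prod>i\<in>J. measure M {\<omega>\<in>space M. (S \<omega>, X \<omega>) \<in> C i})) = ennreal ?e * (\<Prod>i\<in>J. \<integral>\<^sup>+\<omega>. \<psi> i (Ss (k i) \<omega>) \<partial>M)"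
    using SsX_conditioning C k by (simp add: \<psi>_def emeasure_eq_measure prod_ennreal ennreal_mult[symmetric] prod_nonneg)
  also have "(\<Prod>i\<in>J. \<integral>\<^sup>+\<omega>. \<psi> i (Ss (k i) \<omega>) \<partial>M) = (\<integral>\<^sup>+\<omega>. (\<Prod>i\<in>J. \<psi> i (Ss (k i) \<omega>)) \<partial>M)"
    by (rule Ss_nn_integral_prod[OF J k \<psi>m, symmetric])
  also have "ennreal ?e * \<dots> = (\<integral>\<^sup>+\<omega>. ennreal ?e * (\<Prod>i\<in>J. \<psi> i (Ss (k i) \<omega>)) \<partial>M)"
    using \<psi>m Ss_measurable k(2) by (intro nn_integral_cmult[symmetric] borel_measurable_prod measurable_compose[OF Ss_measurable \<psi>m]) auto
  also have "\<dots> \<le> (\<integral>\<^sup>+\<omega>. emeasure M {\<omega>'\<in>space M. \<forall>i\<in>J. (Ss (k i) \<omega>, Xs (k i) \<omega>') \<in> C i} \<partial>M)"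
  proof (rule nn_integral_mono)
    fix \<omega>
    let ?B = "\<lambda>i. {x. (Ss (k i) \<omega>, x) \<in> C i}"
    have "?e * (\<Prod>i\<in>J. measure std_normal_distribution (?B i)) \<le> measure M {\<omega>'\<in>space M. \<forall>i\<in>J. Xs (k i) \<omega>' \<in> ?B i}"
    proof (rule stationary_gaussian_comparison(2)[OF M G J k c \<eta> b])
      show "?B i \<in> sets borel" if "i \<in> J" for i by (rule section_measurable(1)[OF C[OF that]])
      show "?B i \<subseteq> {-b..b}" if "i \<in> J" for i
        using Cb[of i] that by (auto simp: abs_le_iff) (use neg_le_iff_le in force)+
    qed
    then show "ennreal ?e * (\<Prod>i\<in>J. \<psi> i (Ss (k i) \<omega>)) \<le> emeasure M {\<omega>'\<in>space M. \<forall>i\<in>J. (Ss (k i) \<omega>, Xs (k i) \<omega>') \<in> C i}"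
      by (simp add: \<psi>_def N.emeasure_eq_measure emeasure_eq_measure prod_ennreal ennreal_mult[symmetric] prod_nonneg ennreal_leI)
  qed
  also have "\<dots> = emeasure M {\<omega>\<in>space M. \<forall>i\<in>J. (Ss (k i) \<omega>, Xs (k i) \<omega>) \<in> C i}"
    by (rule joint_conditioning[OF J k(2) C, symmetric])
  finally show ?thesis by (simp add: emeasure_eq_measure)
qed

end

section \<open>Clusters of indices\<close>

text \<open>A tuple \<open>f\<close> is anchored at \<open>K\<close> if its entries in \<open>K\<close> are mutually far apart and every other entry is close
  to one of them; \<open>K\<close> is a maximal separated subfamily.\<close>

definition separated :: "nat \<Rightarrow> (nat \<Rightarrow> nat \<times> nat) \<Rightarrow> nat set \<Rightarrow> bool" where
  "separated g f K \<longleftrightarrow> (\<forall>i\<in>K. \<forall>l\<in>K. i \<noteq> l \<longrightarrow> int g < \<bar>int (fst (f i)) - int (fst (f l))\<bar>)"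

definition anchored :: "nat \<Rightarrow> nat \<Rightarrow> nat \<Rightarrow> nat set \<Rightarrow> (nat \<Rightarrow> nat \<times> nat) set" where
  "anchored g n j K = {f \<in> {..<j} \<rightarrow>\<^sub>E marked_indices n.
     separated g f K \<and> (\<forall>i\<in>{..<j} - K. \<exists>l\<in>K. \<bar>int (fst (f i)) - int (fst (f l))\<bar> \<le> int g)}"

lemma ex_anchor:
  assumes f: "f \<in> {..<j} \<rightarrow>\<^sub>E marked_indices n"
  shows "\<exists>K\<subseteq>{..<j}. f \<in> anchored g n j K"
proof -
  let ?S = "{K \<in> Pow {..<j}. separated g f K}"
  have "\<exists>K\<in>?S. \<forall>K'\<in>?S. K \<subseteq> K' \<longrightarrow> K = K'"
  proof (rule finite_has_maximal)
    have "{} \<in> ?S" by (simp add: separated_def)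
    then show "?S \<noteq> {}" by (rule ex_in_conv[THEN iffD1, OF exI])
  qed simp
  then obtain K where K: "K \<in> ?S" "\<forall>K'\<in>?S. K \<subseteq> K' \<longrightarrow> K = K'" by (rule bexE)
  have "\<exists>l\<in>K. \<bar>int (fst (f i)) - int (fst (f l))\<bar> \<le> int g" if i: "i \<in> {..<j} - K" for i
  proof (rule ccontr)
    assume *: "\<not> ?thesis"
    have "separated g f (insert i K)"
      unfolding separated_def
    proof (intro ballI impI)
      fix a b assume "a \<in> insert i K" "b \<in> insert i K" "a \<noteq> b"
      then show "int g < \<bar>int (fst (f a)) - int (fst (f b))\<bar>"
        using * K(1) by (auto simp: separated_def not_le abs_minus_commute)
    qed
    then have "insert i K \<in> ?S" using i K(1) by auto
    from K(2)[rule_format, OF this] i show False by blast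
  qed
  then show ?thesis using f K(1) by (intro exI[of _ K]) (simp add: anchored_def)
qed

text \<open>An entry outside \<open>K\<close> is encoded by its anchor, its offset and its mark, so
  it has only \<open>card K * (2 * (2 * g + 1))\<close> choices instead of
  \<open>2 * n\<close>.\<close>

lemma card_anchored:
  assumes K: "K \<subseteq> {..<j}"
  shows "card (anchored g n j K) \<le> (2 * n) ^ card K * (card K * (2 * (2 * g + 1))) ^ (j - card K)"
proof -
  let ?O = "{- int g..int g} \<times> {1, 2::nat}"
  let ?D = "(K \<rightarrow>\<^sub>E marked_indices n) \<times> (({..<j} - K) \<rightarrow>\<^sub>E (K \<times> ?O))"
  \<comment> \<open>The decoding map. Its image only has to contain the anchored tuples, so the
    value of \<open>nat\<close> at negative sums is harmless.\<close>
  define \<Phi> where "\<Phi> ab i = (if i \<in> K then fst ab i else if i < j then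
    (nat (int (fst (fst ab (fst (snd ab i)))) + fst (snd (snd ab i))), snd (snd (snd ab i))) else undefined)"
    for ab :: "(nat \<Rightarrow> nat \<times> nat) \<times> (nat \<Rightarrow> nat \<times> (int \<times> nat))" and i :: nat
  have fK: "finite K" using K finite_subset by blast
  have fD: "finite ?D" using fK by (intro finite_cartesian_product finite_PiE) auto
  have "anchored g n j K \<subseteq> \<Phi> ` ?D"
  proof
    fix f assume "f \<in> anchored g n j K"
    then have f: "f \<in> {..<j} \<rightarrow>\<^sub>E marked_indices n"
      and near: "\<And>i. i \<in> {..<j} - K \<Longrightarrow> \<exists>l\<in>K. \<bar>int (fst (f i)) - int (fst (f l))\<bar> \<le> int g"
      by (auto simp: anchored_def)
    obtain l where l: "\<And>i. i \<in> {..<j} - K \<Longrightarrow> l i \<in> K \<and> \<bar>int (fst (f i)) - int (fst (f (l i)))\<bar> \<le> int g"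
      using near by metis
    define a where "a = restrict f K"
    define b where "b = (\<lambda>i\<in>{..<j} - K. (l i, (int (fst (f i)) - int (fst (f (l i))), snd (f i))))"
    have fm: "f i \<in> marked_indices n" if "i < j" for i using PiE_mem[OF f] that by simp
    have "a \<in> K \<rightarrow>\<^sub>E marked_indices n" using fm K by (auto simp: a_def)
    moreover have "b \<in> ({..<j} - K) \<rightarrow>\<^sub>E (K \<times> ?O)"
    proof (rule PiE_I)
      fix i assume i: "i \<in> {..<j} - K"
      have "snd (f i) \<in> {1, 2}" using fm[of i] i by (auto simp: marked_indices_def)
      then show "b i \<in> K \<times> ?O" using l[OF i] i by (auto simp: b_def abs_le_iff)
    qed (auto simp: b_def)
    moreover have "f = \<Phi> (a, b)"
    proof
      fix i
      consider "i \<in> K" | "i \<in> {..<j} - K" | "i \<notin> {..<j}" using K by blast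
      then show "f i = \<Phi> (a, b) i"
      proof cases
        case 1 then show ?thesis by (simp add: \<Phi>_def a_def)
      next
        case 2
        then have "l i \<in> K" using l by blast
        then show ?thesis using 2 by (simp add: \<Phi>_def a_def b_def)
      next
        case 3
        then have "i \<notin> K" using K by blast
        then show ?thesis using 3 f by (auto simp: \<Phi>_def PiE_def extensional_def)
      qed
    qed
    ultimately show "f \<in> \<Phi> ` ?D" by blast
  qed
  then have "card (anchored g n j K) \<le> card (\<Phi> ` ?D)" using fD by (intro card_mono) auto
  also have "\<dots> \<le> card ?D" using fD by (rule card_image_le)
  also have "card ?D = card (marked_indices n) ^ card K * (card (K \<times> ?O)) ^ card ({..<j} - K)"
    using fK by (simp add: card_cartesian_product card_funcsetE)
  also have "card ({..<j} - K) = j - card K" using K fK by (simp add: card_Diff_subset)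
  also have "card (marked_indices n) = 2 * n" by (simp add: marked_indices_def card_cartesian_product)
  also have "card (K \<times> ?O) = card K * (2 * (2 * g + 1))"
  proof -
    have "card {- int g..int g} = 2 * g + 1" by simp
    then show ?thesis by (simp add: card_cartesian_product)
  qed
  finally show ?thesis .
qed

lemma sum_UN_le:
  fixes f :: "'a \<Rightarrow> real"
  assumes "finite I" "\<And>i. i \<in> I \<Longrightarrow> finite (A i)" "\<And>a. 0 \<le> f a"
  shows "sum f (\<Union>i\<in>I. A i) \<le> (\<Sum>i\<in>I. sum f (A i))"
  using assms(1,2)
proof (induction I rule: finite_induct)
  case (insert i I)
  have "sum f (A i \<union> (\<Union>i\<in>I. A i)) \<le> sum f (A i) + sum f (\<Union>i\<in>I. A i)"
    using insert assms(3) by (subst sum.union_inter[symmetric]) (auto intro: sum_nonneg)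
  then show ?case using insert by (auto intro: order_trans)
qed simp

text \<open>An anchored tuple has of order \<open>n\<close> choices per anchor and
  \<open>n powr (\<delta> / 2)\<close> per other entry, at a cost of order \<open>1 / n\<close> and
  \<open>n powr - \<delta>\<close> respectively, so tuples anchored at a proper subset contribute
  nothing in the limit. Separated tuples contribute a small relative error, and the product weights
  have total mass \<open>(w 1 + w 2) ^ j\<close>.\<close>

lemma tuple_probabilities_factorize:
  fixes A :: "nat \<Rightarrow> (nat \<Rightarrow> nat \<times> nat) \<Rightarrow> real" and q :: "nat \<Rightarrow> nat \<Rightarrow> real" and w :: "nat \<Rightarrow> real"
  assumes w: "\<And>d. d \<in> {1, 2} \<Longrightarrow> 0 < w d" and q0: "\<And>n d. 0 \<le> q n d"
    and q: "\<And>d. d \<in> {1, 2} \<Longrightarrow> (\<lambda>n. real n * q n d) \<longlonglongrightarrow> w d"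
    and \<delta>: "0 < \<delta>" "\<delta> \<le> 1" and g: "\<And>n. real (g n) \<le> real n powr (\<delta> / 2)"
    and A0: "\<And>n f. 0 \<le> A n f"
    and sep: "\<And>\<epsilon>. 0 < \<epsilon> \<Longrightarrow> \<forall>\<^sub>F n in sequentially. \<forall>f\<in>{..<j} \<rightarrow>\<^sub>E marked_indices n. separated (g n) f {..<j} \<longrightarrow>
      exp (- \<epsilon>) * (\<Prod>i<j. q n (snd (f i))) \<le> A n f \<and> A n f \<le> exp \<epsilon> * (\<Prod>i<j. q n (snd (f i)))"
    and near: "\<forall>\<^sub>F n in sequentially. \<forall>K\<subseteq>{..<j}. \<forall>f\<in>{..<j} \<rightarrow>\<^sub>E marked_indices n. separated (g n) f K \<longrightarrow>
      A n f \<le> 2 * ((\<Prod>i\<in>K. q n (snd (f i))) * (real n powr - \<delta>) ^ (j - card K))"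
  shows "(\<lambda>n. \<Sum>f\<in>{..<j} \<rightarrow>\<^sub>E marked_indices n. \<bar>A n f - (\<Prod>i<j. w (snd (f i)) / real n)\<bar>) \<longlonglongrightarrow> 0"
proof -
  let ?F = "\<lambda>n. {..<j} \<rightarrow>\<^sub>E marked_indices n" and ?W = "\<lambda>n f. \<Prod>i<j. w (snd (f i)) / real n"
  \<comment> \<open>\<open>c\<close> eventually dominates both \<open>n * q n d\<close> and
    \<open>w d\<close>; the summand 1 makes it at least 1, so its powers may be raised to the
    exponent \<open>j\<close>.\<close>
  define c where "c = 2 * (w 1 + w 2) + 1"
  \<comment> \<open>Number of choices for an entry near an anchor times the cost of one large scale;
    of order \<open>n powr (- \<delta> / 2)\<close>.\<close>
  define h where "h n = real j * (2 * (2 * real n powr (\<delta> / 2) + 1)) * real n powr - \<delta>" for n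
  define e where "e n K = 3 * c ^ j * 2 ^ card K * h n ^ (j - card K)" for n and K :: "nat set"
  have w12: "0 < w 1" "0 < w 2" using w by auto
  have c1: "1 \<le> c" using w12 by (simp add: c_def)
  have fin: "finite (?F n)" for n by (auto intro: finite_PiE)
  have mark: "snd (f i) \<in> {1, 2}" if "f \<in> ?F n" "i < j" for f n i
    using PiE_mem[OF that(1), of i] that(2) by (auto simp: marked_indices_def)
  have W0: "0 \<le> ?W n f" if "f \<in> ?F n" for n f
  proof (rule prod_nonneg)
    fix i assume "i \<in> {..<j}"
    then have "0 < w (snd (f i))" using w[OF mark[OF that, of i]] by simp
    then show "0 \<le> w (snd (f i)) / real n" by simp
  qed
  have "h \<longlonglongrightarrow> 0" unfolding h_def using \<delta> by real_asymp
  then have elim_lim: "(\<lambda>n. \<Sum>K\<in>{K. K \<subset> {..<j}}. e n K) \<longlonglongrightarrow> 0"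
  proof -
    have "(\<lambda>n. e n K) \<longlonglongrightarrow> 0" if "K \<subset> {..<j}" for K
    proof -
      have "card K < j" using psubset_card_mono[OF _ that] by simp
      then have "(\<lambda>n. 3 * c ^ j * 2 ^ card K * h n ^ (j - card K)) \<longlonglongrightarrow> 3 * c ^ j * 2 ^ card K * 0 ^ (j - card K)"
        using \<open>h \<longlonglongrightarrow> 0\<close> by (intro tendsto_intros)
      then show ?thesis using \<open>card K < j\<close> by (simp add: e_def power_0_left)
    qed
    then have "(\<lambda>n. \<Sum>K\<in>{K. K \<subset> {..<j}}. e n K) \<longlonglongrightarrow> (\<Sum>K\<in>{K. K \<subset> {..<j}}. 0)"
      by (intro tendsto_sum) auto
    then show ?thesis by simp
  qed
  have bound: "\<forall>\<^sub>F n in sequentially. (\<Sum>f\<in>?F n. \<bar>A n f - ?W n f\<bar>) \<le>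
      (exp (real (Suc j) * \<epsilon>) - 1) * (w 1 + w 2) ^ j + (\<Sum>K\<in>{K. K \<subset> {..<j}}. e n K)" if \<epsilon>: "0 < \<epsilon>" for \<epsilon>
  proof -
    have ratio: "\<forall>\<^sub>F n in sequentially. exp (- \<epsilon>) * w d < real n * q n d \<and> real n * q n d < exp \<epsilon> * w d \<and> real n * q n d < c" if d: "d \<in> {1, 2}" for d
    proof -
      have wd: "0 < w d" by (rule w[OF d])
      have "exp (- \<epsilon>) * w d < 1 * w d" "1 * w d < exp \<epsilon> * w d" using \<epsilon> wd by (intro mult_strict_right_mono; simp)+
      moreover have "w d < c" using d w12 by (auto simp: c_def)
      ultimately show ?thesis
        using order_tendstoD[OF q[OF d]] by (simp add: eventually_conj_iff)
    qed
    have "\<forall>\<^sub>F n in sequentially. \<forall>d\<in>{1, 2}. exp (- \<epsilon>) * w d < real n * q n d \<and> real n * q n d < exp \<epsilon> * w d \<and> real n * q n d < c"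
      using ratio by (intro eventually_ball_finite) auto
    then show ?thesis using sep[OF \<epsilon>] near eventually_gt_at_top[of 0]
    proof eventually_elim
      case (elim n)
      let ?I = "1 / real n"
      have n: "0 < real n" using elim by simp
      have q1: "exp (- \<epsilon>) * (w d / real n) \<le> q n d" "q n d \<le> exp \<epsilon> * (w d / real n)" "q n d \<le> c * ?I" "w d / real n \<le> c * ?I" "0 < w d" if d: "d \<in> {1, 2}" for d
      proof -
        have "w d \<le> c" using d w12 by (auto simp: c_def)
        then show "w d / real n \<le> c * ?I" using n by (simp add: divide_right_mono)
        have "exp (- \<epsilon>) * w d < real n * q n d" "real n * q n d < exp \<epsilon> * w d" "real n * q n d < c" using elim(1) d by blast+
        then show "exp (- \<epsilon>) * (w d / real n) \<le> q n d" "q n d \<le> exp \<epsilon> * (w d / real n)" "q n d \<le> c * ?I"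
          using n by (simp_all add: field_simps)
        show "0 < w d" by (rule w[OF d])
      qed
      \<comment> \<open>Here \<open>\<delta> \<le> 1\<close> enters: the product weights of
        clustered tuples obey the same bound as the probabilities.\<close>
      have nd: "?I \<le> real n powr - \<delta>"
      proof -
        have "real n powr - 1 \<le> real n powr - \<delta>" using \<delta> elim(4) by (intro powr_mono) auto
        then show ?thesis using n by (simp add: powr_minus_divide)
      qed
      \<comment> \<open>\<open>Suc j\<close> counts one \<open>\<epsilon>\<close> for the
        factorization and one for each of the \<open>j\<close> ratios of \<open>n * q n d\<close> to
        \<open>w d\<close>.\<close>
      have 1: "\<bar>A n f - ?W n f\<bar> \<le> (exp (real (Suc j) * \<epsilon>) - 1) * ?W n f" if f: "f \<in> ?F n" and s: "separated (g n) f {..<j}" for f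
      proof -
        have m: "\<And>i. i \<in> {..<j} \<Longrightarrow> snd (f i) \<in> {1, 2}" using mark[OF f] by simp
        have up: "(\<Prod>i<j. q n (snd (f i))) \<le> (\<Prod>i<j. exp \<epsilon> * (w (snd (f i)) / real n))"
          by (intro prod_mono conjI q0 q1(2) m)
        have lo: "(\<Prod>i<j. exp (- \<epsilon>) * (w (snd (f i)) / real n)) \<le> (\<Prod>i<j. q n (snd (f i)))"
        proof (intro prod_mono conjI)
          fix i assume i: "i \<in> {..<j}"
          show "0 \<le> exp (- \<epsilon>) * (w (snd (f i)) / real n)" using q1(5)[OF m[OF i]] by simp
          show "exp (- \<epsilon>) * (w (snd (f i)) / real n) \<le> q n (snd (f i))" by (rule q1(1)[OF m[OF i]])
        qed
        have pe: "(\<Prod>i<j. exp y * (w (snd (f i)) / real n)) = exp (real j * y) * ?W n f" for y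
          by (simp only: prod.distrib prod_constant card_lessThan exp_of_nat_mult)
        have es: "exp y * (exp (real j * y) * ?W n f) = exp (real (Suc j) * y) * ?W n f" for y
        proof -
          have "y + real j * y = real (Suc j) * y" by (simp add: distrib_right)
          then show ?thesis unfolding mult.assoc[symmetric] exp_add[symmetric] by (simp only:)
        qed
        have "A n f \<le> exp \<epsilon> * (\<Prod>i<j. q n (snd (f i)))" using elim(2) f s by blast
        also have "\<dots> \<le> exp \<epsilon> * (exp (real j * \<epsilon>) * ?W n f)" using up unfolding pe by (intro mult_left_mono) auto
        also have "\<dots> = exp (real (Suc j) * \<epsilon>) * ?W n f" by (rule es)
        finally have U: "A n f \<le> exp (real (Suc j) * \<epsilon>) * ?W n f" .
        have "exp (- (real (Suc j) * \<epsilon>)) * ?W n f = exp (- \<epsilon>) * (exp (real j * - \<epsilon>) * ?W n f)"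
          unfolding es by simp
        also have "\<dots> \<le> exp (- \<epsilon>) * (\<Prod>i<j. q n (snd (f i)))" using lo unfolding pe by (intro mult_left_mono) auto
        also have "\<dots> \<le> A n f" using elim(2) f s by blast
        finally have Lo: "exp (- (real (Suc j) * \<epsilon>)) * ?W n f \<le> A n f" .
        let ?E = "exp (real (Suc j) * \<epsilon>)"
        have "1 - exp (- (real (Suc j) * \<epsilon>)) \<le> ?E - 1"
          using exp_ge_add_one_self[of "- (real (Suc j) * \<epsilon>)"] exp_ge_add_one_self[of "real (Suc j) * \<epsilon>"] by linarith
        from mult_right_mono[OF this W0[OF f]] U Lo show ?thesis
          by (simp only: left_diff_distrib mult_1)
      qed
      \<comment> \<open>The 3 is made of 2 from the cluster bound on \<open>A n f\<close> and 1 from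
        the product weight.\<close>
      have 2: "\<bar>A n f - ?W n f\<bar> \<le> 3 * c ^ j * (?I ^ card K * (real n powr - \<delta>) ^ (j - card K))"
        if f: "f \<in> ?F n" and s: "separated (g n) f K" and K: "K \<subseteq> {..<j}" for f K
      proof -
        have kj: "card K \<le> j" using card_mono[OF _ K] by simp
        have m: "\<And>i. i \<in> {..<j} \<Longrightarrow> snd (f i) \<in> {1, 2}" using mark[OF f] by simp
        let ?B = "?I ^ card K * (real n powr - \<delta>) ^ (j - card K)"
        have cK: "c ^ card K \<le> c ^ j" using c1 kj by (intro power_increasing)
        have "(\<Prod>i\<in>K. q n (snd (f i))) \<le> (\<Prod>i\<in>K. c * ?I)"
        proof (intro prod_mono conjI)
          fix i assume "i \<in> K"
          then have "i \<in> {..<j}" using K by blast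
          then show "q n (snd (f i)) \<le> c * ?I" by (rule q1(3)[OF m])
        qed (rule q0)
        also have "\<dots> = c ^ card K * ?I ^ card K" by (simp only: prod_constant power_mult_distrib)
        also have "\<dots> \<le> c ^ j * ?I ^ card K" using cK by (intro mult_right_mono) auto
        finally have "2 * ((\<Prod>i\<in>K. q n (snd (f i))) * (real n powr - \<delta>) ^ (j - card K)) \<le> 2 * ((c ^ j * ?I ^ card K) * (real n powr - \<delta>) ^ (j - card K))"
          by (intro mult_left_mono mult_right_mono) auto
        moreover have "A n f \<le> 2 * ((\<Prod>i\<in>K. q n (snd (f i))) * (real n powr - \<delta>) ^ (j - card K))"
          using elim(3) f s K by blast
        ultimately have a: "A n f \<le> 2 * (c ^ j * ?B)" by (simp add: mult.assoc)
        have "?W n f \<le> (\<Prod>i<j. c * ?I)"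
        proof (intro prod_mono conjI)
          fix i assume i: "i \<in> {..<j}"
          show "0 \<le> w (snd (f i)) / real n" using q1(5)[OF m[OF i]] by simp
          show "w (snd (f i)) / real n \<le> c * ?I" by (rule q1(4)[OF m[OF i]])
        qed
        also have "\<dots> = c ^ j * (?I ^ card K * ?I ^ (j - card K))"
          using kj by (simp only: prod_constant card_lessThan power_mult_distrib power_add[symmetric] le_add_diff_inverse)
        also have "\<dots> \<le> c ^ j * ?B"
          using nd c1 by (intro mult_left_mono power_mono) auto
        finally have "?W n f \<le> c ^ j * ?B" .
        with a A0[of n f] W0[OF f] show ?thesis by (simp only: mult.assoc)
      qed
      have cover: "?F n = {f\<in>?F n. separated (g n) f {..<j}} \<union> (\<Union>K\<in>{K. K \<subset> {..<j}}. anchored (g n) n j K)" (is "_ = ?S \<union> ?N")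
      proof (intro equalityI subsetI)
        fix f assume f: "f \<in> ?F n"
        obtain K where K: "K \<subseteq> {..<j}" "f \<in> anchored (g n) n j K" using ex_anchor[OF f] by blast
        then show "f \<in> ?S \<union> ?N"
          using f by (cases "K = {..<j}") (auto simp: anchored_def)
      qed (auto simp: anchored_def)
      have fS: "finite ?S" using fin[of n] by simp
      have fA: "finite (anchored (g n) n j K)" for K
        by (rule finite_subset[OF _ fin[of n]]) (auto simp: anchored_def)
      have fPs: "finite {K. K \<subset> {..<j}}" by (rule finite_subset[of _ "Pow {..<j}"]) auto
      have fN: "finite ?N" using fA fPs by (intro finite_UN_I)
      have "(\<Sum>f\<in>?F n. \<bar>A n f - ?W n f\<bar>) = (\<Sum>f\<in>?S \<union> ?N. \<bar>A n f - ?W n f\<bar>)" using cover by simp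
      also have "\<dots> \<le> (\<Sum>f\<in>?S. \<bar>A n f - ?W n f\<bar>) + (\<Sum>f\<in>?N. \<bar>A n f - ?W n f\<bar>)"
        using fS fN by (subst sum.union_inter[symmetric]) (auto intro: sum_nonneg)
      also have "(\<Sum>f\<in>?S. \<bar>A n f - ?W n f\<bar>) \<le> (exp (real (Suc j) * \<epsilon>) - 1) * (w 1 + w 2) ^ j"
      proof -
        have "(\<Sum>f\<in>?S. \<bar>A n f - ?W n f\<bar>) \<le> (\<Sum>f\<in>?S. (exp (real (Suc j) * \<epsilon>) - 1) * ?W n f)"
          using 1 by (intro sum_mono) auto
        also have "\<dots> \<le> (\<Sum>f\<in>?F n. (exp (real (Suc j) * \<epsilon>) - 1) * ?W n f)"
          using fin W0 \<epsilon> by (intro sum_mono2) auto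
        also have "\<dots> = (exp (real (Suc j) * \<epsilon>) - 1) * (w 1 + w 2) ^ j"
          using sum_prod_marked_weights[of n w j] elim(4) by (simp only: sum_distrib_left[symmetric] of_nat_0_less_iff)
        finally show ?thesis .
      qed
      also have "(\<Sum>f\<in>?N. \<bar>A n f - ?W n f\<bar>) \<le> (\<Sum>K\<in>{K. K \<subset> {..<j}}. \<Sum>f\<in>anchored (g n) n j K. \<bar>A n f - ?W n f\<bar>)"
        using fA fPs by (intro sum_UN_le) auto
      also have "\<dots> \<le> (\<Sum>K\<in>{K. K \<subset> {..<j}}. e n K)"
      proof (rule sum_mono)
        fix K assume "K \<in> {K. K \<subset> {..<j}}"
        then have K: "K \<subseteq> {..<j}" by auto
        have kj: "card K \<le> j" using card_mono[OF _ K] by simp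
        have "(\<Sum>f\<in>anchored (g n) n j K. \<bar>A n f - ?W n f\<bar>) \<le> (\<Sum>f\<in>anchored (g n) n j K. 3 * c ^ j * (?I ^ card K * (real n powr - \<delta>) ^ (j - card K)))"
          using 2 K by (intro sum_mono) (auto simp: anchored_def)
        also have "\<dots> = real (card (anchored (g n) n j K)) * (3 * c ^ j * (?I ^ card K * (real n powr - \<delta>) ^ (j - card K)))" by simp
        also have "\<dots> \<le> ((2 * real n) ^ card K * (real j * (2 * (2 * real n powr (\<delta> / 2) + 1))) ^ (j - card K)) * (3 * c ^ j * (?I ^ card K * (real n powr - \<delta>) ^ (j - card K)))"
        proof (rule mult_right_mono)
          have "real (card (anchored (g n) n j K)) \<le> real ((2 * n) ^ card K * (card K * (2 * (2 * g n + 1))) ^ (j - card K))"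
            using card_anchored[OF K] by (simp only: of_nat_le_iff)
          also have "\<dots> = (2 * real n) ^ card K * (real (card K) * (2 * (2 * real (g n) + 1))) ^ (j - card K)"
            by (simp only: of_nat_mult of_nat_power of_nat_add of_nat_numeral of_nat_1)
          also have "\<dots> \<le> (2 * real n) ^ card K * (real j * (2 * (2 * real n powr (\<delta> / 2) + 1))) ^ (j - card K)"
            using g[of n] kj by (intro mult_left_mono power_mono mult_mono) auto
          finally show "real (card (anchored (g n) n j K)) \<le> (2 * real n) ^ card K * (real j * (2 * (2 * real n powr (\<delta> / 2) + 1))) ^ (j - card K)" .
        qed (use c1 in auto)
        also have "\<dots> = 3 * c ^ j * ((2 * real n) ^ card K * ?I ^ card K) * ((real j * (2 * (2 * real n powr (\<delta> / 2) + 1))) ^ (j - card K) * (real n powr - \<delta>) ^ (j - card K))"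
          by (simp only: mult_ac)
        also have "\<dots> = 3 * c ^ j * (2 * real n * ?I) ^ card K * h n ^ (j - card K)"
          by (simp only: power_mult_distrib[symmetric] h_def)
        also have "\<dots> = e n K" using n by (simp add: e_def)
        finally show "(\<Sum>f\<in>anchored (g n) n j K. \<bar>A n f - ?W n f\<bar>) \<le> e n K" .
      qed
      finally show ?case by simp
    qed
  qed
  show ?thesis
  proof (rule LIMSEQ_I)
    fix r :: real assume r: "0 < r"
    have "((\<lambda>\<epsilon>. (exp (real (Suc j) * \<epsilon>) - 1) * (w 1 + w 2) ^ j) \<longlongrightarrow> (exp (real (Suc j) * 0) - 1) * (w 1 + w 2) ^ j) (at_right 0)"
      by (intro tendsto_intros)
    then have "\<forall>\<^sub>F \<epsilon> in at_right 0. (exp (real (Suc j) * \<epsilon>) - 1) * (w 1 + w 2) ^ j < r / 2"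
      using r by (intro order_tendstoD(2)) auto
    then have "\<forall>\<^sub>F \<epsilon> in at_right 0. 0 < \<epsilon> \<and> (exp (real (Suc j) * \<epsilon>) - 1) * (w 1 + w 2) ^ j < r / 2"
      using eventually_at_right_less[of 0] by eventually_elim simp
    then obtain \<epsilon> where \<epsilon>: "0 < \<epsilon>" "(exp (real (Suc j) * \<epsilon>) - 1) * (w 1 + w 2) ^ j < r / 2"
      using eventually_happens[of _ "at_right (0::real)"] trivial_limit_at_right_real by blast
    have "\<forall>\<^sub>F n in sequentially. (\<Sum>K\<in>{K. K \<subset> {..<j}}. e n K) < r / 2"
      using order_tendstoD(2)[OF elim_lim, of "r / 2"] r by simp
    with bound[OF \<epsilon>(1)] have "\<forall>\<^sub>F n in sequentially. norm ((\<Sum>f\<in>?F n. \<bar>A n f - ?W n f\<bar>) - 0) < r"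
    proof eventually_elim
      case (elim n)
      have "0 \<le> (\<Sum>f\<in>?F n. \<bar>A n f - ?W n f\<bar>)" by (intro sum_nonneg) simp
      then show ?case using elim \<epsilon>(2) by simp
    qed
    then show "\<exists>no. \<forall>n\<ge>no. norm ((\<Sum>f\<in>?F n. \<bar>A n f - ?W n f\<bar>) - 0) < r" by (simp add: eventually_sequentially)
  qed
qed

section \<open>Convergence of the exceedances\<close>

text \<open>The bound on \<open>x\<close> belongs to the region, so that for each frozen scale the
  section lies in the interval on which normal densities are compared.\<close>

definition exceedance_region :: "real \<Rightarrow> real \<Rightarrow> nat \<Rightarrow> (real \<times> real) set" where
  "exceedance_region v b d = {(s, x). v < xi d (s * x) \<and> \<bar>x\<bar> \<le> b}"

lemma exceedance_region_measurable: "exceedance_region v b d \<in> sets (borel \<Otimes>\<^sub>M borel)"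
proof -
  have "exceedance_region v b d = {p \<in> space (borel \<Otimes>\<^sub>M borel). v < xi d (fst p * snd p) \<and> \<bar>snd p\<bar> \<le> b}"
    by (auto simp: exceedance_region_def space_pair_measure)
  also have "\<dots> \<in> sets (borel \<Otimes>\<^sub>M borel)" unfolding xi_def by measurable
  finally show ?thesis .
qed

lemma exceedance_region_scale:
  assumes v: "0 < v" and b: "0 < b" and m: "(s, x) \<in> exceedance_region v b d" and s: "0 \<le> s"
  shows "v / b < s"
proof -
  have "v < \<bar>s * x\<bar>" "\<bar>x\<bar> \<le> b" using m by (auto simp: exceedance_region_def xi_def split: if_splits)
  then have "v < s * \<bar>x\<bar>" "s * \<bar>x\<bar> \<le> s * b" using s by (auto simp: abs_mult intro: mult_left_mono)
  then show ?thesis using b by (simp add: divide_less_eq)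
qed

text \<open>If \<open>m\<close> exceeds \<open>n powr \<gamma>\<close> then
  \<open>ln m \<ge> \<gamma> * ln n\<close>, so decay relative to \<open>ln m\<close> is decay
  relative to \<open>ln n\<close>: a separation by any small power of \<open>n\<close> is
  enough.\<close>

lemma sup_correlation_bound:
  assumes \<rho>: "(\<lambda>n. \<rho> n * ln (real n)) \<longlonglongrightarrow> 0" and \<gamma>: "0 < \<gamma>" and \<epsilon>: "0 < \<epsilon>"
  shows "\<forall>\<^sub>F n in sequentially. \<forall>m. real n powr \<gamma> < real m \<longrightarrow> \<bar>\<rho> m\<bar> \<le> \<epsilon> / ln (real n)"
proof -
  have "\<forall>\<^sub>F m in sequentially. \<bar>\<rho> m * ln (real m)\<bar> < \<epsilon> * \<gamma>"
    using tendstoD[OF \<rho>, of "\<epsilon> * \<gamma>"] \<epsilon> \<gamma> by (simp add: dist_real_def)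
  then obtain N where N: "\<And>m. N \<le> m \<Longrightarrow> \<bar>\<rho> m * ln (real m)\<bar> < \<epsilon> * \<gamma>" by (auto simp: eventually_sequentially)
  have "\<forall>\<^sub>F n in sequentially. real N < real n powr \<gamma>" using \<gamma> by real_asymp
  then show ?thesis using eventually_gt_at_top[of 1]
  proof eventually_elim
    case (elim n)
    show ?case
    proof (intro allI impI)
      fix m assume m: "real n powr \<gamma> < real m"
      have n1: "1 < real n" using elim by simp
      have ln: "0 < ln (real n)" using n1 by simp
      have "\<gamma> * ln (real n) = ln (real n powr \<gamma>)" using n1 by (simp add: ln_powr)
      also have "\<dots> \<le> ln (real m)" using m n1 by (intro ln_mono) auto
      finally have "\<bar>\<rho> m\<bar> * (\<gamma> * ln (real n)) \<le> \<bar>\<rho> m\<bar> * \<bar>ln (real m)\<bar>" by (intro mult_left_mono) auto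
      also have "\<dots> < \<epsilon> * \<gamma>" using N[of m] m elim by (simp add: abs_mult)
      finally have "\<gamma> * (\<bar>\<rho> m\<bar> * ln (real n)) < \<gamma> * \<epsilon>" by (simp add: mult_ac)
      then have "\<bar>\<rho> m\<bar> * ln (real n) < \<epsilon>" using \<gamma> by simp
      then show "\<bar>\<rho> m\<bar> \<le> \<epsilon> / ln (real n)" using ln by (simp add: pos_le_divide_eq)
    qed
  qed
qed

text \<open>A random subset of a fixed finite set takes finitely many values, each on an event, so
  every property \<open>P\<close> of it is an event. This settles the measurability of the
  exceedance process, in particular for vaguely open sets.\<close>

lemma finite_random_set_event:
  assumes fin: "finite I" and sub: "\<And>\<omega>. T \<omega> \<subseteq> I" and ev: "\<And>a. {\<omega>\<in>space M. a \<in> T \<omega>} \<in> sets M"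
  shows "{\<omega>\<in>space M. P (T \<omega>)} \<in> sets M"
proof -
  have "{\<omega>\<in>space M. P (T \<omega>)} = (\<Union>B\<in>{B \<in> Pow (I). P B}. {\<omega>\<in>space M. \<forall>a\<in>I. a \<in> T \<omega> \<longleftrightarrow> a \<in> B})"
  proof (intro set_eqI iffI)
    fix \<omega> assume "\<omega> \<in> {\<omega>\<in>space M. P (T \<omega>)}"
    then show "\<omega> \<in> (\<Union>B\<in>{B \<in> Pow (I). P B}. {\<omega>\<in>space M. \<forall>a\<in>I. a \<in> T \<omega> \<longleftrightarrow> a \<in> B})"
      using sub[of \<omega>] by (intro UN_I[of "T \<omega>"]) auto
  next
    fix \<omega> assume "\<omega> \<in> (\<Union>B\<in>{B \<in> Pow (I). P B}. {\<omega>\<in>space M. \<forall>a\<in>I. a \<in> T \<omega> \<longleftrightarrow> a \<in> B})"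
    then obtain B where B: "B \<subseteq> I" "P B" "\<omega> \<in> space M" "\<forall>a\<in>I. a \<in> T \<omega> \<longleftrightarrow> a \<in> B" by auto
    have "T \<omega> = B" using sub[of \<omega>] B(1,4) by blast
    then show "\<omega> \<in> {\<omega>\<in>space M. P (T \<omega>)}" using B by simp
  qed
  also have "\<dots> \<in> sets M"
  proof (intro sets.finite_UN sets.sets_Collect_finite_All)
    fix B a
    have "{\<omega>\<in>space M. a \<notin> T \<omega>} = space M - {\<omega>\<in>space M. a \<in> T \<omega>}" by auto
    then have "{\<omega>\<in>space M. a \<notin> T \<omega>} \<in> sets M" using ev[of a] by simp
    then show "{\<omega>\<in>space M. a \<in> T \<omega> \<longleftrightarrow> a \<in> B} \<in> sets M"
      using ev[of a] by (cases "a \<in> B") simp_all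
  qed (use fin in simp_all)
  finally show ?thesis .
qed

theorem theorem2p1:
  fixes M :: "'a measure"
    and Xs Ss :: "nat \<Rightarrow> 'a \<Rightarrow> real" and X S :: "'a \<Rightarrow> real"
    and \<rho> :: "nat \<Rightarrow> real" and F g :: "real \<Rightarrow> real" and L p \<alpha> :: real
    and u :: "nat \<Rightarrow> real \<Rightarrow> real" and x :: "nat \<Rightarrow> real"
  assumes "prob_space M"
    and "standard_stationary_gaussian M Xs \<rho>"
    and "(\<lambda>n. \<rho> n * ln (real n)) \<longlonglongrightarrow> 0"
    and "distributed M lborel X std_normal_density"
    and "prob_space.indep_vars M (\<lambda>_. borel) (\<lambda>n. if n = 0 then S else Ss n) UNIV"
    and "AE \<omega> in M. 0 \<le> S \<omega>"
    and "\<forall>n\<ge>1. AE \<omega> in M. 0 \<le> Ss n \<omega>"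
    and "cdf (distr M borel S) = F"
    and "\<forall>n\<ge>1. cdf (distr M borel (Ss n)) = F"
    and "prob_space.indep_var M
           (PiM UNIV (\<lambda>_. borel)) (\<lambda>\<omega> n. if n = 0 then S \<omega> else Ss n \<omega>)
           (PiM {1..} (\<lambda>_. borel)) (\<lambda>\<omega>. \<lambda>n\<in>{1..}. Xs n \<omega>)"
    and "prob_space.indep_var M
           (PiM UNIV (\<lambda>_. borel)) (\<lambda>\<omega> n. if n = 0 then S \<omega> else Ss n \<omega>)
           (PiM {0} (\<lambda>_. borel)) (\<lambda>\<omega>. \<lambda>n\<in>{0}. X \<omega>)"
    and "L > 0" and "p > 0"
    and "ultimately_monotone g"
    and "regularly_varying g \<alpha>"
    and "(\<lambda>t. measure M {\<omega>\<in>space M. S \<omega> > t}) \<sim>[at_top] (\<lambda>t. g t * exp (- L * t powr p))"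
    and "\<forall>z. (\<lambda>n. real n * measure M {\<omega>\<in>space M. S \<omega> * X \<omega> > u n z}) \<longlonglongrightarrow> exp (- z)"
  shows "\<exists>(Q :: (real \<times> nat) measure measure) N.
           prob_space Q \<and> poisson_process Q bivariate_space (intensity x) N \<and>
           converges_in_distribution (vague_topology bivariate_space)
             M (\<lambda>n \<omega>. exceedances u x (\<lambda>i. Ss i \<omega> * Xs i \<omega>) n) Q N"
proof -
  note M = assms(1) and G = assms(2) and rho = assms(3) and X = assms(4) and indS = assms(5)
    and indSX = assms(10) and indX = assms(11) and level = assms(17)
  interpret prob_space M by (rule M)
  interpret N: prob_space std_normal_distribution by (rule prob_std_normal)
  have Xm: "X \<in> borel_measurable M" using distributed_measurable[OF X] by simp
  have SSm: "(if n = 0 then S else Ss n) \<in> borel_measurable M" for n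
    using indS unfolding indep_vars_def by blast
  have Sm: "S \<in> borel_measurable M" using SSm[of 0] by simp
  have Ssm: "Ss n \<in> borel_measurable M" if "1 \<le> n" for n using SSm[of n] that by simp
  have Xsd: "distributed M lborel (Xs n) std_normal_density" if "1 \<le> n" for n
    using G that by (auto simp: standard_stationary_gaussian_def)
  have Xsm: "Xs n \<in> borel_measurable M" if "1 \<le> n" for n
    using distributed_measurable[OF Xsd[OF that]] by simp
  have law: "distr M borel (Ss n) = distr M borel S" if "1 \<le> n" for n
    using assms(8,9) that Sm Ssm by (intro cdf_unique real_distribution_distr) auto
  have Ss0: "AE \<omega> in M. 0 \<le> Ss n \<omega>" if "1 \<le> n" for n using assms(7) that by auto
  note facts0 = M G X indS Ss0 law indSX indX

  define b where "b n = 2 * sqrt (ln (real n))" for n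
  define C where "C n d = exceedance_region (u n (x d)) (b n) d" for n d
  define q where "q n d = prob {\<omega>\<in>space M. (S \<omega>, X \<omega>) \<in> C n d}" for n d
  \<comment> \<open>\<open>R\<close> is the truncated exceedance set, to which the conditioning
    applies; \<open>R'\<close> is the one that defines the point process. They differ only if some
    \<open>\<bar>Xs i \<omega>\<bar>\<close> with \<open>i \<le> n\<close> exceeds
    \<open>b n\<close>.\<close>
  define R where "R n \<omega> = {a \<in> marked_indices n. (Ss (fst a) \<omega>, Xs (fst a) \<omega>) \<in> C n (snd a)}" for n \<omega>
  define R' where "R' n \<omega> = {(i, d) \<in> {1..n} \<times> {1, 2}. xi d (Ss i \<omega> * Xs i \<omega>) > u n (x d)}" for n \<omega>
  have Cm: "C n d \<in> sets (borel \<Otimes>\<^sub>M borel)" for n d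
    unfolding C_def by (rule exceedance_region_measurable)

  have normal_event: "prob {\<omega>\<in>space M. Z \<omega> \<in> A} = measure std_normal_distribution A"
    if "distributed M lborel Z std_normal_density" "A \<in> sets borel" for Z A
  proof -
    have Zm: "Z \<in> M \<rightarrow>\<^sub>M lborel" using distributed_measurable[OF that(1)] .
    have "measure (distr M lborel Z) A = prob (Z -` A \<inter> space M)"
      using Zm that(2) by (intro measure_distr) auto
    moreover have "distr M lborel Z = std_normal_distribution" using that(1) by (simp add: distributed_def)
    ultimately show ?thesis by (simp add: vimage_def Int_def conj_commute)
  qed
  have SX: "emeasure M {\<omega>\<in>space M. (S \<omega>, X \<omega>) \<in> D} = (\<integral>\<^sup>+\<omega>. emeasure std_normal_distribution {z. (S \<omega>, z) \<in> D} \<partial>M)"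
    if "D \<in> sets (borel \<Otimes>\<^sub>M borel)" for D
    by (rule SX_conditioning[OF facts0 that])

  obtain \<delta>' where \<delta>': "0 < \<delta>'" and lev: "\<And>v \<kappa>. (\<lambda>n. real n * prob {\<omega>\<in>space M. v n < S \<omega> * X \<omega>}) \<longlonglongrightarrow> \<kappa> \<Longrightarrow>
    \<forall>\<^sub>F n in sequentially. 0 < v n \<and> prob {\<omega>\<in>space M. v n / b n < S \<omega>} \<le> real n powr - \<delta>'"
  proof -
    have ev[measurable]: "{\<omega>\<in>space M. t < S \<omega>} \<in> events" "{\<omega>\<in>space M. t < S \<omega> * X \<omega>} \<in> events" for t
      using Sm Xm by measurable
    have "\<exists>\<delta>>0. \<forall>v \<kappa>. (\<lambda>n. real n * prob {\<omega>\<in>space M. v n < S \<omega> * X \<omega>}) \<longlonglongrightarrow> \<kappa> \<longrightarrow>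
      (\<forall>\<^sub>F n in sequentially. 0 < v n \<and> prob {\<omega>\<in>space M. v n / (2 * sqrt (ln (real n))) < S \<omega>} \<le> real n powr - \<delta>)"
    proof (rule exceedance_level[OF \<open>L > 0\<close> \<open>p > 0\<close>, where T = "\<lambda>t. prob {\<omega>\<in>space M. t < S \<omega>}" and G = "\<lambda>t. prob {\<omega>\<in>space M. t < S \<omega> * X \<omega>}"])
      show "antimono (\<lambda>t. prob {\<omega>\<in>space M. t < S \<omega>})" "antimono (\<lambda>t. prob {\<omega>\<in>space M. t < S \<omega> * X \<omega>})"
        using ev by (auto intro!: antimonoI finite_measure_mono)
      show "\<forall>\<^sub>F t in at_top. exp (- (2 * L * t powr p)) \<le> prob {\<omega>\<in>space M. t < S \<omega>} \<and> prob {\<omega>\<in>space M. t < S \<omega>} \<le> exp (- (L / 2 * t powr p))"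
        by (rule weibull_tail_bounds[OF assms(12-15) _ assms(16)]) simp
      \<comment> \<open>\<open>S > s\<close> and \<open>X > v / s\<close> together force
        \<open>S * X > v\<close>; freezing \<open>S\<close> gives the probability of the smaller
        event its product form.\<close>
      fix s v :: real assume s: "0 < s" and v: "0 \<le> v"
      let ?D = "{s<..} \<times> {v / s<..}"
      have D: "?D \<in> sets (borel \<Otimes>\<^sub>M borel)" by (intro pair_measureI) auto
      have "ennreal (prob {\<omega>\<in>space M. s < S \<omega>} * measure std_normal_distribution {v / s<..}) =
        (\<integral>\<^sup>+\<omega>. emeasure std_normal_distribution {v / s<..} * indicator {\<omega>\<in>space M. s < S \<omega>} \<omega> \<partial>M)"
        by (subst nn_integral_cmult_indicator[OF ev(1)])
          (simp add: emeasure_eq_measure N.emeasure_eq_measure ennreal_mult[symmetric] mult.commute)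
      also have "\<dots> = (\<integral>\<^sup>+\<omega>. emeasure std_normal_distribution {z. (S \<omega>, z) \<in> ?D} \<partial>M)"
        by (intro nn_integral_cong) (auto simp: indicator_def greaterThan_def)
      also have "\<dots> = emeasure M {\<omega>\<in>space M. (S \<omega>, X \<omega>) \<in> ?D}" by (rule SX[OF D, symmetric])
      also have "\<dots> \<le> emeasure M {\<omega>\<in>space M. v < S \<omega> * X \<omega>}"
      proof (rule emeasure_mono[OF _ ev(2)], rule subsetI)
        fix \<omega> assume \<omega>: "\<omega> \<in> {\<omega>\<in>space M. (S \<omega>, X \<omega>) \<in> ?D}"
        then have a: "s < S \<omega>" "v / s < X \<omega>" by auto
        have "v = s * (v / s)" using s by simp
        also have "\<dots> < s * X \<omega>" using a s by (intro mult_strict_left_mono) auto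
        also have "\<dots> \<le> S \<omega> * X \<omega>"
        proof (rule mult_right_mono)
          have "0 \<le> v / s" using s v by simp
          then show "0 \<le> X \<omega>" using a by linarith
        qed (use a in simp)
        finally show "\<omega> \<in> {\<omega>\<in>space M. v < S \<omega> * X \<omega>}" using \<omega> by simp
      qed
      finally show "prob {\<omega>\<in>space M. s < S \<omega>} * measure std_normal_distribution {v / s<..} \<le> prob {\<omega>\<in>space M. v < S \<omega> * X \<omega>}"
        by (simp add: emeasure_eq_measure)
    qed
    then show ?thesis using that unfolding b_def by blast
  qed
  \<comment> \<open>\<open>tuple_probabilities_factorize\<close> requires an exponent of at most 1;
    the cap only weakens the tail bound.\<close>
  define \<delta> where "\<delta> = min \<delta>' 1"
  have \<delta>: "0 < \<delta>" "\<delta> \<le> 1" using \<delta>' by (auto simp: \<delta>_def)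
  have lev\<delta>: "\<forall>\<^sub>F n in sequentially. \<forall>d\<in>{1, 2}. 0 < u n (x d) \<and> prob {\<omega>\<in>space M. u n (x d) / b n < S \<omega>} \<le> real n powr - \<delta>"
  proof (rule eventually_ball_finite)
    show "\<forall>d\<in>{1, 2}. \<forall>\<^sub>F n in sequentially. 0 < u n (x d) \<and> prob {\<omega>\<in>space M. u n (x d) / b n < S \<omega>} \<le> real n powr - \<delta>"
    proof
      fix d
      have "\<forall>\<^sub>F n in sequentially. 0 < u n (x d) \<and> prob {\<omega>\<in>space M. u n (x d) / b n < S \<omega>} \<le> real n powr - \<delta>'"
        by (rule lev[of "\<lambda>n. u n (x d)" "exp (- x d)"]) (rule level[rule_format])
      then show "\<forall>\<^sub>F n in sequentially. 0 < u n (x d) \<and> prob {\<omega>\<in>space M. u n (x d) / b n < S \<omega>} \<le> real n powr - \<delta>"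
        using eventually_gt_at_top[of 1]
      proof eventually_elim
        case (elim n)
        have "real n powr - \<delta>' \<le> real n powr - \<delta>" using elim by (intro powr_mono) (auto simp: \<delta>_def)
        then show ?case using elim by linarith
      qed
    qed
  qed simp

  \<comment> \<open>For \<open>b n = 2 * sqrt (ln n)\<close> the bound
    \<open>exp (- y\<^sup>2 / 2)\<close> at \<open>y = b n\<close> is \<open>n\<close> to the power
    -2, which beats the union over \<open>n\<close> indices.\<close>
  have big: "real n * measure std_normal_distribution {z. b n < \<bar>z\<bar>} \<le> 2 / real n" if "1 \<le> n" for n
  proof -
    have "0 \<le> b n" using that by (simp add: b_def)
    from std_normal_tail_upper[OF this]
    have "measure std_normal_distribution {z. b n < \<bar>z\<bar>} \<le> 2 * exp (- (2 * ln (real n)))"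
      using that by (simp add: b_def power_mult_distrib)
    also have "exp (- (2 * ln (real n))) = 1 / (real n * real n)"
      using that by (simp add: exp_minus exp_double power2_eq_square field_simps)
    finally show ?thesis using that by (simp add: field_simps)
  qed

  have q_lim: "(\<lambda>n. real n * q n d) \<longlonglongrightarrow> exp (- x d)" if d: "d \<in> {1, 2}" for d
  proof -
    let ?Y = "\<lambda>n. {\<omega>\<in>space M. u n (x d) < S \<omega> * X \<omega>}"
    let ?D = "\<lambda>n. exceedance_region (u n (x d)) (b n) 1"
    have q1: "q n d = prob {\<omega>\<in>space M. (S \<omega>, X \<omega>) \<in> ?D n}" for n
    proof (cases "d = 1")
      case True then show ?thesis by (simp add: q_def C_def)
    next
      case False
      \<comment> \<open>The standard normal law is symmetric and can be reflected with the scale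
        frozen, so a negative exceedance has the probability of a positive one. The hypothesis on
        upper tails of \<open>S * X\<close> thus serves both marks.\<close>
      have refl_std: "emeasure std_normal_distribution {z. - z \<in> A} = emeasure std_normal_distribution A" if A: "A \<in> sets borel" for A
      proof -
        have A': "{z. - z \<in> A} \<in> sets borel"
          using measurable_sets[of uminus borel borel A] A by (simp add: vimage_def)
        have "emeasure std_normal_distribution A = (\<integral>\<^sup>+z. ennreal (std_normal_density z) * indicator A z \<partial>lborel)"
          using A by (subst emeasure_density) auto
        also have "\<dots> = (\<integral>\<^sup>+z. ennreal (std_normal_density (0 + - 1 * z)) * indicator A (0 + - 1 * z) \<partial>lborel)"
          using A nn_integral_real_affine[of "\<lambda>z. ennreal (std_normal_density z) * indicator A z" "- 1" 0] by simp
        also have "\<dots> = (\<integral>\<^sup>+z. ennreal (std_normal_density z) * indicator {z. - z \<in> A} z \<partial>lborel)"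
          by (intro nn_integral_cong) (auto simp: std_normal_density_def indicator_def)
        also have "\<dots> = emeasure std_normal_distribution {z. - z \<in> A}"
          using A' by (subst emeasure_density) auto
        finally show ?thesis by simp
      qed
      have "ennreal (q n d) = (\<integral>\<^sup>+\<omega>. emeasure std_normal_distribution {z. (S \<omega>, z) \<in> C n d} \<partial>M)"
        unfolding q_def emeasure_eq_measure[symmetric] by (rule SX[OF Cm])
      also have "\<dots> = (\<integral>\<^sup>+\<omega>. emeasure std_normal_distribution {z. (S \<omega>, z) \<in> ?D n} \<partial>M)"
      proof (rule nn_integral_cong)
        fix \<omega>
        have "{z. (S \<omega>, z) \<in> C n d} = {z. - z \<in> {z. (S \<omega>, z) \<in> ?D n}}"
          using False by (auto simp: C_def exceedance_region_def xi_def)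
        moreover have "{z. (S \<omega>, z) \<in> ?D n} \<in> sets borel"
          by (rule section_measurable(1)[OF facts0 exceedance_region_measurable])
        ultimately show "emeasure std_normal_distribution {z. (S \<omega>, z) \<in> C n d} = emeasure std_normal_distribution {z. (S \<omega>, z) \<in> ?D n}"
          by (simp only: refl_std)
      qed
      also have "\<dots> = ennreal (prob {\<omega>\<in>space M. (S \<omega>, X \<omega>) \<in> ?D n})"
        unfolding emeasure_eq_measure[symmetric] by (rule SX[OF exceedance_region_measurable, symmetric])
      finally show ?thesis by (simp add: q_def)
    qed
    have Ym: "?Y n \<in> events" for n using Sm Xm by measurable
    have Dm: "{\<omega>\<in>space M. (S \<omega>, X \<omega>) \<in> ?D n} \<in> events" for n
      using Sm Xm unfolding exceedance_region_def xi_def by measurable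
    have Bm: "{\<omega>\<in>space M. X \<omega> \<in> {z. b n < \<bar>z\<bar>}} \<in> events" for n using Xm by measurable
    have bs: "{z. b n < \<bar>z\<bar>} \<in> sets borel" for n by measurable
    have diff: "\<bar>real n * q n d - real n * prob (?Y n)\<bar> \<le> 2 / real n" if n: "1 \<le> n" for n
    proof -
      have "prob {\<omega>\<in>space M. (S \<omega>, X \<omega>) \<in> ?D n} \<le> prob (?Y n)"
        by (intro finite_measure_mono Ym) (auto simp: exceedance_region_def xi_def)
      moreover have "prob (?Y n) \<le> prob ({\<omega>\<in>space M. (S \<omega>, X \<omega>) \<in> ?D n} \<union> {\<omega>\<in>space M. X \<omega> \<in> {z. b n < \<bar>z\<bar>}})"
        using Dm Bm by (intro finite_measure_mono) (auto simp: exceedance_region_def xi_def)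
      moreover have "\<dots> \<le> prob {\<omega>\<in>space M. (S \<omega>, X \<omega>) \<in> ?D n} + prob {\<omega>\<in>space M. X \<omega> \<in> {z. b n < \<bar>z\<bar>}}"
        using Dm Bm by (rule measure_Un_le)
      ultimately have "\<bar>q n d - prob (?Y n)\<bar> \<le> measure std_normal_distribution {z. b n < \<bar>z\<bar>}"
        unfolding q1 normal_event[OF X bs] by linarith
      then have "real n * \<bar>q n d - prob (?Y n)\<bar> \<le> real n * measure std_normal_distribution {z. b n < \<bar>z\<bar>}"
        by (rule mult_left_mono) simp
      also note big[OF n]
      finally show ?thesis by (simp add: right_diff_distrib[symmetric] abs_mult)
    qed
    have "(\<lambda>n. real n * q n d - real n * prob (?Y n)) \<longlonglongrightarrow> 0"
    proof (rule Lim_null_comparison)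
      show "\<forall>\<^sub>F n in sequentially. norm (real n * q n d - real n * prob (?Y n)) \<le> 2 / real n"
        using eventually_ge_at_top[of 1] by eventually_elim (use diff in simp)
      show "(\<lambda>n. 2 / real n) \<longlonglongrightarrow> 0" by (rule lim_const_over_n)
    qed
    from tendsto_add[OF this level[rule_format, of "x d"]] show ?thesis by simp
  qed

  have Rm: "{\<omega>\<in>space M. a \<in> R n \<omega>} \<in> events" for n a
  proof (cases "a \<in> marked_indices n")
    case True
    then have a: "1 \<le> fst a" by (auto simp: marked_indices_def)
    have "(\<lambda>\<omega>. (Ss (fst a) \<omega>, Xs (fst a) \<omega>)) \<in> M \<rightarrow>\<^sub>M borel \<Otimes>\<^sub>M borel"
      using Ssm[OF a] Xsm[OF a] by (rule measurable_Pair)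
    from measurable_sets[OF this Cm[of n "snd a"]] show ?thesis
      using True by (simp add: R_def vimage_def Int_def conj_commute)
  next
    case False then show ?thesis by (simp add: R_def)
  qed

  \<comment> \<open>The floor loses nothing: an integer distance above \<open>gap n\<close> is above
    \<open>n powr (\<delta> / 2)\<close> itself, as \<open>sup_correlation_bound\<close>
    demands.\<close>
  define gap where "gap n = nat \<lfloor>real n powr (\<delta> / 2)\<rfloor>" for n
  have gap: "real (gap n) \<le> real n powr (\<delta> / 2)" for n
    unfolding gap_def by (simp add: of_nat_nat)

  \<comment> \<open>Zero on tuples with a repeated entry, since factorial moments run over distinct
    marked indices. Such tuples are never separated, so for nonzero \<open>j\<close> they fall under
    the cluster bound.\<close>
  define A where "A j n f = (if inj_on f {..<j} then prob {\<omega>\<in>space M. f ` {..<j} \<subseteq> R n \<omega>} else 0)"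
    for j :: nat and n and f :: "nat \<Rightarrow> nat \<times> nat"

  have rect: "{\<omega>\<in>space M. f ` {..<j} \<subseteq> R n \<omega>} = {\<omega>\<in>space M. \<forall>i\<in>{..<j}. (Ss (fst (f i)) \<omega>, Xs (fst (f i)) \<omega>) \<in> C n (snd (f i))}"
    if "f \<in> {..<j} \<rightarrow>\<^sub>E marked_indices n" for f and j n :: nat
    using PiE_mem[OF that] by (auto simp: R_def)

  have corr: "\<forall>\<^sub>F n in sequentially. \<forall>K f. separated (gap n) f K \<longrightarrow>
      (\<forall>i\<in>K. \<forall>l\<in>K. i \<noteq> l \<longrightarrow> \<bar>correlation \<rho> (fst (f i)) (fst (f l))\<bar> \<le> \<epsilon> / ln (real n))" if "0 < \<epsilon>" for \<epsilon>
    using sup_correlation_bound[OF rho _ that, of "\<delta> / 2"] \<delta>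
  proof (simp, elim eventually_mono, intro allI impI ballI)
    fix n K f i l
    assume *: "\<forall>m. real n powr (\<delta> / 2) < real m \<longrightarrow> \<bar>\<rho> m\<bar> \<le> \<epsilon> / ln (real n)"
      and s: "separated (gap n) f K" and il: "i \<in> K" "l \<in> K" "i \<noteq> l"
    let ?a = "fst (f i)" and ?c = "fst (f l)"
    have far: "int (gap n) < \<bar>int ?a - int ?c\<bar>" using s il by (auto simp: separated_def)
    have lt: "real n powr (\<delta> / 2) < real m" if "int (gap n) < int m" for m
      using that unfolding gap_def by linarith
    consider "?a < ?c" | "?c < ?a" using far by fastforce
    then show "\<bar>correlation \<rho> ?a ?c\<bar> \<le> \<epsilon> / ln (real n)"
    proof cases
      case 1
      then have "int (gap n) < int (?c - ?a)" using far by linarith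
      from *[rule_format, OF lt[OF this]] 1 show ?thesis by (simp add: correlation_def)
    next
      case 2
      then have "int (gap n) < int (?a - ?c)" using far by linarith
      from *[rule_format, OF lt[OF this]] 2 show ?thesis by (simp add: correlation_def)
    qed
  qed

  have large: "\<forall>\<^sub>F n in sequentially. 1 \<le> b n \<and> 0 < ln (real n)"
  proof -
    have "\<forall>\<^sub>F n in sequentially. 1 < ln (real n)" by real_asymp
    then show ?thesis
    proof eventually_elim
      case (elim n)
      then have "1 \<le> sqrt (ln (real n))" by simp
      then have "1 \<le> b n" unfolding b_def by linarith
      then show ?case using elim by linarith
    qed
  qed
  have bsq: "(b n)\<^sup>2 = 4 * ln (real n)" if "0 < ln (real n)" for n
    using that by (simp add: b_def power_mult_distrib)

  have star: "(\<lambda>n. \<Sum>f\<in>{..<j} \<rightarrow>\<^sub>E marked_indices n. \<bar>A j n f - (\<Prod>i<j. exp (- x (snd (f i))) / real n)\<bar>) \<longlonglongrightarrow> 0" for j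
  proof (rule tuple_probabilities_factorize[where q = q and \<delta> = \<delta> and g = gap])
    \<comment> \<open>One statement for both needs: \<open>K = {..<j}\<close> gives the two-sided
      estimate for separated tuples, a proper subset \<open>K\<close> the cluster bound.\<close>
    have key: "\<forall>\<^sub>F n in sequentially. \<forall>f\<in>{..<j} \<rightarrow>\<^sub>E marked_indices n. \<forall>K\<subseteq>{..<j}. separated (gap n) f K \<longrightarrow>
        A j n f \<le> exp \<epsilon> * ((\<Prod>i\<in>K. q n (snd (f i))) * (real n powr - \<delta>) ^ (j - card K)) \<and>
        (K = {..<j} \<longrightarrow> exp (- \<epsilon>) * (\<Prod>i<j. q n (snd (f i))) \<le> A j n f)" if \<epsilon>: "0 < \<epsilon>" for \<epsilon>
    proof -
      \<comment> \<open>As \<open>(b n)\<^sup>2 = 4 * ln n\<close> cancels the logarithm in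
        \<open>\<epsilon>' / ln n\<close>, the exponent of the comparison is
        \<open>16 * 4 ^ card K * \<epsilon>'\<close>; this choice keeps it below
        \<open>\<epsilon>\<close> for every \<open>K\<close>.\<close>
      define \<epsilon>' where "\<epsilon>' = \<epsilon> / (16 * 4 ^ j)"
      have \<epsilon>': "0 < \<epsilon>'" "16 * 4 ^ j * \<epsilon>' = \<epsilon>" using \<epsilon> by (auto simp: \<epsilon>'_def)
      have "\<forall>\<^sub>F n in sequentially. 3 ^ j * (\<epsilon>' / ln (real n)) \<le> 1/4"
      proof -
        have "(\<lambda>n. 3 ^ j * (\<epsilon>' / ln (real n))) \<longlonglongrightarrow> 0" by real_asymp
        from order_tendstoD(2)[OF this, of "1/4"] show ?thesis by (auto elim: eventually_mono)
      qed
      then show ?thesis using corr[OF \<epsilon>'(1)] large lev\<delta>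
      proof eventually_elim
        case (elim n)
        let ?\<eta> = "\<epsilon>' / ln (real n)"
        have \<eta>0: "0 \<le> ?\<eta>" using elim(3) \<epsilon>' by simp
        have b1: "1 \<le> b n" using elim(3) by simp
        show ?case
        proof (intro ballI allI impI)
          fix f K assume f: "f \<in> {..<j} \<rightarrow>\<^sub>E marked_indices n" and K: "K \<subseteq> {..<j}" and s: "separated (gap n) f K"
          have fK: "finite K" using K finite_subset by blast
          have kj: "card K \<le> j" using card_mono[OF _ K] by simp
          have mark: "1 \<le> fst (f i)" "snd (f i) \<in> {1, 2}" if "i \<in> {..<j}" for i
            using PiE_mem[OF f that] by (auto simp: marked_indices_def)
          have c: "\<bar>correlation \<rho> (fst (f i)) (fst (f l))\<bar> \<le> ?\<eta>" if "i \<in> K" "l \<in> K" "i \<noteq> l" for i l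
            using elim(2) s that by blast
          have "(3::real) ^ card K \<le> 3 ^ j" using kj by (intro power_increasing) auto
          then have \<eta>1: "3 ^ card K * ?\<eta> \<le> 1/4" using mult_right_mono[OF _ \<eta>0] elim(1) by (meson order_trans)
          have expo: "4 * 4 ^ card K * ?\<eta> * (b n)\<^sup>2 \<le> \<epsilon>"
          proof -
            have "4 * 4 ^ card K * ?\<eta> * (b n)\<^sup>2 = 16 * 4 ^ card K * \<epsilon>'" using elim(3) by (simp add: bsq)
            also have "\<dots> \<le> 16 * 4 ^ j * \<epsilon>'"
              using kj \<epsilon>' by (intro mult_right_mono mult_left_mono power_increasing) auto
            finally show ?thesis using \<epsilon>' by simp
          qed
          have qK: "0 \<le> (\<Prod>i\<in>K. q n (snd (f i)))" by (intro prod_nonneg) (simp add: q_def)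
          have Cb: "\<bar>z\<bar> \<le> b n" if "(t, z) \<in> C n d" for t z d using that by (auto simp: C_def exceedance_region_def)
          have up: "A j n f \<le> exp \<epsilon> * ((\<Prod>i\<in>K. q n (snd (f i))) * (real n powr - \<delta>) ^ (j - card K))"
          \<comment> \<open>Distinct times are needed for the scales to be independent; they fail
            for an injective tuple that carries both marks at one time.\<close>
          proof (cases "inj_on f {..<j} \<and> inj_on (\<lambda>i. fst (f i)) {..<j}")
            case True
            have "prob {\<omega>\<in>space M. \<forall>i\<in>{..<j}. (Ss (fst (f i)) \<omega>, Xs (fst (f i)) \<omega>) \<in> C n (snd (f i))} \<le>
                exp (4 * 4 ^ card K * ?\<eta> * (b n)\<^sup>2) * ((\<Prod>i\<in>K. prob {\<omega>\<in>space M. (S \<omega>, X \<omega>) \<in> C n (snd (f i))}) *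
                (\<Prod>i\<in>{..<j} - K. prob {\<omega>\<in>space M. u n (x (snd (f i))) / b n < S \<omega>}))"
            proof (rule joint_upper[OF facts0, where k = "\<lambda>i. fst (f i)" and J = "{..<j}"])
              fix i t z assume i: "i \<in> {..<j}" and m: "(t, z) \<in> C n (snd (f i))"
              show "\<bar>z\<bar> \<le> b n" by (rule Cb[OF m])
              assume "0 \<le> t"
              moreover have "0 < u n (x (snd (f i)))" using elim(4) mark(2)[OF i] by blast
              ultimately show "u n (x (snd (f i))) / b n < t"
                using m b1 exceedance_region_scale[of "u n (x (snd (f i)))" "b n" t z "snd (f i)"] by (simp add: C_def)
            qed (use True mark Cm K c \<eta>0 \<eta>1 b1 in auto)
            also have "\<dots> \<le> exp \<epsilon> * ((\<Prod>i\<in>K. q n (snd (f i))) * (real n powr - \<delta>) ^ (j - card K))"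
            proof (intro mult_mono)
              have "(\<Prod>i\<in>{..<j} - K. prob {\<omega>\<in>space M. u n (x (snd (f i))) / b n < S \<omega>}) \<le> (\<Prod>i\<in>{..<j} - K. real n powr - \<delta>)"
              proof (intro prod_mono conjI)
                fix i assume "i \<in> {..<j} - K"
                then have "snd (f i) \<in> {1, 2}" using mark by blast
                then show "prob {\<omega>\<in>space M. u n (x (snd (f i))) / b n < S \<omega>} \<le> real n powr - \<delta>" using elim(4) by blast
              qed simp
              also have "\<dots> = (real n powr - \<delta>) ^ (j - card K)" using K fK by (simp add: card_Diff_subset)
              finally show "(\<Prod>i\<in>{..<j} - K. prob {\<omega>\<in>space M. u n (x (snd (f i))) / b n < S \<omega>}) \<le> (real n powr - \<delta>) ^ (j - card K)" .
              show "(\<Prod>i\<in>K. prob {\<omega>\<in>space M. (S \<omega>, X \<omega>) \<in> C n (snd (f i))}) \<le> (\<Prod>i\<in>K. q n (snd (f i)))" by (simp add: q_def)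
              show "exp (4 * 4 ^ card K * ?\<eta> * (b n)\<^sup>2) \<le> exp \<epsilon>" using expo by (subst exp_le_cancel_iff)
            qed (intro mult_nonneg_nonneg prod_nonneg exp_ge_zero measure_nonneg qK)+
            finally show ?thesis using True by (simp add: A_def rect[OF f])
          next
            case False
            \<comment> \<open>At one time the two marks exclude each other: both levels are
              positive, and \<open>s * x\<close> and \<open>- (s * x)\<close> cannot both exceed
              positive numbers.\<close>
            have "A j n f = 0"
            proof (cases "inj_on f {..<j}")
              case True
              with False obtain i l where il: "i < j" "l < j" "i \<noteq> l" "fst (f i) = fst (f l)" by (auto simp: inj_on_def)
              have "f i \<noteq> f l" using True il by (auto simp: inj_on_def)
              then have ne: "snd (f i) \<noteq> snd (f l)" using il by (simp add: prod_eq_iff)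
              have pos: "0 < u n (x 1)" "0 < u n (x 2)" using elim(4) by auto
              have disj: "\<not> (y \<in> C n (snd (f i)) \<and> y \<in> C n (snd (f l)))" for y
                using ne pos mark(2)[of i] mark(2)[of l] il by (auto simp: C_def exceedance_region_def xi_def)
              have "{\<omega>\<in>space M. f ` {..<j} \<subseteq> R n \<omega>} = {}"
              proof -
                have "\<not> (\<forall>k\<in>{..<j}. (Ss (fst (f k)) \<omega>, Xs (fst (f k)) \<omega>) \<in> C n (snd (f k)))" for \<omega>
                proof
                  assume a: "\<forall>k\<in>{..<j}. (Ss (fst (f k)) \<omega>, Xs (fst (f k)) \<omega>) \<in> C n (snd (f k))"
                  have "(Ss (fst (f l)) \<omega>, Xs (fst (f l)) \<omega>) \<in> C n (snd (f i))"
                    using a[rule_format, of i] il by simp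
                  moreover have "(Ss (fst (f l)) \<omega>, Xs (fst (f l)) \<omega>) \<in> C n (snd (f l))"
                    using a[rule_format, of l] il by simp
                  ultimately show False using disj by blast
                qed
                then show ?thesis unfolding rect[OF f] by blast
              qed
              then show ?thesis unfolding A_def by (simp only: measure_empty if_cancel)
            qed (simp add: A_def)
            then show ?thesis using qK by simp
          qed
          have lo: "exp (- \<epsilon>) * (\<Prod>i<j. q n (snd (f i))) \<le> A j n f" if KJ: "K = {..<j}"
          proof -
            \<comment> \<open>Separation is a strict inequality, so separated positions have
              different times.\<close>
            have ifst: "inj_on (\<lambda>i. fst (f i)) {..<j}"
              using s unfolding KJ separated_def inj_on_def by fastforce
            then have if': "inj_on f {..<j}" by (auto simp: inj_on_def)
            have "exp (- \<epsilon>) * (\<Prod>i<j. q n (snd (f i))) \<le> exp (- (4 * 4 ^ card K * ?\<eta> * (b n)\<^sup>2)) * (\<Prod>i<j. q n (snd (f i)))"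
              using expo qK unfolding KJ by (intro mult_right_mono) auto
            also have "\<dots> \<le> prob {\<omega>\<in>space M. \<forall>i\<in>{..<j}. (Ss (fst (f i)) \<omega>, Xs (fst (f i)) \<omega>) \<in> C n (snd (f i))}"
              unfolding q_def KJ
              by (rule joint_lower[OF facts0, where k = "\<lambda>i. fst (f i)"])
                (use ifst mark Cm Cb c \<eta>0 \<eta>1 b1 KJ in auto)
            finally show ?thesis using if' by (simp add: A_def rect[OF f])
          qed
          show "A j n f \<le> exp \<epsilon> * ((\<Prod>i\<in>K. q n (snd (f i))) * (real n powr - \<delta>) ^ (j - card K)) \<and>
            (K = {..<j} \<longrightarrow> exp (- \<epsilon>) * (\<Prod>i<j. q n (snd (f i))) \<le> A j n f)" using up lo by blast
        qed
      qed
    qed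
    show "\<forall>\<^sub>F n in sequentially. \<forall>f\<in>{..<j} \<rightarrow>\<^sub>E marked_indices n. separated (gap n) f {..<j} \<longrightarrow>
      exp (- \<epsilon>) * (\<Prod>i<j. q n (snd (f i))) \<le> A j n f \<and> A j n f \<le> exp \<epsilon> * (\<Prod>i<j. q n (snd (f i)))" if "0 < \<epsilon>" for \<epsilon>
      using key[OF that]
    proof eventually_elim
      case (elim n)
      show ?case
      proof (intro ballI impI)
        fix f assume f: "f \<in> {..<j} \<rightarrow>\<^sub>E marked_indices n" and s: "separated (gap n) f {..<j}"
        from elim[rule_format, OF f subset_refl s]
        show "exp (- \<epsilon>) * (\<Prod>i<j. q n (snd (f i))) \<le> A j n f \<and> A j n f \<le> exp \<epsilon> * (\<Prod>i<j. q n (snd (f i)))" by simp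
      qed
    qed
    \<comment> \<open>The factor 2 of the cluster bound is \<open>exp \<epsilon>\<close> at
      \<open>\<epsilon> = ln 2\<close>.\<close>
    have ln2: "exp (ln 2) = (2 :: real)" by simp
    show "\<forall>\<^sub>F n in sequentially. \<forall>K\<subseteq>{..<j}. \<forall>f\<in>{..<j} \<rightarrow>\<^sub>E marked_indices n. separated (gap n) f K \<longrightarrow>
      A j n f \<le> 2 * ((\<Prod>i\<in>K. q n (snd (f i))) * (real n powr - \<delta>) ^ (j - card K))"
      using key[of "ln 2"] unfolding ln2 by (rule eventually_mono) (simp, blast)
  qed (use \<delta> gap q_lim in \<open>auto simp: q_def A_def\<close>)

  define V where "V = point_law x"
  \<comment> \<open>The limit is realised canonically: \<open>Q\<close> is the law itself, and the
    process on it is the identity.\<close>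
  define Q where "Q = mixed_law bivariate_space (intensity_mass x) V"
  have R'sub: "R' n \<omega> \<subseteq> marked_indices n" for n \<omega> by (auto simp: R'_def marked_indices_def)
  have R'm: "{\<omega>\<in>space M. a \<in> R' n \<omega>} \<in> events" for n a
  proof (cases "a \<in> marked_indices n")
    case True
    then have a: "1 \<le> fst a" by (auto simp: marked_indices_def)
    note [measurable] = Ssm[OF a] Xsm[OF a]
    have "{\<omega>\<in>space M. a \<in> R' n \<omega>} = {\<omega>\<in>space M. u n (x (snd a)) < xi (snd a) (Ss (fst a) \<omega> * Xs (fst a) \<omega>)}"
      using True by (auto simp: R'_def marked_indices_def)
    also have "\<dots> \<in> events" unfolding xi_def by measurable
    finally show ?thesis .
  next
    case False
    then have "{\<omega>\<in>space M. a \<in> R' n \<omega>} = {}" using R'sub by blast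
    then show ?thesis by (simp only: sets.empty_sets)
  qed
  have ex_eq: "exceedances u x (\<lambda>i. Ss i \<omega> * Xs i \<omega>) n = point_sum bivariate_space (R' n \<omega>) (rescale n)" for n \<omega>
    unfolding exceedances_eq_point_sum R'_def by (simp add: rescale_def[abs_def] split_def)
  note ev_set = finite_random_set_event[OF finite_marked_indices]
  have meas: "(\<lambda>\<omega>. point_sum bivariate_space (R' n \<omega>) (rescale n)) \<in> M \<rightarrow>\<^sub>M borel_algebra_of (vague_topology bivariate_space)" for n
    unfolding borel_algebra_of_def
  proof (rule measurable_measure_of)
    show "(\<lambda>\<omega>. point_sum bivariate_space (R' n \<omega>) (rescale n)) \<in> space M \<rightarrow> topspace (vague_topology bivariate_space)"
      using exceedances_point_measure by (auto simp: topspace_vague ex_eq[symmetric])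
    fix U assume "U \<in> {U. openin (vague_topology bivariate_space) U}"
    show "(\<lambda>\<omega>. point_sum bivariate_space (R' n \<omega>) (rescale n)) -` U \<inter> space M \<in> events"
      using ev_set[where P = "\<lambda>B. point_sum bivariate_space B (rescale n) \<in> U", OF R'sub R'm] by (simp add: vimage_def Int_def conj_commute)
  qed (auto dest: openin_subset)
  have conv: "(\<lambda>n. LINT \<omega>|M. h (point_sum bivariate_space (R' n \<omega>) (rescale n))) \<longlonglongrightarrow> (LINT \<nu>|Q. h \<nu>)"
    if h: "continuous_map (vague_topology bivariate_space) euclideanreal h" and c: "\<And>\<nu>. \<nu> \<in> point_measures bivariate_space \<Longrightarrow> \<bar>h \<nu>\<bar> \<le> c" for h c
  proof -
    have l: "(\<lambda>n. LINT \<omega>|M. h (point_sum bivariate_space (R n \<omega>) (rescale n))) \<longlonglongrightarrow> (LINT \<nu>|Q. h \<nu>)"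
      unfolding Q_def V_def
      by (rule point_sum_converges[OF h c M _ Rm]) (use star in \<open>auto simp: R_def A_def\<close>)
    \<comment> \<open>Off \<open>?Bad\<close> the sets \<open>R'\<close> and \<open>R\<close>
      coincide; on it the functionals differ by at most \<open>2 * c\<close>, and the union bound
      gives it probability at most \<open>2 / n\<close>.\<close>
    have d: "\<bar>(LINT \<omega>|M. h (point_sum bivariate_space (R' n \<omega>) (rescale n))) - (LINT \<omega>|M. h (point_sum bivariate_space (R n \<omega>) (rescale n)))\<bar> \<le> 2 * c * (2 / real n)" if n: "1 \<le> n" for n
    proof -
      let ?h = "\<lambda>B. h (point_sum bivariate_space B (rescale n))"
      let ?Bad = "\<Union>i\<in>{1..n}. {\<omega>\<in>space M. Xs i \<omega> \<in> {z. b n < \<bar>z\<bar>}}"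
      have bs: "{z. b n < \<bar>z\<bar>} \<in> sets borel" by measurable
      have Bi: "{\<omega>\<in>space M. Xs i \<omega> \<in> {z. b n < \<bar>z\<bar>}} \<in> events" if "i \<in> {1..n}" for i
        using measurable_sets[OF Xsm bs, of i] that by (simp add: vimage_def Int_def conj_commute)
      have Bad: "?Bad \<in> events" using Bi by (intro sets.finite_UN) auto
      have hc: "\<bar>?h B\<bar> \<le> c" if "B \<subseteq> marked_indices n" for B
        using that rescale_in_space by (intro c point_sum_in_point_measures) (auto intro: finite_subset[OF that])
      have hm: "(\<lambda>\<omega>. ?h (T \<omega>)) \<in> borel_measurable M"
        if "\<And>\<omega>. T \<omega> \<subseteq> marked_indices n" "\<And>a. {\<omega>\<in>space M. a \<in> T \<omega>} \<in> events" for T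
      proof (rule measurableI)
        fix D :: "real set" assume "D \<in> sets borel"
        show "(\<lambda>\<omega>. ?h (T \<omega>)) -` D \<inter> space M \<in> events"
          using ev_set[where P = "\<lambda>B. ?h B \<in> D", OF that] by (simp add: vimage_def Int_def conj_commute)
      qed simp
      have Rsub: "R n \<omega> \<subseteq> marked_indices n" for \<omega> by (auto simp: R_def)
      have i: "integrable M (\<lambda>\<omega>. ?h (R' n \<omega>))" "integrable M (\<lambda>\<omega>. ?h (R n \<omega>))"
        using hc R'sub Rsub hm[OF R'sub R'm] hm[OF Rsub Rm] by (auto intro!: integrable_const_bound[of _ c])
      have pt: "\<bar>?h (R' n \<omega>) - ?h (R n \<omega>)\<bar> \<le> 2 * c * indicator ?Bad \<omega>" if \<omega>: "\<omega> \<in> space M" for \<omega>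
      proof (cases "\<omega> \<in> ?Bad")
        case True
        then show ?thesis using hc[OF R'sub] hc[OF Rsub, of \<omega>] abs_triangle_ineq4[of "?h (R' n \<omega>)" "?h (R n \<omega>)"]
          by (smt (verit) indicator_simps(1) mult_cancel_left1)
      next
        case False
        then have "\<bar>Xs i \<omega>\<bar> \<le> b n" if "i \<in> {1..n}" for i using \<omega> that by force
        then have "R' n \<omega> = R n \<omega>"
          by (auto simp: R_def R'_def C_def exceedance_region_def marked_indices_def)
        then show ?thesis using False by simp
      qed
      have "\<bar>(LINT \<omega>|M. ?h (R' n \<omega>)) - (LINT \<omega>|M. ?h (R n \<omega>))\<bar> = \<bar>LINT \<omega>|M. ?h (R' n \<omega>) - ?h (R n \<omega>)\<bar>"
        using i by simp
      also have "\<dots> \<le> (LINT \<omega>|M. 2 * c * indicator ?Bad \<omega>)"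
        using i Bad pt
        by (intro order_trans[OF integral_abs_bound integral_mono])
          (auto intro!: integrable_abs integrable_mult_right integrable_real_indicator simp: emeasure_eq_measure)
      also have "\<dots> = 2 * c * prob ?Bad" using Bad by (simp add: Int_absorb2 sets.sets_into_space)
      also have "\<dots> \<le> 2 * c * (2 / real n)"
      proof (rule mult_left_mono)
        have "prob ?Bad \<le> (\<Sum>i\<in>{1..n}. prob {\<omega>\<in>space M. Xs i \<omega> \<in> {z. b n < \<bar>z\<bar>}})"
          using Bi by (intro finite_measure_subadditive_finite) auto
        also have "\<dots> = real n * measure std_normal_distribution {z. b n < \<bar>z\<bar>}"
          using normal_event[OF Xsd bs] by simp
        also note big[OF n]
        finally show "prob ?Bad \<le> 2 / real n" .
        show "0 \<le> 2 * c" using hc[of "{}"] by simp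
      qed
      finally show ?thesis .
    qed
    have "(\<lambda>n. (LINT \<omega>|M. h (point_sum bivariate_space (R' n \<omega>) (rescale n))) - (LINT \<omega>|M. h (point_sum bivariate_space (R n \<omega>) (rescale n)))) \<longlonglongrightarrow> 0"
    proof (rule Lim_null_comparison)
      show "\<forall>\<^sub>F n in sequentially. norm ((LINT \<omega>|M. h (point_sum bivariate_space (R' n \<omega>) (rescale n))) - (LINT \<omega>|M. h (point_sum bivariate_space (R n \<omega>) (rescale n)))) \<le> 2 * c * (2 / real n)"
        using eventually_ge_at_top[of 1] by eventually_elim (use d in simp)
      show "(\<lambda>n. 2 * c * (2 / real n)) \<longlonglongrightarrow> 0" using tendsto_mult[OF tendsto_const lim_const_over_n[of 2], of "2 * c"] by simp
    qed
    from tendsto_add[OF this l] show ?thesis by simp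
  qed
  have pp: "poisson_process Q bivariate_space (intensity x) (\<lambda>\<nu>. \<nu>)"
    unfolding Q_def V_def
    by (rule poisson_process_mixed_law[OF prob_point_law sets_point_law intensity_mass_pos measure_intensity])
  have "prob_space Q"
    unfolding Q_def V_def by (rule prob_mixed_law[OF prob_point_law sets_point_law intensity_mass_pos])
  moreover have "converges_in_distribution (vague_topology bivariate_space)
             M (\<lambda>n \<omega>. exceedances u x (\<lambda>i. Ss i \<omega> * Xs i \<omega>) n) Q (\<lambda>\<nu>. \<nu>)"
    unfolding converges_in_distribution_def ex_eq
  proof (intro conjI allI impI)
    show "(\<lambda>\<nu>. \<nu>) \<in> Q \<rightarrow>\<^sub>M borel_algebra_of (vague_topology bivariate_space)"
      using pp unfolding poisson_process_def by blast
    fix h assume h: "continuous_map (vague_topology bivariate_space) euclideanreal h \<and>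
      (\<exists>c. \<forall>\<nu>\<in>topspace (vague_topology bivariate_space). \<bar>h \<nu>\<bar> \<le> c)"
    then obtain c where c: "\<forall>\<nu>\<in>point_measures bivariate_space. \<bar>h \<nu>\<bar> \<le> c"
      unfolding topspace_vague by blast
    show "(\<lambda>n. LINT \<omega>|M. h (point_sum bivariate_space (R' n \<omega>) (rescale n))) \<longlonglongrightarrow> (LINT \<nu>|Q. h \<nu>)"
      by (rule conv[of h c]) (use h c in auto)
  qed (rule meas)
  ultimately show ?thesis using pp by blast
qed

end
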